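(* Let $v$ be either an even integer with $v\ge 42$ or an odd integer with $v\ge 29$, let $t$ be a divisor of $v$, let $\lambda$ be a positive integer, and let $n\ge k\ge 3$ be odd integers such that $v=\frac{2nk}{\lambda}+t$ and such that at least one of the following holds: (1) $\gcd(n,k-1)=1$; (2) $3<k<200$; (3) $n\ge (k-2)(k-1)$. Then there exists a cellular biembedding of the multigraph ${}^\lambda K_{(\frac{2nk}{\lambda t}+1)\times t}$ into an orientable surface whose face lengths are multiples of $k$ strictly larger than $k$.
   Context: For positive integers $p,t,\lambda$, ${}^\lambda K_{p\times t}$ denotes the complete multipartite multigraph with $p$ parts each of size $t$, in which any two vertices lying in different parts are joined by exactly $\lambda$ parallel edges (and vertices in the same part are not adjacent). A multigraph is viewed as a topological space via the topology induced by any simple graph that is a subdivision of it (a simple graph being a 1-dimensional simplicial complex). An embedding of a multigraph $\Gamma$ in a surface $\Sigma$ is a continuous injective map $\psi:\Gamma\to\Sigma$; its faces are the connected components of $\Sigma\setminus\psi(\Gamma)$; it is cellular if every face is homeomorphic to an open disc; it is a biembedding if its faces can be properly 2-coloured (faces sharing an edge receive different colours). The length of a face is the length of its boundary walk. *)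

theory Defs
  imports "HOL-Complex_Analysis.Complex_Analysis"
begin

section \<open>Multigraphs and their topological realization\<close>

record ('v, 'e) multigraph =
  verts :: "'v set"
  edges :: "'e set"
  ends :: "'e \<Rightarrow> 'v set"

text \<open>
  The complete multipartite multigraph with \<open>p\<close> parts of size \<open>t\<close> and edge multiplicity \<open>lam\<close>.
  The vertex \<open>(i, j)\<close> is the \<open>j\<close>-th vertex of the \<open>i\<close>-th part; the edge \<open>({x, y}, m)\<close> is the
  \<open>m\<close>-th of the \<open>lam\<close> parallel edges joining \<open>x\<close> and \<open>y\<close>.
\<close>
definition complete_multipartite ::
  "nat \<Rightarrow> nat \<Rightarrow> nat \<Rightarrow> (nat \<times> nat, (nat \<times> nat) set \<times> nat) multigraph" where
  "complete_multipartite lam p t =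
    \<lparr> verts = {0..<p} \<times> {0..<t},
      edges = {{x, y} | x y. x \<in> {0..<p} \<times> {0..<t} \<and> y \<in> {0..<p} \<times> {0..<t} \<and> fst x \<noteq> fst y}
              \<times> {0..<lam},
      ends = fst \<rparr>"

text \<open>
  Bisecting every edge of a loopless multigraph gives a simple graph that is a subdivision of it;
  its vertex set is the disjoint sum of the vertices and the edges (the latter standing for
  their midpoints).  The following are the simplices of this graph, and \<open>realization\<close> is its
  geometric realization in barycentric coordinates.  It is used with the subspace
  topology inherited from the product topology on functions into the reals; for finite graphs this
  is the usual topology of the simplicial complex.
\<close>
definition subdivision_simplices :: "('v, 'e) multigraph \<Rightarrow> ('v + 'e) set set" where
  "subdivision_simplices G =
    {{Inl v} | v. v \<in> verts G} \<union> {{Inr e} | e. e \<in> edges G} \<union>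
    {{Inl v, Inr e} | v e. e \<in> edges G \<and> v \<in> ends G e}"

definition realization :: "('v, 'e) multigraph \<Rightarrow> ('v + 'e \<Rightarrow> real) set" where
  "realization G =
    {x. (\<forall>w. 0 \<le> x w) \<and>
        (\<exists>S \<in> subdivision_simplices G. (\<forall>w. w \<notin> S \<longrightarrow> x w = 0) \<and> (\<Sum>w\<in>S. x w) = 1)}"

definition vertex_points :: "('v, 'e) multigraph \<Rightarrow> ('v + 'e \<Rightarrow> real) set" where
  "vertex_points G = {x \<in> realization G. \<exists>v \<in> verts G. x (Inl v) = 1}"

text \<open>The edge \<open>e\<close> without its end points: the midpoint \<open>Inr e\<close> has nonzero barycentric
  coordinate exactly on the interiors of the two halves of \<open>e\<close> and at the midpoint itself.\<close>
definition open_edge :: "('v, 'e) multigraph \<Rightarrow> 'e \<Rightarrow> ('v + 'e \<Rightarrow> real) set" where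
  "open_edge G e = {x \<in> realization G. 0 < x (Inr e)}"


section \<open>Surfaces\<close>

text \<open>Surfaces are closed (compact, without boundary) connected topological 2-manifolds.\<close>
definition closed_surface :: "'a topology \<Rightarrow> bool" where
  "closed_surface X \<longleftrightarrow>
    topspace X \<noteq> {} \<and> compact_space X \<and> connected_space X \<and>
    Hausdorff_space X \<and> second_countable X \<and>
    (\<forall>x \<in> topspace X. \<exists>U (V :: complex set).
       openin X U \<and> x \<in> U \<and> open V \<and>
       (subtopology X U) homeomorphic_space (top_of_set V))"

text \<open>For an injective continuous map on an open set of the plane: small circles are mapped to
  closed curves winding once counterclockwise, that is, the local degree is everywhere 1.\<close>
definition orientation_preserving_on :: "complex set \<Rightarrow> (complex \<Rightarrow> complex) \<Rightarrow> bool" where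
  "orientation_preserving_on D f \<longleftrightarrow>
    (\<forall>z r. 0 < r \<longrightarrow> cball z r \<subseteq> D \<longrightarrow> winding_number (f \<circ> circlepath z r) (f z) = 1)"

text \<open>An oriented atlas is a set of charts, given as a domain and a coordinate map, all of whose
  transition maps preserve the orientation of the plane.\<close>
definition oriented_atlas :: "'a topology \<Rightarrow> ('a set \<times> ('a \<Rightarrow> complex)) set \<Rightarrow> bool" where
  "oriented_atlas X A \<longleftrightarrow>
    (\<forall>(U, h) \<in> A. openin X U \<and> open (h ` U) \<and>
       homeomorphic_map (subtopology X U) (top_of_set (h ` U)) h) \<and>
    (\<Union>(U, h) \<in> A. U) = topspace X \<and>
    (\<forall>(U, h) \<in> A. \<forall>(U', h') \<in> A.
       orientation_preserving_on (h ` (U \<inter> U')) (h' \<circ> inv_into U h))"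

definition orientable :: "'a topology \<Rightarrow> bool" where
  "orientable X \<longleftrightarrow> (\<exists>A. oriented_atlas X A)"


section \<open>Embeddings\<close>

definition embedding ::
  "('v, 'e) multigraph \<Rightarrow> 'a topology \<Rightarrow> (('v + 'e \<Rightarrow> real) \<Rightarrow> 'a) \<Rightarrow> bool" where
  "embedding G X \<psi> \<longleftrightarrow>
    continuous_map (top_of_set (realization G)) X \<psi> \<and> inj_on \<psi> (realization G)"

definition faces ::
  "('v, 'e) multigraph \<Rightarrow> 'a topology \<Rightarrow> (('v + 'e \<Rightarrow> real) \<Rightarrow> 'a) \<Rightarrow> 'a set set" where
  "faces G X \<psi> = connected_components_of (subtopology X (topspace X - \<psi> ` realization G))"

definition cellular ::
  "('v, 'e) multigraph \<Rightarrow> 'a topology \<Rightarrow> (('v + 'e \<Rightarrow> real) \<Rightarrow> 'a) \<Rightarrow> bool" where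
  "cellular G X \<psi> \<longleftrightarrow>
    (\<forall>F \<in> faces G X \<psi>. (subtopology X F) homeomorphic_space (top_of_set (ball (0::complex) 1)))"

definition faces_at ::
  "('v, 'e) multigraph \<Rightarrow> 'a topology \<Rightarrow> (('v + 'e \<Rightarrow> real) \<Rightarrow> 'a) \<Rightarrow> 'e \<Rightarrow> 'a set set" where
  "faces_at G X \<psi> e = {F \<in> faces G X \<psi>. \<psi> ` open_edge G e \<subseteq> X closure_of F}"

text \<open>An edge of a cellular embedding lies on at most two faces.  An edge both of whose sides lie
  on one and the same face counts as that face sharing an edge with itself, so it rules out a
  proper colouring (the dual graph would have a loop).\<close>
definition biembedding ::
  "('v, 'e) multigraph \<Rightarrow> 'a topology \<Rightarrow> (('v + 'e \<Rightarrow> real) \<Rightarrow> 'a) \<Rightarrow> bool" where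
  "biembedding G X \<psi> \<longleftrightarrow>
    embedding G X \<psi> \<and>
    (\<exists>c :: 'a set \<Rightarrow> bool. \<forall>e \<in> edges G. \<exists>F F'. faces_at G X \<psi> e = {F, F'} \<and> c F \<noteq> c F')"

text \<open>
  The closed walk \<open>es\<close> (listed by its edges) is a boundary walk of the face \<open>F\<close>: there is
  a map of the closed unit disc that is a homeomorphism from the open disc onto \<open>F\<close> and whose
  restriction to the unit circle, divided into \<open>length es\<close> equal arcs, traverses the edges
  of \<open>es\<close> one after the other.  An edge with both sides on \<open>F\<close> occurs twice in \<open>es\<close>.  Graphs
  without edges are not catered for.
\<close>
definition boundary_walk ::
  "('v, 'e) multigraph \<Rightarrow> 'a topology \<Rightarrow> (('v + 'e \<Rightarrow> real) \<Rightarrow> 'a) \<Rightarrow> 'a set \<Rightarrow> 'e list \<Rightarrow> bool" where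
  "boundary_walk G X \<psi> F es \<longleftrightarrow>
    es \<noteq> [] \<and> set es \<subseteq> edges G \<and>
    (\<exists>\<phi> :: complex \<Rightarrow> 'a.
       continuous_map (top_of_set (cball 0 1)) X \<phi> \<and>
       homeomorphic_map (top_of_set (ball 0 1)) (subtopology X F) \<phi> \<and>
       (\<forall>i < length es.
          \<phi> (cis (2 * pi * real i / real (length es))) \<in> \<psi> ` vertex_points G \<and>
          bij_betw \<phi>
            (cis ` {2 * pi * real i / real (length es) <..<
                    2 * pi * real (Suc i) / real (length es)})
            (\<psi> ` open_edge G (es ! i))))"

definition has_face_length ::
  "('v, 'e) multigraph \<Rightarrow> 'a topology \<Rightarrow> (('v + 'e \<Rightarrow> real) \<Rightarrow> 'a) \<Rightarrow> 'a set \<Rightarrow> nat \<Rightarrow> bool" where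
  "has_face_length G X \<psi> F l \<longleftrightarrow> (\<exists>es. boundary_walk G X \<psi> F es \<and> length es = l)"

text \<open>A surface has the cardinality of the continuum, so up to homeomorphism every surface has a
  carrier consisting of elements of the following type.\<close>
type_synonym surface_point = "nat \<times> complex"

end

theory Submission
  imports Defs "HOL-Combinatorics.Orbits"
begin

text \<open>
  It suffices to find a biembedding with only two faces, both of length \<open>v * n * k\<close>, the
  number of edges. The degree of the multigraph is \<open>2 * d\<close> with \<open>d = n * k\<close> odd. Orient it with
  all in- and out-degrees equal to \<open>d\<close> and take an Euler circuit \<open>P\<close>, seen as a cyclic permutation of
  the edges. For each vertex in turn, compose the current circuit with the first return map
  to the \<open>d\<close> edges leaving that vertex; since \<open>d\<close> is odd, the square of a \<open>d\<close>-cycle is a \<open>d\<close>-cycle, so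
  the result is again an Euler circuit. This ends with a second circuit \<open>Q\<close> such that \<open>Q\<close>
  composed with the inverse of \<open>P\<close> is a single cycle at every vertex. Hence a disc bounded by \<open>P\<close> and
  a disc bounded by the reverse of \<open>Q\<close> glue to a closed surface: it is a covering of the Riemann
  sphere branched over \<open>0\<close>, \<open>\<infinity>\<close> (the two face centres) and \<open>1\<close> (the vertices), so it is a
  Riemann surface and therefore orientable.
\<close>

section \<open>Gluing charts holomorphically\<close>

text \<open>The number of edges \<open>v * n * k\<close> is a multiple of \<open>k\<close> exceeding
  \<open>k\<close>, and two faces are properly 2-coloured as soon as every edge borders both. Gluing
  polygons would leave orientability, a statement about winding numbers, to be checked by hand at
  edges and vertices; logarithmic coordinates avoid this. With \<open>z = exp s\<close> on the
  sphere, a punctured face is a half plane in \<open>s\<close>, cut into horizontal strips of height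
  \<open>2 * pi\<close>, one per edge, taken modulo \<open>N\<close> strips. Sheets are cut along
  the positive real axis: \<open>P\<close> tells which sheet follows when \<open>z\<close> crosses
  (0, 1) upwards, \<open>Q\<close> when it crosses (1, infinity) upwards. An edge is the lift of the
  unit circle without 1 to one sheet, with the black face inside and the white face outside. Near a
  vertex the covering is \<open>u \<mapsto> exp (u ^ d)\<close> rather than
  \<open>1 + u ^ d\<close>, because the face coordinate is then \<open>u ^ d\<close> itself up to a
  period. All transition maps thus come from exponentials; they are injective and holomorphic, hence
  of local degree 1.\<close>

lemma orientation_preserving_on_holomorphic:
  assumes "open D" and f: "f holomorphic_on D" and inj: "inj_on f D"
  shows "orientation_preserving_on D f"
  unfolding orientation_preserving_on_def
proof (intro allI impI)
  fix z and r :: real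
  assume r: "0 < r" and sub: "cball z r \<subseteq> D"
  \<comment> \<open>The difference quotient of \<open>f\<close> at \<open>z\<close>, with the
    singularity removed. It has no zero because \<open>f\<close> is injective, and
    \<open>f' / (f - f z) = (f' / h) / (w - z)\<close> turns the winding number into a Cauchy
    integral with value \<open>f' z / h z = 1\<close>.\<close>
  define h where "h = (\<lambda>w. if w = z then deriv f z else (f w - f z) / (w - z))"
  have zD: "z \<in> D" using sub r by auto
  have h: "h holomorphic_on D"
    unfolding h_def by (rule pole_lemma_open[OF f \<open>open D\<close>])
  have h0: "h w \<noteq> 0" if "w \<in> D" for w
    using that zD inj holomorphic_injective_imp_regular[OF f \<open>open D\<close> inj zD]
    by (auto simp: h_def inj_on_def)
  have hf: "f w - f z = (w - z) * h w" if "w \<noteq> z" for w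
    using that by (simp add: h_def)
  have path: "path_image (circlepath z r) \<subseteq> D" "z \<notin> path_image (circlepath z r)"
  proof -
    have *: "path_image (circlepath z r) = sphere z r"
      using r by (simp add: path_image_circlepath_nonneg)
    show "path_image (circlepath z r) \<subseteq> D"
      unfolding * using sub sphere_cball by blast
    show "z \<notin> path_image (circlepath z r)"
      unfolding * using r by simp
  qed
  have ana: "f analytic_on D"
    using f \<open>open D\<close> by (simp add: analytic_on_open)
  have valid: "valid_path (f \<circ> circlepath z r)"
    by (rule valid_path_compose_analytic[OF _ ana path(1)]) simp
  have notin: "f z \<notin> path_image (f \<circ> circlepath z r)"
    unfolding path_image_compose using path inj_onD[OF inj _ zD] by blast
  have "winding_number (f \<circ> circlepath z r) (f z) =
        1 / (2 * pi * \<i>) * contour_integral (f \<circ> circlepath z r) (\<lambda>w. 1 / (w - f z))"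
    by (rule winding_number_valid_path[OF valid notin])
  also have "contour_integral (f \<circ> circlepath z r) (\<lambda>w. 1 / (w - f z)) =
      contour_integral (circlepath z r) (\<lambda>w. deriv f w * (1 / (f w - f z)))"
    by (rule contour_integral_comp_analyticW[OF ana _ path(1)]) simp
  also have "\<dots> = contour_integral (circlepath z r) (\<lambda>w. (deriv f w / h w) / (w - z))"
  proof (rule contour_integral_eq)
    fix w assume "w \<in> path_image (circlepath z r)"
    then have "w \<noteq> z" using path by auto
    then show "deriv f w * (1 / (f w - f z)) = (deriv f w / h w) / (w - z)"
      by (simp add: hf)
  qed
  also have "\<dots> = 2 * of_real pi * \<i> * (deriv f z / h z)"
  proof (rule contour_integral_unique, rule Cauchy_integral_circlepath_simple)
    show "(\<lambda>w. deriv f w / h w) holomorphic_on cball z r"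
      by (rule holomorphic_on_subset[OF _ sub])
        (intro holomorphic_intros holomorphic_deriv f h h0 \<open>open D\<close>)
  qed (use r in auto)
  also have "deriv f z / h z = 1"
    using h0[OF zD] by (simp add: h_def)
  also have "1 / (2 * pi * \<i>) * (2 * of_real pi * \<i> * 1) = 1"
    by simp
  finally show "winding_number (f \<circ> circlepath z r) (f z) = 1" .
qed

text \<open>Overlaps are described by a common parameter \<open>s\<close> with two holomorphic maps
  \<open>a\<close> and \<open>b\<close> instead of a transition map: with exponentials for
  \<open>a\<close> and \<open>b\<close>, no branch of a logarithm or root has to be chosen.\<close>

locale holomorphic_gluing =
  fixes I :: "'i set" and V :: "'i \<Rightarrow> complex set" and \<phi> :: "'i \<Rightarrow> complex \<Rightarrow> 'a"
  assumes finite_I: "finite I"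
    and open_V: "i \<in> I \<Longrightarrow> open (V i)"
    and inj: "i \<in> I \<Longrightarrow> inj_on (\<phi> i) (V i)"
    and overlap: "\<lbrakk>i \<in> I; k \<in> I; z \<in> V i; y \<in> V k; \<phi> i z = \<phi> k y\<rbrakk> \<Longrightarrow>
      \<exists>S a b s. open S \<and> s \<in> S \<and> a s = z \<and> b s = y \<and> a holomorphic_on S \<and> b holomorphic_on S \<and>
        inj_on a S \<and> a ` S \<subseteq> V i \<and> b ` S \<subseteq> V k \<and> (\<forall>s\<in>S. \<phi> i (a s) = \<phi> k (b s))"
begin

definition carrier :: "'a set" where
  "carrier = (\<Union>i\<in>I. \<phi> i ` V i)"

definition glued :: "'a topology" where
  "glued = topology (\<lambda>U. U \<subseteq> carrier \<and> (\<forall>i\<in>I. open {z \<in> V i. \<phi> i z \<in> U}))"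

lemma openin_glued: "openin glued U \<longleftrightarrow> U \<subseteq> carrier \<and> (\<forall>i\<in>I. open {z \<in> V i. \<phi> i z \<in> U})"
proof -
  have "istopology (\<lambda>U. U \<subseteq> carrier \<and> (\<forall>i\<in>I. open {z \<in> V i. \<phi> i z \<in> U}))"
  proof (unfold istopology_def, intro conjI allI impI ballI)
    fix S T :: "'a set" and i
    assume S: "S \<subseteq> carrier \<and> (\<forall>i\<in>I. open {z \<in> V i. \<phi> i z \<in> S})"
      and T: "T \<subseteq> carrier \<and> (\<forall>i\<in>I. open {z \<in> V i. \<phi> i z \<in> T})"
    show "S \<inter> T \<subseteq> carrier" using S by auto
    assume i: "i \<in> I"
    have "{z \<in> V i. \<phi> i z \<in> S \<inter> T} = {z \<in> V i. \<phi> i z \<in> S} \<inter> {z \<in> V i. \<phi> i z \<in> T}" by auto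
    then show "open {z \<in> V i. \<phi> i z \<in> S \<inter> T}" using S T i by auto
  next
    fix K :: "'a set set" and i
    assume K: "\<forall>S\<in>K. S \<subseteq> carrier \<and> (\<forall>i\<in>I. open {z \<in> V i. \<phi> i z \<in> S})"
    show "\<Union> K \<subseteq> carrier" using K by auto
    assume i: "i \<in> I"
    have "{z \<in> V i. \<phi> i z \<in> \<Union> K} = (\<Union>S\<in>K. {z \<in> V i. \<phi> i z \<in> S})" by auto
    then show "open {z \<in> V i. \<phi> i z \<in> \<Union> K}" using K i by auto
  qed
  then show ?thesis by (simp add: glued_def)
qed

text \<open>The transition map is \<open>b\<close> after the inverse of \<open>a\<close>, which is
  holomorphic because \<open>a\<close> is injective; \<open>b\<close> inherits injectivity from
  \<open>a\<close> through the injective chart \<open>\<phi> i\<close>.\<close>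

lemma overlap_holomorphic_inverse:
  assumes "i \<in> I" "k \<in> I" "z \<in> V i" "y \<in> V k" "\<phi> i z = \<phi> k y"
  obtains W T where "open W" "z \<in> W" "W \<subseteq> V i" "T holomorphic_on W" "inj_on T W"
    "T ` W \<subseteq> V k" "T z = y" "\<And>w. w \<in> W \<Longrightarrow> \<phi> i w = \<phi> k (T w)"
proof -
  obtain S a b s where S: "open S" "s \<in> S" "a s = z" "b s = y" "a holomorphic_on S"
    "b holomorphic_on S" "inj_on a S" "a ` S \<subseteq> V i" "b ` S \<subseteq> V k"
    "\<forall>s\<in>S. \<phi> i (a s) = \<phi> k (b s)"
    using overlap[OF assms] by blast
  have b: "inj_on b S"
  proof (rule inj_onI)
    fix s t assume st: "s \<in> S" "t \<in> S" "b s = b t"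
    then have "\<phi> i (a s) = \<phi> i (a t)" using S by metis
    then have "a s = a t" using inj_onD[OF inj[OF assms(1)]] S(8) st by blast
    then show "s = t" using inj_onD[OF S(7)] st by blast
  qed
  obtain g where g: "g holomorphic_on a ` S" "\<And>s. s \<in> S \<Longrightarrow> g (a s) = s"
    using holomorphic_has_inverse[OF S(5,1,7)] by metis
  show thesis
  proof (rule that)
    show "open (a ` S)" by (rule open_mapping_thm3[OF S(5,1,7)])
    show "(b \<circ> g) holomorphic_on (a ` S)"
      by (rule holomorphic_on_compose_gen[OF g(1) S(6)]) (auto simp: g)
    show "inj_on (b \<circ> g) (a ` S)"
      using b by (auto simp: inj_on_def g)
  qed (use S g in auto)
qed

text \<open>Seen from another chart, the image of \<open>W\<close> is locally the preimage of
  \<open>W\<close> under a continuous transition map.\<close>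

lemma openin_image:
  assumes i: "i \<in> I" and W: "open W" "W \<subseteq> V i"
  shows "openin glued (\<phi> i ` W)"
  unfolding openin_glued
proof (intro conjI ballI)
  show "\<phi> i ` W \<subseteq> carrier" using i W by (auto simp: carrier_def)
next
  fix k assume k: "k \<in> I"
  show "open {z \<in> V k. \<phi> k z \<in> \<phi> i ` W}"
  proof (subst open_subopen, intro ballI, goal_cases)
    case (1 y)
    then obtain z where z: "z \<in> W" "y \<in> V k" "\<phi> k y = \<phi> i z" by auto
    obtain W' T where T: "open W'" "y \<in> W'" "W' \<subseteq> V k" "T holomorphic_on W'"
      "T ` W' \<subseteq> V i" "T y = z" "\<And>w. w \<in> W' \<Longrightarrow> \<phi> k w = \<phi> i (T w)"
      using overlap_holomorphic_inverse[OF k i z(2) _ z(3)] z W by blast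
    have "open (W' \<inter> T -` W)"
      by (rule continuous_open_preimage[OF holomorphic_on_imp_continuous_on[OF T(4)] T(1) W(1)])
    moreover have "y \<in> W' \<inter> T -` W" "W' \<inter> T -` W \<subseteq> {z \<in> V k. \<phi> k z \<in> \<phi> i ` W}"
      using T z by auto
    ultimately show ?case by blast
  qed
qed

lemma topspace_glued [simp]: "topspace glued = carrier"
proof
  show "topspace glued \<subseteq> carrier"
    using openin_topspace[of glued] unfolding openin_glued by blast
  have "openin glued (\<phi> i ` V i)" if "i \<in> I" for i
    using openin_image[OF that open_V[OF that]] by simp
  then show "carrier \<subseteq> topspace glued"
    unfolding carrier_def using openin_subset by blast
qed

lemma continuous_map_chart:
  assumes "i \<in> I" shows "continuous_map (top_of_set (V i)) glued (\<phi> i)"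
  unfolding continuous_map_def
proof (intro conjI allI impI)
  show "\<phi> i \<in> topspace (top_of_set (V i)) \<rightarrow> topspace glued"
    using assms by (auto simp: carrier_def)
  fix U assume "openin glued U"
  then have "open {z \<in> V i. \<phi> i z \<in> U}" using assms by (simp add: openin_glued)
  then show "openin (top_of_set (V i)) {x \<in> topspace (top_of_set (V i)). \<phi> i x \<in> U}"
    using open_V[OF assms] by (auto simp: openin_open_eq)
qed

lemma continuous_map_from_glued:
  fixes f :: "'a \<Rightarrow> 'b :: topological_space"
  assumes "\<And>i. i \<in> I \<Longrightarrow> continuous_on (V i) (\<lambda>z. f (\<phi> i z))"
  shows "continuous_map glued euclidean f"
  unfolding continuous_map_def
proof (intro conjI allI impI)
  fix U :: "'b set" assume "openin euclidean U"
  then have U: "open U" by simp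
  show "openin glued {x \<in> topspace glued. f x \<in> U}"
    unfolding openin_glued
  proof (intro conjI ballI)
    fix i assume i: "i \<in> I"
    have "open (V i \<inter> (\<lambda>z. f (\<phi> i z)) -` U)"
      by (rule continuous_open_preimage[OF assms[OF i] open_V[OF i] U])
    moreover have "{z \<in> V i. \<phi> i z \<in> {x \<in> topspace glued. f x \<in> U}} = V i \<inter> (\<lambda>z. f (\<phi> i z)) -` U"
      using i by (auto simp: carrier_def)
    ultimately show "open {z \<in> V i. \<phi> i z \<in> {x \<in> topspace glued. f x \<in> U}}" by simp
  qed auto
qed auto

lemma homeomorphic_map_chart:
  assumes i: "i \<in> I" and W: "open W" "W \<subseteq> V i"
  shows "homeomorphic_map (top_of_set W) (subtopology glued (\<phi> i ` W)) (\<phi> i)"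
proof (rule bijective_open_imp_homeomorphic_map)
  show "continuous_map (top_of_set W) (subtopology glued (\<phi> i ` W)) (\<phi> i)"
    by (rule continuous_map_into_subtopology)
      (use continuous_map_from_subtopology_mono[OF continuous_map_chart[OF i] W(2)] in auto)
  show "open_map (top_of_set W) (subtopology glued (\<phi> i ` W)) (\<phi> i)"
    unfolding open_map_def
  proof (intro allI impI)
    fix U assume "openin (top_of_set W) U"
    then have "open U" "U \<subseteq> W" using W by (auto simp: openin_open_eq)
    then show "openin (subtopology glued (\<phi> i ` W)) (\<phi> i ` U)"
      using openin_image[OF i, of U] openin_image[OF i W] W
      by (auto simp: openin_open_subtopology)
  qed
  show "\<phi> i ` topspace (top_of_set W) = topspace (subtopology glued (\<phi> i ` W))"
    using i W by (auto simp: carrier_def)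
  show "inj_on (\<phi> i) (topspace (top_of_set W))"
    using inj_on_subset[OF inj[OF i] W(2)] by simp
qed

lemma locally_planar:
  assumes "x \<in> topspace glued"
  shows "\<exists>U (W :: complex set). openin glued U \<and> x \<in> U \<and> open W \<and>
    (subtopology glued U) homeomorphic_space (top_of_set W)"
proof -
  obtain i where i: "i \<in> I" "x \<in> \<phi> i ` V i" using assms by (auto simp: carrier_def)
  have "top_of_set (V i) homeomorphic_space subtopology glued (\<phi> i ` V i)"
    using homeomorphic_map_chart[OF i(1) open_V[OF i(1)]] homeomorphic_map_imp_homeomorphic_space
    by blast
  then show ?thesis
    using i openin_image[OF i(1) open_V[OF i(1)]] open_V[OF i(1)] homeomorphic_space_sym by blast
qed

lemma second_countable_glued: "second_countable glued"
proof -
  obtain B :: "complex set set" where B: "countable B" "\<And>b. b \<in> B \<Longrightarrow> open b"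
    "\<And>S x. open S \<Longrightarrow> x \<in> S \<Longrightarrow> \<exists>b\<in>B. x \<in> b \<and> b \<subseteq> S"
  proof -
    obtain B :: "complex set set" where "countable B" "topological_basis B"
      using ex_countable_basis by blast
    then show thesis
      using that topological_basis_open topological_basisE by metis
  qed
  show ?thesis
    unfolding second_countable_def
  proof (intro exI conjI ballI allI impI)
    show "countable (\<Union>i\<in>I. (\<lambda>b. \<phi> i ` b) ` {b \<in> B. b \<subseteq> V i})"
      by (rule countable_UN[OF countable_finite[OF finite_I]]) (use B in auto)
    show "openin glued U" if "U \<in> (\<Union>i\<in>I. (\<lambda>b. \<phi> i ` b) ` {b \<in> B. b \<subseteq> V i})" for U
      using that B openin_image by auto
    fix U x assume U: "openin glued U \<and> x \<in> U"
    then have "x \<in> carrier" by (auto simp: openin_glued)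
    then obtain i z where i: "i \<in> I" "z \<in> V i" "x = \<phi> i z" by (auto simp: carrier_def)
    have "open {z \<in> V i. \<phi> i z \<in> U}" using U i by (simp add: openin_glued)
    then obtain b where "b \<in> B" "z \<in> b" "b \<subseteq> {z \<in> V i. \<phi> i z \<in> U}"
      using B(3)[of _ z] U i by blast
    then show "\<exists>V\<in>\<Union>i\<in>I. (\<lambda>b. \<phi> i ` b) ` {b \<in> B. b \<subseteq> V i}. x \<in> V \<and> V \<subseteq> U"
      using i by (intro bexI[of _ "\<phi> i ` b"]) auto
  qed
qed

text \<open>The atlas consists of the inverse charts. Their transition maps are injective and agree
  locally with the holomorphic maps of \<open>overlap_holomorphic_inverse\<close>, so they preserve
  orientation.\<close>

lemma orientable_glued: "orientable glued"
  unfolding orientable_def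
proof
  define h where "h = (\<lambda>i. inv_into (V i) (\<phi> i))"
  have h: "h i (\<phi> i z) = z" if "i \<in> I" "z \<in> V i" for i z
    using inj that by (simp add: h_def)
  have himg: "h i ` \<phi> i ` V i = V i" if "i \<in> I" for i
    using h that by (auto simp: image_image)
  have inv: "inv_into (\<phi> i ` V i) (h i) z = \<phi> i z" if "i \<in> I" "z \<in> V i" for i z
  proof -
    have "inj_on (h i) (\<phi> i ` V i)" using h that by (auto simp: inj_on_def)
    then show ?thesis using that h by (metis imageI inv_into_f_f)
  qed
  have "orientation_preserving_on (h i ` (\<phi> i ` V i \<inter> \<phi> k ` V k)) (h k \<circ> inv_into (\<phi> i ` V i) (h i))"
    (is "orientation_preserving_on ?D ?f") if i: "i \<in> I" and k: "k \<in> I" for i k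
  proof (rule orientation_preserving_on_holomorphic)
    have D: "?D = {z \<in> V i. \<phi> i z \<in> \<phi> k ` V k}"
    proof (intro set_eqI iffI)
      fix z assume "z \<in> ?D"
      then obtain x where "x \<in> V i" "\<phi> i x \<in> \<phi> k ` V k" "z = h i (\<phi> i x)" by blast
      then show "z \<in> {z \<in> V i. \<phi> i z \<in> \<phi> k ` V k}" using h[OF i] by simp
    next
      fix z assume "z \<in> {z \<in> V i. \<phi> i z \<in> \<phi> k ` V k}"
      then have "z \<in> V i" "\<phi> i z \<in> \<phi> i ` V i \<inter> \<phi> k ` V k" by auto
      then show "z \<in> ?D" using h[OF i] by force
    qed
    show open_D: "open ?D"
      using openin_image[OF k open_V[OF k]] i unfolding D by (simp add: openin_glued)
    have f: "\<phi> k (?f z) = \<phi> i z \<and> ?f z \<in> V k" if "z \<in> ?D" for z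
      using that inv[OF i] h[OF k] by (auto simp: D)
    show "inj_on ?f ?D"
      using f inj[OF i] unfolding D inj_on_def by (metis (lifting) mem_Collect_eq)
    show "?f holomorphic_on ?D"
      unfolding holomorphic_on_def
    proof
      fix z assume z: "z \<in> ?D"
      obtain W T where T: "open W" "z \<in> W" "W \<subseteq> V i" "T holomorphic_on W"
        "T ` W \<subseteq> V k" "\<And>w. w \<in> W \<Longrightarrow> \<phi> i w = \<phi> k (T w)"
        using overlap_holomorphic_inverse[OF i k, of z "?f z"] f[OF z] z
        by (metis (lifting) D mem_Collect_eq)
      have "T w = ?f w" if "w \<in> W" for w
        using that T inv[OF i] h[OF k] by (metis comp_apply image_subset_iff subsetD)
      then have "?f holomorphic_on W"
        using holomorphic_transform[OF T(4)] by blast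
      then have "?f field_differentiable at z"
        using T(1,2) holomorphic_on_imp_differentiable_at by blast
      then show "?f field_differentiable at z within ?D"
        by (rule field_differentiable_at_within)
    qed
  qed
  moreover have "homeomorphic_map (subtopology glued (\<phi> i ` V i)) (top_of_set (V i)) (h i)"
    if i: "i \<in> I" for i
  proof -
    obtain g where g: "homeomorphic_maps (top_of_set (V i)) (subtopology glued (\<phi> i ` V i)) (\<phi> i) g"
      using homeomorphic_map_chart[OF i open_V[OF i] order_refl] by (auto simp: homeomorphic_map_maps)
    then have "g (\<phi> i z) = h i (\<phi> i z)" if "z \<in> V i" for z
      using that h[OF i] by (simp add: homeomorphic_maps_def)
    then have "homeomorphic_maps (top_of_set (V i)) (subtopology glued (\<phi> i ` V i)) (\<phi> i) (h i)"
      by (intro homeomorphic_maps_eq[OF g]) auto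
    then show ?thesis
      using homeomorphic_maps_map homeomorphic_maps_sym by blast
  qed
  ultimately show "oriented_atlas glued ((\<lambda>i. (\<phi> i ` V i, h i)) ` I)"
    unfolding oriented_atlas_def
    using openin_image open_V by (auto simp: himg carrier_def)
qed

end

section \<open>A surface from three permutations\<close>

text \<open>The period \<open>2 * pi * k * \<i>\<close> of \<open>exp\<close>, in Cartesian form so
  that real and imaginary parts simplify at once.\<close>

definition turn :: "int \<Rightarrow> complex" where
  "turn k = Complex 0 (2 * pi * of_int k)"

lemma Re_turn [simp]: "Re (turn k) = 0" and Im_turn [simp]: "Im (turn k) = 2 * pi * of_int k"
  by (simp_all add: turn_def)

lemma turn_add: "turn (j + k) = turn j + turn k"
  by (simp add: complex_eq_iff algebra_simps)

lemma turn_diff: "turn (j - k) = turn j - turn k"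
  by (simp add: complex_eq_iff algebra_simps)

lemma turn_0 [simp]: "turn 0 = 0"
  by (simp add: complex_eq_iff)

lemma exp_turn [simp]: "exp (turn k) = 1"
proof -
  have "turn k = \<i> * of_real (2 * pi * of_int k)" by (simp add: complex_eq_iff)
  then have "exp (turn k) = cis (2 * pi * of_int k)" by (simp only: cis_conv_exp)
  then show ?thesis using cis_multiple_2pi[of "of_int k"] by simp
qed

lemma exp_eq_exp_iff_turn: "exp w = exp z \<longleftrightarrow> (\<exists>k. w = z + turn k)"
proof
  assume "exp w = exp z"
  then obtain k :: int where "w = z + (of_int (2 * k) * pi) * \<i>"
    using exp_eq by auto
  then have "w = z + turn k" by (simp add: complex_eq_iff)
  then show "\<exists>k. w = z + turn k" ..
qed (auto simp: exp_add)

lemma exp_add_turn [simp]: "exp (z + turn k) = exp z"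
  by (simp add: exp_add)

lemma exp_eq_1_imp_turn: "exp z = 1 \<Longrightarrow> \<exists>k. z = turn k"
  using exp_eq_exp_iff_turn[of z 0] by simp

lemma exp_divide_power [simp]: "n > 0 \<Longrightarrow> exp (s / of_nat n) ^ n = exp (s :: complex)"
  by (simp flip: exp_of_nat_mult)

lemma exp_divide_cong_turn:
  assumes "n > 0" "s = s' + turn (int n * k)"
  shows "exp (s / of_nat n) = exp (s' / of_nat n)"
proof -
  have "s / of_nat n = s' / of_nat n + turn k"
    using assms by (simp add: complex_eq_iff field_simps)
  then show ?thesis by simp
qed

lemma turn_small: "\<bar>2 * pi * real_of_int k\<bar> < 2 * pi \<Longrightarrow> k = 0"
  by (simp add: abs_mult)

lemma floor_Im_add_turn: "\<lfloor>Im (s + turn k) / (2 * pi)\<rfloor> = \<lfloor>Im s / (2 * pi)\<rfloor> + k"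
proof -
  have "Im (s + turn k) / (2 * pi) = Im s / (2 * pi) + of_int k"
    by (simp add: field_simps)
  then show ?thesis by simp
qed

lemma floor_Im_eq_0: "0 \<le> Im s \<Longrightarrow> Im s < 2 * pi \<Longrightarrow> \<lfloor>Im s / (2 * pi)\<rfloor> = 0"
  by (simp add: floor_eq_iff)

lemma split_turn:
  obtains j r where "s = r + turn j" "0 \<le> Im r" "Im r < 2 * pi"
proof
  let ?j = "\<lfloor>Im s / (2 * pi)\<rfloor>"
  show "s = (s - turn ?j) + turn ?j" by simp
  have "of_int ?j * (2 * pi) \<le> Im s" "Im s < (of_int ?j + 1) * (2 * pi)"
    by (simp_all flip: pos_le_divide_eq pos_divide_less_eq)
  then show "0 \<le> Im (s - turn ?j)" "Im (s - turn ?j) < 2 * pi"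
    by (simp_all add: algebra_simps)
qed

lemma exp_inj_strip:
  assumes "exp r = exp r'" "0 \<le> Im r" "Im r < 2 * pi" "0 \<le> Im r'" "Im r' < 2 * pi"
  shows "r = r'"
proof -
  obtain k where k: "r = r' + turn k" using assms(1) exp_eq_exp_iff_turn by blast
  then have "0 = 0 + k" using floor_Im_add_turn[of r' k] floor_Im_eq_0 assms by metis
  then show ?thesis using k by simp
qed

lemma exp_nonneg_Reals_imp_turn:
  assumes "exp s \<in> \<real>\<^sub>\<ge>\<^sub>0"
  shows "\<exists>k. s = of_real (Re s) + turn k"
proof -
  have "exp s = of_real (norm (exp s))"
    using assms by (auto elim!: nonneg_Reals_cases simp del: norm_exp_eq_Re)
  then have "exp s = exp (of_real (Re s))"
    by (simp add: exp_of_real)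
  then show ?thesis using exp_eq_exp_iff_turn by blast
qed

lemma exp_nonpos_Reals_imp_turn:
  assumes "exp s \<in> \<real>\<^sub>\<le>\<^sub>0"
  shows "\<exists>k. s = of_real (Re s) + \<i> * pi + turn k"
proof -
  have "exp (s - \<i> * pi) \<in> \<real>\<^sub>\<ge>\<^sub>0"
    using assms by (simp add: exp_diff complex_nonneg_Reals_iff complex_nonpos_Reals_iff)
  from exp_nonneg_Reals_imp_turn[OF this] show ?thesis
    by (auto simp: algebra_simps)
qed

text \<open>Removing this ray leaves a neighbourhood of 0 that avoids the branch points 1 and
  infinity and still contains the rest of the closed unit disc.\<close>

definition from_one :: "complex set" where
  "from_one = {z \<in> \<real>. 1 \<le> Re z}"

lemma from_one_nonneg: "z \<in> from_one \<Longrightarrow> z \<in> \<real>\<^sub>\<ge>\<^sub>0"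
  by (auto simp: from_one_def complex_nonneg_Reals_iff complex_is_Real_iff)

lemma inverse_notin_from_one:
  assumes "z \<in> from_one" "z \<noteq> 1" shows "inverse z \<notin> from_one"
proof -
  have z: "z = of_real (Re z)" "1 \<le> Re z"
    using assms by (auto simp: from_one_def complex_is_Real_iff complex_eq_iff)
  then have "1 < Re z" using assms by (metis of_real_1 order_le_less)
  then have "Re (inverse z) < 1"
    using z(1) by (metis Re_complex_of_real of_real_inverse inverse_less_1_iff)
  then show ?thesis by (simp add: from_one_def)
qed

lemma exp_in_from_one_iff: "exp s \<in> from_one \<longleftrightarrow> 0 \<le> Re s \<and> (\<exists>k. s = of_real (Re s) + turn k)"
proof
  assume s: "exp s \<in> from_one"
  then obtain k where k: "s = of_real (Re s) + turn k"
    using exp_nonneg_Reals_imp_turn from_one_nonneg by blast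
  then have "exp s = exp (of_real (Re s))" by (metis exp_add_turn)
  then have "Re (exp s) = exp (Re s)" by (simp add: exp_of_real)
  then show "0 \<le> Re s \<and> (\<exists>k. s = of_real (Re s) + turn k)"
    using k s by (auto simp: from_one_def)
next
  assume "0 \<le> Re s \<and> (\<exists>k. s = of_real (Re s) + turn k)"
  then have "exp s = of_real (exp (Re s))" "0 \<le> Re s" by (auto simp: exp_of_real) (metis exp_add_turn exp_of_real)
  then show "exp s \<in> from_one" by (simp add: from_one_def)
qed

text \<open>The domain reaches beyond the unit circle, since the charts of the two faces must
  overlap along the interior of the edges. Of the closed disc only the \<open>n\<close>-th roots of
  unity are missing, where the vertices sit.\<close>

definition slit :: "nat \<Rightarrow> complex set" where
  "slit n = {w. w ^ n \<notin> from_one}"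

lemma open_slit: "open (slit n)"
proof -
  have "closed from_one"
    unfolding from_one_def by (intro closed_Collect_conj closed_complex_Reals closed_Collect_le continuous_intros | simp add: Collect_mem_eq)+
  then have "closed ((\<lambda>w. w ^ n) -` from_one)"
    by (intro closed_vimage continuous_intros)
  moreover have "slit n = - ((\<lambda>w. w ^ n) -` from_one)" by (auto simp: slit_def)
  ultimately show ?thesis by (simp add: closed_def)
qed

text \<open>Passes from the logarithmic coordinate \<open>s\<close> to
  \<open>w = exp (s / n)\<close> and fills in the cone point \<open>p\<close> at
  \<open>w = 0\<close>. The branch taken by \<open>Ln\<close> is irrelevant once \<open>G\<close>
  has period \<open>turn n\<close>.\<close>

definition cone_map :: "nat \<Rightarrow> 'b \<Rightarrow> (complex \<Rightarrow> 'b) \<Rightarrow> complex \<Rightarrow> 'b" where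
  "cone_map n p G w = (if w = 0 then p else G (of_nat n * Ln w))"

lemma cone_map_0 [simp]: "cone_map n p G 0 = p"
  by (simp add: cone_map_def)

lemma cone_map_exp:
  assumes "n > 0" and per: "\<And>s k. G (s + turn (int n * k)) = G s"
  shows "cone_map n p G (exp (s / of_nat n)) = G s"
proof -
  obtain k where "Ln (exp (s / of_nat n)) = s / of_nat n + turn k"
    using exp_eq_exp_iff_turn[of "Ln (exp (s / of_nat n))"] by auto
  then have "of_nat n * Ln (exp (s / of_nat n)) = s + turn (int n * k)"
    using \<open>n > 0\<close> by (simp add: complex_eq_iff field_simps)
  then show ?thesis by (simp add: cone_map_def per)
qed

lemma nonzero_eq_exp_divide:
  fixes w :: complex
  assumes "w \<noteq> 0" "n > 0"
  obtains s where "w = exp (s / of_nat n)"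
  using assms that[of "of_nat n * Ln w"] by simp

datatype chart_index = Black | White | Vertex nat

text \<open>All centres have second coordinate 0, which no other point of the surface has; the shift
  by 2 keeps the vertices apart from the two faces.\<close>

fun centre :: "chart_index \<Rightarrow> surface_point" where
  "centre Black = (0, 0)"
| "centre White = (1, 0)"
| "centre (Vertex x) = (x + 2, 0)"

lemma centre_eq_iff [simp]: "centre i = centre k \<longleftrightarrow> i = k"
  by (cases i; cases k) auto

lemma snd_centre [simp]: "snd (centre i) = 0"
  by (cases i) auto

declare centre.simps [simp del]

text \<open>
  The labels name the edges; \<open>P\<close> and \<open>Q\<close> list them in the order in which the two facial
  walks traverse them, \<open>R x\<close> lists the edges that leave the vertex \<open>x\<close> in their rotation
  around \<open>x\<close>, and \<open>src\<close> gives the vertex where an edge starts.  Besides the centres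
  of the two faces and the vertices
  the surface consists of the points \<open>(l, z)\<close> with \<open>z \<noteq> 0, 1\<close>, where \<open>z\<close> is the image
  in the Riemann sphere: the surface covers the sphere, \<open>P\<close>, \<open>Q\<close> and \<open>R\<close>
  being the monodromy around the branch points \<open>0\<close>, \<open>\<infinity>\<close> and \<open>1\<close>, and \<open>l\<close> is the sheet of \<open>(l, z)\<close>.
\<close>
locale two_face_map =
  fixes N d :: nat and P Q :: "int \<Rightarrow> nat" and R :: "nat \<Rightarrow> int \<Rightarrow> nat"
    and Vs :: "nat set" and src :: "nat \<Rightarrow> nat"
  assumes N_pos: "N > 0" and d_pos: "d > 0" and finite_Vs: "finite Vs"
    and P_eq_iff: "P i = P j \<longleftrightarrow> int N dvd i - j"
    and Q_eq_iff: "Q i = Q j \<longleftrightarrow> int N dvd i - j"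
    and range_Q: "range Q = range P"
    and R_eq_iff: "x \<in> Vs \<Longrightarrow> R x i = R x j \<longleftrightarrow> int d dvd i - j"
    and range_R: "x \<in> Vs \<Longrightarrow> range (R x) = {l \<in> range P. src l = x}"
    and src_P: "src (P i) \<in> Vs"
    and rotation: "x \<in> Vs \<Longrightarrow> R x c = P i \<Longrightarrow> P (i - 1) = Q j \<Longrightarrow> R x (c + 1) = Q (j + 1)"
begin

text \<open>A face in logarithmic coordinates: \<open>exp\<close> maps strip \<open>j\<close> to the
  sheet \<open>K j\<close>, so passing from one strip to the next changes the sheet. The corner
  \<open>turn j\<close> becomes the vertex where the edge \<open>K j\<close> starts.\<close>

definition cell :: "(int \<Rightarrow> nat) \<Rightarrow> complex \<Rightarrow> surface_point" where
  "cell K s = (let j = \<lfloor>Im s / (2 * pi)\<rfloor> in if exp s = 1 then centre (Vertex (src (K j))) else (K j, exp s))"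

definition pos :: "nat \<Rightarrow> int" where
  "pos l = (SOME j. P j = l)"

text \<open>Here \<open>exp t\<close> is the face coordinate relative to a corner at
  \<open>x\<close>. While \<open>Im t\<close> runs through the \<open>c\<close>-th interval of
  length \<open>2 * pi\<close>, the point \<open>z = exp (exp t)\<close> circles once around 1:
  first in the upper half plane on the sheet \<open>R x c\<close>, then, across (0, 1), in the lower
  half plane on the sheet that precedes it in \<open>P\<close>.\<close>

definition star :: "nat \<Rightarrow> complex \<Rightarrow> surface_point" where
  "star x t = cell P (exp t + turn (pos (R x \<lfloor>Im t / (2 * pi)\<rfloor>)))"

text \<open>The minus sign for the white face belongs to the coordinate \<open>1 / z\<close> at
  infinity.\<close>

fun lift :: "chart_index \<Rightarrow> complex \<Rightarrow> surface_point" where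
  "lift Black = cell P"
| "lift White = (\<lambda>s. cell Q (- s))"
| "lift (Vertex x) = star x"

fun sheets :: "chart_index \<Rightarrow> nat" where
  "sheets (Vertex x) = d"
| "sheets _ = N"

text \<open>For \<open>u\<close> in the vertex disc, \<open>u ^ d\<close> has norm below 1. On such
  values \<open>exp\<close> is injective and equals 1 only at the centre.\<close>

fun dom :: "chart_index \<Rightarrow> complex set" where
  "dom (Vertex x) = ball 0 1"
| "dom _ = slit N"

definition chart :: "chart_index \<Rightarrow> complex \<Rightarrow> surface_point" where
  "chart i = cone_map (sheets i) (centre i) (lift i)"

definition indices :: "chart_index set" where
  "indices = {Black, White} \<union> Vertex ` Vs"

lemma P_pos [simp]: "l \<in> range P \<Longrightarrow> P (pos l) = l"
  unfolding pos_def by (metis (mono_tags) imageE someI_ex)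

lemma cell_strip:
  assumes "0 \<le> Im r" "Im r < 2 * pi"
  shows "cell K (r + turn j) = (if exp r = 1 then centre (Vertex (src (K j))) else (K j, exp r))"
  using floor_Im_eq_0[OF assms] unfolding cell_def by (simp only: floor_Im_add_turn) (simp add: Let_def)

lemma cell_periodic:
  assumes "\<And>i j. K i = K j \<longleftrightarrow> int N dvd i - j"
  shows "cell K (s + turn (int N * k)) = cell K s"
proof -
  obtain j r where s: "s = r + turn j" "0 \<le> Im r" "Im r < 2 * pi" using split_turn .
  have "s + turn (int N * k) = r + turn (j + int N * k)" by (simp add: s turn_add)
  then have "cell K (s + turn (int N * k)) = cell K (r + turn (j + int N * k))" by (rule arg_cong)
  moreover have "K (j + int N * k) = K j" using assms by simp
  ultimately show ?thesis using s(2,3) by (simp only: cell_strip s(1))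
qed

lemma cell_inject:
  assumes "\<And>i j. K i = K j \<longleftrightarrow> int N dvd i - j"
    and eq: "cell K s = cell K s'" and ne: "exp s \<noteq> 1" "exp s' \<noteq> 1"
  shows "\<exists>k. s = s' + turn (int N * k)"
proof -
  obtain j r where s: "s = r + turn j" "0 \<le> Im r" "Im r < 2 * pi" using split_turn .
  obtain j' r' where s': "s' = r' + turn j'" "0 \<le> Im r'" "Im r' < 2 * pi" using split_turn .
  have "K j = K j'" "exp r = exp r'"
    using eq ne s s' by (auto simp: cell_strip split: if_splits)
  then have r: "r = r'" and "int N dvd j - j'"
    using exp_inj_strip s s' assms(1) by blast+
  then obtain k where "j = j' + int N * k" by (metis add_diff_cancel_left' diff_add_cancel dvd_def add.commute)
  then have "s = s' + turn (int N * k)" by (simp add: s s' r turn_add)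
  then show ?thesis ..
qed

lemma sheets_pos: "sheets i > 0"
  by (cases i) (simp_all add: N_pos d_pos)

lemma lift_periodic:
  assumes "i \<in> indices"
  shows "lift i (s + turn (int (sheets i) * k)) = lift i s"
proof (cases i)
  case Black
  then show ?thesis using P_eq_iff by (simp add: cell_periodic)
next
  case White
  have "- (s + turn (int N * k)) = - s + turn (int N * (- k))"
    by (simp add: complex_eq_iff)
  then show ?thesis using cell_periodic[of Q "- s" "- k"] Q_eq_iff White by simp
next
  case (Vertex x)
  then have x: "x \<in> Vs" using assms by (auto simp: indices_def)
  have "R x (\<lfloor>Im s / (2 * pi)\<rfloor> + int d * k) = R x \<lfloor>Im s / (2 * pi)\<rfloor>"
    using R_eq_iff[OF x] by simp
  then show ?thesis unfolding Vertex by (simp only: lift.simps sheets.simps star_def floor_Im_add_turn exp_add_turn)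
qed

lemma chart_exp: "i \<in> indices \<Longrightarrow> chart i (exp (s / of_nat (sheets i))) = lift i s"
  unfolding chart_def by (simp add: cone_map_exp sheets_pos lift_periodic)

lemma chart_black: "chart Black (exp (s / of_nat N)) = cell P s"
  using chart_exp[of Black s] by (simp add: indices_def)

lemma chart_white: "chart White (exp (- (s / of_nat N))) = cell Q s"
  using chart_exp[of White "- s"] by (simp add: indices_def)

lemma chart_vertex: "x \<in> Vs \<Longrightarrow> chart (Vertex x) (exp (t / of_nat d)) = star x t"
  using chart_exp[of "Vertex x" t] by (simp add: indices_def)

lemma chart_0 [simp]: "chart i 0 = centre i"
  by (simp add: chart_def)


lemma indices_simps [simp]: "Black \<in> indices" "White \<in> indices" "Vertex x \<in> indices \<longleftrightarrow> x \<in> Vs"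
  by (auto simp: indices_def)

lemma indices_cases:
  assumes "i \<in> indices"
  obtains "i = Black" | "i = White" | x where "i = Vertex x" "x \<in> Vs"
  using assms by (auto simp: indices_def)

lemma black_cases:
  assumes "w \<in> slit N" "w \<noteq> 0"
  obtains s where "w = exp (s / of_nat N)" "exp s \<notin> from_one"
proof -
  obtain s where s: "w = exp (s / of_nat N)" using nonzero_eq_exp_divide[OF assms(2) N_pos] .
  then have "exp s \<notin> from_one" using assms(1) N_pos by (simp add: slit_def)
  then show thesis using s that by blast
qed

lemma white_cases:
  assumes "w \<in> slit N" "w \<noteq> 0"
  obtains s where "w = exp (- (s / of_nat N))" "exp (- s) \<notin> from_one"
proof -
  obtain s where "w = exp (s / of_nat N)" "exp s \<notin> from_one" using black_cases[OF assms] .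
  then show thesis using that[of "- s"] by simp
qed

lemma vertex_cases:
  assumes "w \<in> ball 0 1" "w \<noteq> 0"
  obtains t where "w = exp (t / of_nat d)" "Re t < 0"
proof -
  obtain t where t: "w = exp (t / of_nat d)" using nonzero_eq_exp_divide[OF assms(2) d_pos] .
  then have "exp (Re t / d) < 1" using assms(1) by simp
  then have "Re t < 0" using d_pos by (simp add: divide_less_0_iff)
  then show thesis using t that by blast
qed

lemma one_from_one: "1 \<in> from_one"
  by (simp add: from_one_def)

lemma Im_exp_small: "Re t < 0 \<Longrightarrow> \<bar>Im (exp t)\<bar> < 1"
  using abs_Im_le_cmod[of "exp t"] by (simp add: le_less_trans)

lemma exp_exp_ne_1:
  assumes "Re t < 0" shows "exp (exp t) \<noteq> 1"
proof
  assume "exp (exp t) = 1"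
  then obtain k where k: "exp t = turn k" using exp_eq_1_imp_turn by blast
  then have "\<bar>2 * pi * real_of_int k\<bar> < 1" using Im_exp_small[OF assms] by simp
  then have "k = 0" using turn_small[of k] pi_gt3 by simp
  then show False using k by simp
qed

text \<open>On a whole sector between two crossings of (1, infinity) the vertex chart is the black
  face coordinate moved to a corner. Any index \<open>j\<close> of the edge serves because
  \<open>cell P\<close> is periodic.\<close>

lemma star_black:
  assumes "of_int c * (2 * pi) \<le> Im t" "Im t < (of_int c + 1) * (2 * pi)" "P j = R x c"
  shows "star x t = cell P (exp t + turn j)"
proof -
  have c: "\<lfloor>Im t / (2 * pi)\<rfloor> = c"
    using assms by (simp add: floor_eq_iff pos_le_divide_eq pos_divide_less_eq)
  have "P (pos (R x c)) = P j" using assms(3) by (metis P_pos rangeI)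
  then obtain k where "pos (R x c) - j = int N * k" by (auto simp: P_eq_iff)
  then have "pos (R x c) = j + int N * k" by simp
  then have "star x t = cell P ((exp t + turn j) + turn (int N * k))"
    by (simp only: star_def c turn_add add.assoc)
  then show ?thesis by (simp only: cell_periodic[OF P_eq_iff])
qed

lemma R_in_range: "x \<in> Vs \<Longrightarrow> R x c \<in> range P"
  using range_R by blast

text \<open>The sectors are now centred at the crossings of (1, infinity), hence the bound
  \<open>pi\<close> on either side. Above the crossing the sheet is \<open>R x c\<close>;
  \<open>rotation\<close> identifies the sheet below it as the predecessor of \<open>R x c\<close>
  in \<open>Q\<close>. This is where the three permutations have to fit together.\<close>

lemma star_white:
  assumes x: "x \<in> Vs" and t: "Re t < 0" and c: "of_int c * (2 * pi) - pi < Im t" "Im t < of_int c * (2 * pi) + pi"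
    and m: "Q m = R x c"
  shows "star x t = cell Q (exp t + turn m)"
proof (cases "of_int c * (2 * pi) \<le> Im t")
  case True
  obtain j where j: "P j = R x c" using R_in_range[OF x, of c] by (metis imageE)
  have "0 \<le> sin (Im t - of_int c * (2 * pi))"
    using True c by (intro sin_ge_zero) auto
  also have "sin (Im t - of_int c * (2 * pi)) = sin (Im t)"
    using sin_int_2pin[of c] cos_int_2pin[of c] by (simp add: sin_diff mult.commute)
  finally have "0 \<le> Im (exp t)" by (simp add: Im_exp)
  moreover have "Im (exp t) < 2 * pi" using Im_exp_small[OF t] pi_gt3 by linarith
  moreover have "star x t = cell P (exp t + turn j)"
    by (rule star_black[OF True _ j]) (use c in \<open>simp add: algebra_simps\<close>)
  ultimately show ?thesis
    using exp_exp_ne_1[OF t] j m by (simp add: cell_strip)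
next
  case False
  obtain j where j: "P j = R x (c - 1)" using R_in_range[OF x, of "c - 1"] by (metis imageE)
  obtain m' where m': "P (j - 1) = Q m'" using range_Q by (metis imageE rangeI)
  have "Q (m' + 1) = Q m" using rotation[OF x j[symmetric] m'] m by simp
  then have Q: "Q (m - 1) = P (j - 1)" unfolding m' by (simp add: Q_eq_iff dvd_diff_commute algebra_simps)
  have "sin (Im t - of_int c * (2 * pi)) < 0"
    using sin_gt_zero[of "Im t - of_int c * (2 * pi) + pi"] False c by simp
  also have "sin (Im t - of_int c * (2 * pi)) = sin (Im t)"
    using sin_int_2pin[of c] cos_int_2pin[of c] by (simp add: sin_diff mult.commute)
  finally have neg: "Im (exp t) < 0" by (simp add: Im_exp mult_pos_neg)
  have strip: "0 \<le> Im (exp t + turn 1)" "Im (exp t + turn 1) < 2 * pi"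
    using Im_exp_small[OF t] pi_gt3 neg by simp_all
  \<comment> \<open>Below the real axis the point lies in the strip whose index is one less.\<close>
  have shift: "cell K (exp t + turn k) = (K (k - 1), exp (exp t))" for K k
  proof -
    have "exp t + turn k = (exp t + turn 1) + turn (k - 1)" by (simp add: turn_diff)
    then show ?thesis using exp_exp_ne_1[OF t] by (simp only: cell_strip[OF strip]) simp
  qed
  have "star x t = cell P (exp t + turn j)"
    by (rule star_black[of "c - 1", OF _ _ j]) (use False c in \<open>auto simp: algebra_simps\<close>)
  then show ?thesis by (simp only: shift Q)
qed

lemma star_value:
  assumes "Re t < 0"
  shows "star x t = (fst (star x t), exp (exp t))"
  unfolding star_def using exp_exp_ne_1[OF assms] by (simp add: cell_def)

text \<open>Equal values put \<open>exp t\<close> and \<open>exp t'\<close> a multiple of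
  \<open>2 * pi * \<i>\<close> apart, which must be 0 as both have norm below 1. Both points then
  belong to the same edge, whose \<open>src\<close> is the vertex and whose place in the rotation is
  determined modulo \<open>d\<close>.\<close>

lemma star_inject:
  assumes x: "x \<in> Vs" "x' \<in> Vs" and t: "Re t < 0" "Re t' < 0" and eq: "star x t = star x' t'"
  shows "x = x'" "exp (t / of_nat d) = exp (t' / of_nat d)"
proof -
  define c c' where "c = \<lfloor>Im t / (2 * pi)\<rfloor>" and "c' = \<lfloor>Im t' / (2 * pi)\<rfloor>"
  define j j' where "j = pos (R x c)" and "j' = pos (R x' c')"
  have "cell P (exp t + turn j) = cell P (exp t' + turn j')"
    using eq by (simp add: star_def c_def c'_def j_def j'_def)
  then obtain k where k: "exp t + turn j = exp t' + turn j' + turn (int N * k)"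
    using cell_inject[OF P_eq_iff] exp_exp_ne_1[OF t(1)] exp_exp_ne_1[OF t(2)] by force
  then have k': "exp t - exp t' = turn (j' + int N * k - j)"
    by (simp add: turn_add turn_diff algebra_simps)
  then have "Im (exp t) - Im (exp t') = 2 * pi * of_int (j' + int N * k - j)"
    by (metis Im_turn minus_complex.sel(2))
  then have "\<bar>2 * pi * of_int (j' + int N * k - j)\<bar> < 2 * pi"
    using Im_exp_small[OF t(1)] Im_exp_small[OF t(2)] pi_gt3 by linarith
  then have 0: "j' + int N * k - j = 0" by (rule turn_small)
  then have exp_eq: "exp t = exp t'" using k' by simp
  have "P j = P j'" using 0 unfolding P_eq_iff by (auto simp: algebra_simps)
  then have R: "R x c = R x' c'" using R_in_range[OF x(1), of c] R_in_range[OF x(2), of c'] by (simp add: j_def j'_def)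
  have "src (R x c) = x" "src (R x' c') = x'" using range_R x by blast+
  then show xx: "x = x'" using R by simp
  then have dvd: "int d dvd c - c'" using R R_eq_iff x by simp
  obtain n where n: "t = t' + turn n" using exp_eq exp_eq_exp_iff_turn by blast
  then have "c - c' = n" unfolding c_def c'_def n floor_Im_add_turn by simp
  then obtain e where "n = int d * e" using dvd by auto
  then show "exp (t / of_nat d) = exp (t' / of_nat d)"
    using exp_divide_cong_turn[OF d_pos, of t t' e] n by simp
qed

lemma snd_chart_ne_0:
  assumes "i \<in> indices" "w \<in> dom i" "w \<noteq> 0"
  shows "snd (chart i w) \<noteq> 0"
  using assms(1)
proof (cases rule: indices_cases)
  case 1
  then obtain s where "w = exp (s / of_nat N)" "exp s \<notin> from_one" using assms black_cases by auto
  then show ?thesis using 1 one_from_one by (auto simp: chart_black cell_def Let_def)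
next
  case 2
  then obtain s where s: "w = exp (- (s / of_nat N))" "exp (- s) \<notin> from_one" using assms white_cases by auto
  then have "exp s \<noteq> 1" using one_from_one by (auto simp: exp_minus)
  then show ?thesis using 2 s by (auto simp: chart_white cell_def Let_def)
next
  case (3 x)
  then obtain t where "w = exp (t / of_nat d)" "Re t < 0" using assms vertex_cases by auto
  then show ?thesis using 3 star_value[of t x] by (metis chart_vertex exp_not_eq_zero snd_conv)
qed

lemma chart_inj:
  assumes i: "i \<in> indices" shows "inj_on (chart i) (dom i)"
proof (rule inj_onI)
  fix w w' assume w: "w \<in> dom i" "w' \<in> dom i" and eq: "chart i w = chart i w'"
  show "w = w'"
  proof (cases "w = 0 \<or> w' = 0")
    case True
    then show ?thesis using eq snd_chart_ne_0[OF i] w by (metis chart_0 snd_centre)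
  next
    case False
    show ?thesis
      using i
    proof (cases rule: indices_cases)
      case 1
      obtain s where s: "w = exp (s / of_nat N)" "exp s \<notin> from_one" using black_cases w False 1 by auto
      obtain s' where s': "w' = exp (s' / of_nat N)" "exp s' \<notin> from_one" using black_cases w False 1 by auto
      have "\<exists>k. s = s' + turn (int N * k)"
        by (rule cell_inject[OF P_eq_iff]) (use eq s s' one_from_one 1 in \<open>auto simp: chart_black\<close>)
      then show ?thesis using s s' exp_divide_cong_turn[OF N_pos] by blast
    next
      case 2
      obtain s where s: "w = exp (- (s / of_nat N))" "exp (- s) \<notin> from_one" using white_cases w False 2 by auto
      obtain s' where s': "w' = exp (- (s' / of_nat N))" "exp (- s') \<notin> from_one" using white_cases w False 2 by auto
      have "exp s \<noteq> 1" "exp s' \<noteq> 1" using s s' one_from_one by (auto simp: exp_minus)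
      then obtain k where "s = s' + turn (int N * k)"
        using cell_inject[OF Q_eq_iff, of s s'] eq s s' 2 by (auto simp: chart_white)
      then have "exp (s / of_nat N) = exp (s' / of_nat N)" by (rule exp_divide_cong_turn[OF N_pos])
      then show ?thesis using s s' by (simp add: exp_minus)
    next
      case (3 x)
      obtain t where t: "w = exp (t / of_nat d)" "Re t < 0" using vertex_cases w False 3 by auto
      obtain t' where t': "w' = exp (t' / of_nat d)" "Re t' < 0" using vertex_cases w False 3 by auto
      show ?thesis using star_inject(2)[OF 3(2) 3(2) t(2) t'(2)] eq t t' 3 by (simp add: chart_vertex)
    qed
  qed
qed


section \<open>Compatibility of overlapping charts\<close>

definition compatible :: "chart_index \<Rightarrow> chart_index \<Rightarrow> complex \<Rightarrow> complex \<Rightarrow> bool" where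
  "compatible i k z y \<longleftrightarrow> (\<exists>S a b s. open S \<and> s \<in> S \<and> a s = z \<and> b s = y \<and>
    a holomorphic_on S \<and> b holomorphic_on S \<and> inj_on a S \<and>
    a ` S \<subseteq> dom i \<and> b ` S \<subseteq> dom k \<and> (\<forall>s\<in>S. chart i (a s) = chart k (b s)))"

lemma compatible_sym:
  assumes i: "i \<in> indices" and "compatible i k z y"
  shows "compatible k i y z"
proof -
  obtain S a b s where S: "open S" "s \<in> S" "a s = z" "b s = y" "a holomorphic_on S"
    "b holomorphic_on S" "inj_on a S" "a ` S \<subseteq> dom i" "b ` S \<subseteq> dom k"
    "\<forall>s\<in>S. chart i (a s) = chart k (b s)"
    using assms(2) unfolding compatible_def by blast
  have "inj_on b S"
  proof (rule inj_onI)
    fix s t assume st: "s \<in> S" "t \<in> S" "b s = b t"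
    then have "chart i (a s) = chart i (a t)" using S by metis
    then have "a s = a t" using inj_onD[OF chart_inj[OF i]] S(8) st by blast
    then show "s = t" using inj_onD[OF S(7)] st by blast
  qed
  then show ?thesis using S unfolding compatible_def by metis
qed

lemma compatible_refl:
  assumes i: "i \<in> indices" "z \<in> dom i"
  shows "compatible i i z z"
  unfolding compatible_def
  by (rule exI[of _ "dom i"], rule exI[of _ id], rule exI[of _ id], rule exI[of _ z])
    (use assms open_slit in \<open>cases i; auto\<close>)

lemma chart_eq_nonzero:
  assumes "i \<in> indices" "k \<in> indices" "i \<noteq> k" "z \<in> dom i" "y \<in> dom k" "chart i z = chart k y"
  shows "z \<noteq> 0" "y \<noteq> 0"
  using assms snd_chart_ne_0 by (metis chart_0 centre_eq_iff snd_centre)+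

text \<open>The black chart omits the ray from 1 on, the white one the interval (0, 1]. A common
  point thus lies off the positive real axis, along which the sheets are cut, and an open strip of
  \<open>s\<close> serves as common parameter.\<close>

lemma compatible_black_white:
  assumes z: "z \<in> slit N" and y: "y \<in> slit N" and eq: "chart Black z = chart White y"
  shows "compatible Black White z y"
proof -
  have nz: "z \<noteq> 0" "y \<noteq> 0"
    using chart_eq_nonzero[of Black White z y] assms by (auto simp: indices_def)
  obtain u where u: "z = exp (u / of_nat N)" "exp u \<notin> from_one" using black_cases[OF z nz(1)] .
  obtain u' where u': "y = exp (- (u' / of_nat N))" "exp (- u') \<notin> from_one" using white_cases[OF y nz(2)] .
  obtain j s where s: "u = s + turn j" "0 \<le> Im s" "Im s < 2 * pi" using split_turn .
  obtain m s' where s': "u' = s' + turn m" "0 \<le> Im s'" "Im s' < 2 * pi" using split_turn .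
  have e: "exp u = exp s" "exp (- u') = inverse (exp s')"
    by (simp_all only: exp_minus s(1) s'(1) exp_add_turn)
  then have ne: "exp s \<noteq> 1" "exp s' \<noteq> 1"
    using u(2) u'(2) one_from_one by auto
  then have "P j = Q m" and "exp s = exp s'"
    using eq s s' u u' by (auto simp: chart_black chart_white cell_strip)
  then have ss: "s' = s" using exp_inj_strip s s' by metis
  have "Im s \<noteq> 0"
  proof
    assume 0: "Im s = 0"
    then have "of_real (Re s) = s" by (simp add: complex_eq_iff)
    then have "s = of_real (Re s) + turn 0" "- s = of_real (Re (- s)) + turn 0" by auto
    then have "0 \<le> Re s \<Longrightarrow> exp s \<in> from_one" "0 \<le> Re (- s) \<Longrightarrow> exp (- s) \<in> from_one"
      using exp_in_from_one_iff by blast+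
    moreover have "exp s \<notin> from_one" "exp (- s) \<notin> from_one"
      using u(2) u'(2) e ss by (simp_all add: exp_minus)
    moreover have "0 \<le> Re s \<or> 0 \<le> Re (- s)" by auto
    ultimately show False by blast
  qed
  then have pos: "0 < Im s" using s by simp
  define S where "S = {s. 0 < Im s \<and> Im s < 2 * pi}"
  have notin: "exp r \<notin> \<real>\<^sub>\<ge>\<^sub>0" if "r \<in> S" for r
  proof
    assume "exp r \<in> \<real>\<^sub>\<ge>\<^sub>0"
    then obtain k where "r = of_real (Re r) + turn k" using exp_nonneg_Reals_imp_turn by blast
    then have k: "Im r = 2 * pi * of_int k" by (metis Im_complex_of_real Im_turn add_0 plus_complex.sel(2))
    then have "\<bar>2 * pi * of_int k\<bar> < 2 * pi" using that by (auto simp: S_def)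
    then show False using turn_small[of k] k that by (simp add: S_def)
  qed
  have slit: "exp ((r + turn j) / of_nat N) \<in> slit N" "exp (- ((r + turn m) / of_nat N)) \<in> slit N" if "r \<in> S" for r
  proof -
    show "exp ((r + turn j) / of_nat N) \<in> slit N"
      using notin[OF that] N_pos from_one_nonneg by (auto simp: slit_def)
    have "exp (- ((r + turn m) / of_nat N)) ^ N = inverse (exp r)"
      using N_pos by (simp add: exp_minus power_inverse)
    moreover have "inverse (exp r) \<notin> \<real>\<^sub>\<ge>\<^sub>0"
      using notin[OF that] nonneg_Reals_inverse_I[of "inverse (exp r)"] by auto
    ultimately show "exp (- ((r + turn m) / of_nat N)) \<in> slit N"
      using from_one_nonneg by (auto simp: slit_def)
  qed
  show ?thesis
    unfolding compatible_def
  proof (intro exI conjI)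
    show "open S" unfolding S_def by (intro open_Collect_conj open_Collect_less continuous_intros)
    show "s \<in> S" using pos s by (simp add: S_def)
    show "exp ((s + turn j) / of_nat N) = z" using u s by simp
    show "exp (- ((s + turn m) / of_nat N)) = y" using u' s' ss by simp
    show "(\<lambda>s. exp ((s + turn j) / of_nat N)) holomorphic_on S"
      "(\<lambda>s. exp (- ((s + turn m) / of_nat N))) holomorphic_on S"
      by (intro holomorphic_intros; use N_pos in simp)+
    show "inj_on (\<lambda>s. exp ((s + turn j) / of_nat N)) S"
    proof (rule inj_onI)
      fix r r' assume r: "r \<in> S" "r' \<in> S" "exp ((r + turn j) / of_nat N) = exp ((r' + turn j) / of_nat N)"
      then have "exp (r + turn j) = exp (r' + turn j)" using exp_divide_power[OF N_pos] by metis
      then have "exp r = exp r'" by simp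
      from exp_inj_strip[OF this] show "r = r'" using r(1,2) by (simp add: S_def)
    qed
    show "(\<lambda>s. exp ((s + turn j) / of_nat N)) ` S \<subseteq> dom Black"
      "(\<lambda>s. exp (- ((s + turn m) / of_nat N))) ` S \<subseteq> dom White"
      using slit by auto
    show "\<forall>s\<in>S. chart Black (exp ((s + turn j) / of_nat N)) = chart White (exp (- ((s + turn m) / of_nat N)))"
    proof
      fix r assume r: "r \<in> S"
      then have "exp r \<noteq> 1" using notin[of r] by (metis nonneg_Reals_one_I)
      then show "chart Black (exp ((r + turn j) / of_nat N)) = chart White (exp (- ((r + turn m) / of_nat N)))"
        using r \<open>P j = Q m\<close> unfolding chart_black chart_white by (simp add: cell_strip S_def)
    qed
  qed
qed

lemma exp_small_from_one:
  assumes "Re t < 0" "exp (exp t) \<in> from_one"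
  shows "exp t \<in> \<real>\<^sub>\<ge>\<^sub>0"
proof -
  obtain k where k: "0 \<le> Re (exp t)" "exp t = of_real (Re (exp t)) + turn k"
    using assms(2) exp_in_from_one_iff by blast
  then have "Im (exp t) = 2 * pi * of_int k" by (metis Im_complex_of_real Im_turn add_0 plus_complex.sel(2))
  then have "\<bar>2 * pi * of_int k\<bar> < 2 * pi" using Im_exp_small[OF assms(1)] pi_gt3 by linarith
  then have "k = 0" by (rule turn_small)
  then show ?thesis using k by (metis add.right_neutral complex_nonneg_Reals_iff Im_complex_of_real turn_0 Re_complex_of_real)
qed

lemma exp_small_from_one_minus:
  assumes "Re t < 0" "exp (- exp t) \<in> from_one"
  shows "exp t \<in> \<real>\<^sub>\<le>\<^sub>0"
proof -
  have "exp (exp (t + \<i> * pi)) \<in> from_one" using assms(2) by (simp add: exp_add)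
  then have "exp (t + \<i> * pi) \<in> \<real>\<^sub>\<ge>\<^sub>0" using exp_small_from_one[of "t + \<i> * pi"] assms(1) by simp
  then show ?thesis by (simp add: exp_add complex_nonneg_Reals_iff complex_nonpos_Reals_iff)
qed

lemma vertex_param:
  assumes "S \<subseteq> {t. Re t < 0}" and "\<And>t t'. t \<in> S \<Longrightarrow> t' \<in> S \<Longrightarrow> \<bar>Im t - Im t'\<bar> < 2 * pi"
  shows "inj_on (\<lambda>t. exp (t / of_nat d)) S" "(\<lambda>t. exp (t / of_nat d)) ` S \<subseteq> dom (Vertex x)"
    "(\<lambda>t. exp (t / of_nat d)) holomorphic_on S"
proof -
  show "inj_on (\<lambda>t. exp (t / of_nat d)) S"
  proof (rule inj_onI)
    fix t t' assume t: "t \<in> S" "t' \<in> S" "exp (t / of_nat d) = exp (t' / of_nat d)"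
    then have "exp t = exp t'" using exp_divide_power[OF d_pos] by metis
    then obtain k where k: "t = t' + turn k" using exp_eq_exp_iff_turn by blast
    then have "\<bar>2 * pi * of_int k\<bar> < 2 * pi" using assms(2)[OF t(1,2)] by simp
    then have "k = 0" by (rule turn_small)
    then show "t = t'" using k by simp
  qed
  show "(\<lambda>t. exp (t / of_nat d)) ` S \<subseteq> dom (Vertex x)"
    using assms(1) d_pos by (auto simp: divide_less_0_iff)
  show "(\<lambda>t. exp (t / of_nat d)) holomorphic_on S"
    by (intro holomorphic_intros; use d_pos in simp)
qed

text \<open>The crossings of (1, infinity), which the black chart omits, divide the punctured vertex
  disc into \<open>d\<close> open sectors; on each of them \<open>t\<close> parametrises both
  charts.\<close>

lemma compatible_vertex_black:
  assumes x: "x \<in> Vs" and y: "y \<in> ball 0 1" and z: "z \<in> slit N" and eq: "chart (Vertex x) y = chart Black z"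
  shows "compatible (Vertex x) Black y z"
proof -
  have nz: "y \<noteq> 0" "z \<noteq> 0"
    using chart_eq_nonzero[of "Vertex x" Black y z] assms by (auto simp: indices_def)
  obtain s where s: "z = exp (s / of_nat N)" "exp s \<notin> from_one" using black_cases[OF z nz(2)] .
  obtain t where t: "y = exp (t / of_nat d)" "Re t < 0" using vertex_cases[OF y nz(1)] .
  obtain c r where c: "t = r + turn c" "0 \<le> Im r" "Im r < 2 * pi" using split_turn .
  obtain j where j: "P j = R x c" using R_in_range[OF x, of c] by (metis imageE)
  have star: "star x u = cell P (exp u + turn j)"
    if "of_int c * (2 * pi) \<le> Im u" "Im u < (of_int c + 1) * (2 * pi)" for u
    by (rule star_black[OF that j])
  have eq': "cell P (exp t + turn j) = cell P s"
    using eq star[of t] c x by (simp add: s t chart_vertex chart_black algebra_simps)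
  obtain k where k: "exp t + turn j = s + turn (int N * k)"
    using cell_inject[OF P_eq_iff eq'] exp_exp_ne_1[OF t(2)] s(2) one_from_one by fastforce
  \<comment> \<open>Otherwise \<open>exp t\<close> is positive, hence \<open>z > 1\<close>, on the
    cut of the black chart.\<close>
  have "Im r \<noteq> 0"
  proof
    assume "Im r = 0"
    then have "r = of_real (Re r)" by (simp add: complex_eq_iff)
    then have "exp t = of_real (exp (Re r))" using c by (metis exp_add_turn exp_of_real)
    then have "exp (exp t) \<in> from_one"
      using exp_in_from_one_iff[of "exp t"] by (auto intro!: exI[of _ 0])
    moreover have "exp (exp t) = exp s" using k by (metis exp_add_turn)
    ultimately show False using s by simp
  qed
  then have pos: "0 < Im r" using c by simp
  define S where "S = {t. Re t < 0 \<and> of_int c * (2 * pi) < Im t \<and> Im t < (of_int c + 1) * (2 * pi)}"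
  have S: "S \<subseteq> {t. Re t < 0}" "\<And>t t'. t \<in> S \<Longrightarrow> t' \<in> S \<Longrightarrow> \<bar>Im t - Im t'\<bar> < 2 * pi"
    by (auto simp: S_def algebra_simps)
  show ?thesis
    unfolding compatible_def
  proof (intro exI conjI)
    show "open S" unfolding S_def by (intro open_Collect_conj open_Collect_less continuous_intros)
    show "t \<in> S" using pos t c by (simp add: S_def algebra_simps)
    show "exp (t / of_nat d) = y" using t by simp
    show "exp ((exp t + turn j) / of_nat N) = z"
      using s exp_divide_cong_turn[OF N_pos k] by simp
    show "(\<lambda>t. exp ((exp t + turn j) / of_nat N)) holomorphic_on S"
      by (intro holomorphic_intros; use N_pos in simp)
    show "(\<lambda>t. exp ((exp t + turn j) / of_nat N)) ` S \<subseteq> dom Black"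
    proof clarsimp
      fix u assume u: "u \<in> S"
      have "exp u \<notin> \<real>\<^sub>\<ge>\<^sub>0"
      proof
        assume "exp u \<in> \<real>\<^sub>\<ge>\<^sub>0"
        then obtain k where "u = of_real (Re u) + turn k" using exp_nonneg_Reals_imp_turn by blast
        then have k: "Im u = 2 * pi * of_int k" by (metis Im_complex_of_real Im_turn add_0 plus_complex.sel(2))
        then have "of_int c < real_of_int k" "real_of_int k < of_int c + 1"
          using u by (auto simp: S_def mult.commute[of "2 * pi"])
        then have "real_of_int c < real_of_int k" "real_of_int k < real_of_int (c + 1)" by simp_all
        then show False by (simp only: of_int_less_iff)
      qed
      then have "exp (exp u) \<notin> from_one" using exp_small_from_one u S by blast
      then show "exp ((exp u + turn j) / of_nat N) \<in> slit N" using N_pos by (simp add: slit_def)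
    qed
    show "\<forall>t\<in>S. chart (Vertex x) (exp (t / of_nat d)) = chart Black (exp ((exp t + turn j) / of_nat N))"
      using star x by (auto simp: chart_vertex chart_black S_def)
  qed (rule vertex_param[OF S]; assumption)+
qed

lemma compatible_vertex_white:
  assumes x: "x \<in> Vs" and y: "y \<in> ball 0 1" and z: "z \<in> slit N" and eq: "chart (Vertex x) y = chart White z"
  shows "compatible (Vertex x) White y z"
proof -
  have nz: "y \<noteq> 0" "z \<noteq> 0"
    using chart_eq_nonzero[of "Vertex x" White y z] assms by (auto simp: indices_def)
  obtain s where s: "z = exp (- (s / of_nat N))" "exp (- s) \<notin> from_one" using white_cases[OF z nz(2)] .
  then have s1: "exp s \<noteq> 1" using one_from_one by (auto simp: exp_minus)
  obtain t where t: "y = exp (t / of_nat d)" "Re t < 0" using vertex_cases[OF y nz(1)] .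
  \<comment> \<open>The shift by \<open>pi\<close> picks the \<open>c\<close> for which
    \<open>Im t\<close> is within \<open>pi\<close> of \<open>2 * pi * c\<close>, as
    \<open>star_white\<close> wants it.\<close>
  obtain c r where c: "t + \<i> * pi = r + turn c" "0 \<le> Im r" "Im r < 2 * pi" using split_turn .
  obtain m where m: "Q m = R x c" using R_in_range[OF x, of c] range_Q by (metis imageE)
  have snd: "exp s = exp (exp t)"
  proof -
    have "snd (cell Q s) = exp s" using s1 by (simp add: cell_def)
    moreover have "snd (star x t) = exp (exp t)" using star_value[OF t(2)] by (metis snd_conv)
    ultimately show ?thesis using eq x by (simp add: s t chart_vertex chart_white)
  qed
  have Imt: "Im t = Im r + 2 * pi * of_int c - pi"
    using arg_cong[OF c(1), of Im] by simp
  \<comment> \<open>Otherwise \<open>exp t\<close> is negative, hence \<open>z\<close> lies in (0,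
    1), on the cut of the white chart.\<close>
  have "Im r \<noteq> 0"
  proof
    assume "Im r = 0"
    then have "r = of_real (Re r)" by (simp add: complex_eq_iff)
    then have "exp (t + \<i> * pi) = of_real (exp (Re r))" using c by (metis exp_add_turn exp_of_real)
    then have "- exp t = of_real (exp (Re r))" by (simp add: exp_add)
    then have "exp (- exp t) \<in> from_one"
      using exp_in_from_one_iff[of "- exp t"] by (auto intro!: exI[of _ 0])
    then show False using s snd by (simp add: exp_minus)
  qed
  then have pos: "0 < Im r" using c by simp
  define S where "S = {t. Re t < 0 \<and> of_int c * (2 * pi) - pi < Im t \<and> Im t < of_int c * (2 * pi) + pi}"
  have tS: "t \<in> S" using pos t c Imt by (simp add: S_def algebra_simps)
  have star: "star x u = cell Q (exp u + turn m)" if "u \<in> S" for u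
    by (rule star_white[OF x _ _ _ m]) (use that in \<open>auto simp: S_def\<close>)
  have eq': "cell Q (exp t + turn m) = cell Q s"
    using eq star[OF tS] x by (simp add: s t chart_vertex chart_white)
  obtain k where k: "exp t + turn m = s + turn (int N * k)"
    using cell_inject[OF Q_eq_iff eq'] exp_exp_ne_1[OF t(2)] s1 by auto
  have S: "S \<subseteq> {t. Re t < 0}" "\<And>t t'. t \<in> S \<Longrightarrow> t' \<in> S \<Longrightarrow> \<bar>Im t - Im t'\<bar> < 2 * pi"
    by (auto simp: S_def algebra_simps)
  show ?thesis
    unfolding compatible_def
  proof (intro exI conjI)
    show "open S" unfolding S_def by (intro open_Collect_conj open_Collect_less continuous_intros)
    show "t \<in> S" by (rule tS)
    show "exp (t / of_nat d) = y" using t by simp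
    show "exp (- ((exp t + turn m) / of_nat N)) = z"
      using s exp_divide_cong_turn[OF N_pos k] by (simp add: exp_minus)
    show "(\<lambda>t. exp (- ((exp t + turn m) / of_nat N))) holomorphic_on S"
      by (intro holomorphic_intros; use N_pos in simp)
    show "(\<lambda>t. exp (- ((exp t + turn m) / of_nat N))) ` S \<subseteq> dom White"
    proof clarsimp
      fix u assume u: "u \<in> S"
      have "exp u \<notin> \<real>\<^sub>\<le>\<^sub>0"
      proof
        assume "exp u \<in> \<real>\<^sub>\<le>\<^sub>0"
        then obtain k where "u = of_real (Re u) + \<i> * pi + turn k" using exp_nonpos_Reals_imp_turn by blast
        from arg_cong[OF this, of Im] have k: "Im u = pi + 2 * pi * of_int k" by simp
        have "of_int c * (2 * pi) < (real_of_int k + 1) * (2 * pi)" "real_of_int k * (2 * pi) < of_int c * (2 * pi)"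
          using u k by (auto simp: S_def algebra_simps)
        then have "of_int c < real_of_int k + 1" "real_of_int k < of_int c"
          by (simp_all only: mult_less_cancel_right_pos pi_gt_zero zero_less_mult_iff zero_less_numeral simp_thms)
        then have "real_of_int c < real_of_int (k + 1)" "real_of_int k < real_of_int c" by simp_all
        then show False by (simp only: of_int_less_iff)
      qed
      then have "exp (- exp u) \<notin> from_one" using exp_small_from_one_minus u S by blast
      moreover have "exp (- ((exp u + turn m) / of_nat N)) ^ N = exp (- exp u)"
        using N_pos by (simp add: exp_minus power_inverse)
      ultimately show "exp (- ((exp u + turn m) / of_nat N)) \<in> slit N" by (simp add: slit_def)
    qed
    show "\<forall>t\<in>S. chart (Vertex x) (exp (t / of_nat d)) = chart White (exp (- ((exp t + turn m) / of_nat N)))"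
      using star x by (auto simp: chart_vertex chart_white)
  qed (rule vertex_param[OF S]; assumption)+
qed

lemma vertex_charts_disjoint:
  assumes "x \<in> Vs" "x' \<in> Vs" "y \<in> ball 0 1" "y' \<in> ball 0 1" "chart (Vertex x) y = chart (Vertex x') y'"
  shows "x = x'"
proof (rule ccontr)
  assume "x \<noteq> x'"
  then have "y \<noteq> 0" "y' \<noteq> 0"
    using chart_eq_nonzero[of "Vertex x" "Vertex x'" y y'] assms by (auto simp: indices_def)
  then obtain t t' where "y = exp (t / of_nat d)" "Re t < 0" "y' = exp (t' / of_nat d)" "Re t' < 0"
    using vertex_cases assms by metis
  then show False using star_inject(1)[of x x' t t'] assms \<open>x \<noteq> x'\<close> by (simp add: chart_vertex)
qed

sublocale holomorphic_gluing indices dom chart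
proof
  show "finite indices" using finite_Vs by (simp add: indices_def)
  show "open (dom i)" if "i \<in> indices" for i
    using open_slit by (cases i) auto
  show "inj_on (chart i) (dom i)" if "i \<in> indices" for i
    by (rule chart_inj[OF that])
  fix i k z y
  assume i: "i \<in> indices" and k: "k \<in> indices" and z: "z \<in> dom i" and y: "y \<in> dom k"
    and eq: "chart i z = chart k y"
  have "compatible i k z y"
  proof (cases "i = k")
    case True
    then have "z = y" using inj_onD[OF chart_inj[OF i]] eq z y by blast
    then show ?thesis using True compatible_refl i z by blast
  next
    case False
    show ?thesis
      using i
    proof (cases rule: indices_cases)
      case 1
      from k show ?thesis
      proof (cases rule: indices_cases)
        case 2
        then show ?thesis using compatible_black_white[of z y] 1 z y eq by simp
      next
        case (3 x)
        then show ?thesis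
          using compatible_sym[OF k] compatible_vertex_black[of x y z] 1 z y eq by simp
      qed (use False 1 in simp)
    next
      case 2
      from k show ?thesis
      proof (cases rule: indices_cases)
        case 1
        then show ?thesis
          using compatible_sym[OF k] compatible_black_white[of y z] 2 z y eq by simp
      next
        case (3 x)
        then show ?thesis
          using compatible_sym[OF k] compatible_vertex_white[of x y z] 2 z y eq by simp
      qed (use False 2 in simp)
    next
      case (3 x)
      from k show ?thesis
      proof (cases rule: indices_cases)
        case 1
        then show ?thesis using compatible_vertex_black[of x z y] 3 z y eq by simp
      next
        case 2
        then show ?thesis using compatible_vertex_white[of x z y] 3 z y eq by simp
      next
        case (3 x')
        then show ?thesis
          using vertex_charts_disjoint[of x x' z y] \<open>i = Vertex x\<close> \<open>x \<in> Vs\<close> False z y eq by simp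
      qed
    qed
  qed
  then show "\<exists>S a b s. open S \<and> s \<in> S \<and> a s = z \<and> b s = y \<and> a holomorphic_on S \<and> b holomorphic_on S \<and>
        inj_on a S \<and> a ` S \<subseteq> dom i \<and> b ` S \<subseteq> dom k \<and> (\<forall>s\<in>S. chart i (a s) = chart k (b s))"
    unfolding compatible_def .
qed

end

section \<open>The underlying set, and the face charts on the closed disc\<close>

lemma power_less_one_iff: "0 \<le> (a :: real) \<Longrightarrow> n > 0 \<Longrightarrow> a ^ n < 1 \<longleftrightarrow> a < 1"
  by (metis linorder_not_le power_mono_iff power_one zero_le_one)

context two_face_map
begin

lemma cell_surj:
  assumes "l \<in> range K" "z \<noteq> 0" "z \<noteq> 1"
  obtains s where "exp s = z" "cell K s = (l, z)"
proof -
  obtain u where u: "z = exp u" using assms(2) by (metis exp_Ln)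
  obtain i r where r: "u = r + turn i" "0 \<le> Im r" "Im r < 2 * pi" using split_turn .
  obtain j where j: "l = K j" using assms(1) by blast
  have "exp r = z" by (simp add: u r)
  then show thesis using that[of "r + turn j"] j assms r by (simp add: cell_strip)
qed

lemma cell_in: "exp s \<noteq> 1 \<Longrightarrow> cell K s \<in> range K \<times> {exp s}"
  by (simp add: cell_def Let_def)

lemma black_image:
  assumes "0 \<notin> A" "1 \<notin> A"
  shows "chart Black ` {w. w ^ N \<in> A} = range P \<times> A"
proof (intro equalityI subsetI)
  fix p assume "p \<in> chart Black ` {w. w ^ N \<in> A}"
  then obtain w where w: "w ^ N \<in> A" "p = chart Black w" by blast
  then have "w \<noteq> 0" using assms N_pos by (auto simp: power_0_left)
  then obtain s where s: "w = exp (s / of_nat N)" using nonzero_eq_exp_divide N_pos by blast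
  then have "exp s \<in> A" using w N_pos by simp
  moreover from this have "exp s \<noteq> 1" using assms by auto
  ultimately show "p \<in> range P \<times> A" using cell_in[of s P] w s by (auto simp: chart_black)
next
  fix p assume "p \<in> range P \<times> A"
  then obtain l z where p: "p = (l, z)" "l \<in> range P" "z \<in> A" by blast
  then have "z \<noteq> 0" "z \<noteq> 1" using assms by auto
  then obtain s where "exp s = z" "cell P s = p" using cell_surj p by metis
  then show "p \<in> chart Black ` {w. w ^ N \<in> A}"
    using p N_pos by (intro image_eqI[of _ _ "exp (s / of_nat N)"]) (simp_all add: chart_black)
qed

lemma white_image:
  assumes "0 \<notin> A" "1 \<notin> A"
  shows "chart White ` {w. inverse (w ^ N) \<in> A} = range P \<times> A"
proof (intro equalityI subsetI)
  fix p assume "p \<in> chart White ` {w. inverse (w ^ N) \<in> A}"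
  then obtain w where w: "inverse (w ^ N) \<in> A" "p = chart White w" by blast
  then have "inverse w \<noteq> 0" using assms N_pos by (auto simp: power_0_left)
  then obtain s where "inverse w = exp (s / of_nat N)" using nonzero_eq_exp_divide N_pos by blast
  then have s: "w = exp (- (s / of_nat N))" by (metis exp_minus inverse_inverse_eq)
  have "inverse (w ^ N) = exp s" using N_pos by (simp add: s exp_minus power_inverse)
  then have "exp s \<in> A" using w by simp
  moreover from this have "exp s \<noteq> 1" using assms by auto
  ultimately show "p \<in> range P \<times> A" using cell_in[of s Q] w s range_Q by (auto simp: chart_white)
next
  fix p assume "p \<in> range P \<times> A"
  then obtain l z where p: "p = (l, z)" "l \<in> range Q" "z \<in> A" using range_Q by blast
  then have "z \<noteq> 0" "z \<noteq> 1" using assms by auto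
  then obtain s where s: "exp s = z" "cell Q s = p" using cell_surj p by metis
  have "inverse (exp (- (s / of_nat N)) ^ N) = z" using N_pos s by (simp add: exp_minus power_inverse)
  then show "p \<in> chart White ` {w. inverse (w ^ N) \<in> A}"
    using p s by (intro image_eqI[of _ _ "exp (- (s / of_nat N))"]) (simp_all add: chart_white)
qed

lemma black_ball: "chart Black ` ball 0 1 = insert (centre Black) (range P \<times> {z. z \<noteq> 0 \<and> norm z < 1})"
proof -
  have "ball 0 1 = insert 0 {w :: complex. w ^ N \<in> {z. z \<noteq> 0 \<and> norm z < 1}}"
    using N_pos by (auto simp: norm_power power_less_one_iff)
  then show ?thesis using black_image[of "{z. z \<noteq> 0 \<and> norm z < 1}"] by (simp only: image_insert chart_0) simp
qed

lemma white_ball: "chart White ` ball 0 1 = insert (centre White) (range P \<times> {z. norm z > 1})"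
proof -
  have "w = 0 \<or> norm w < 1 \<longleftrightarrow> w = 0 \<or> 1 < norm (inverse (w ^ N))" for w :: complex
  proof (cases "w = 0")
    case False
    have "norm (inverse (w ^ N)) = inverse (norm w ^ N)" by (simp only: norm_inverse norm_power)
    moreover have "1 < inverse (norm w ^ N) \<longleftrightarrow> norm w ^ N < 1"
      using False by (simp add: one_less_inverse_iff)
    ultimately show ?thesis using False N_pos by (simp add: power_less_one_iff)
  qed simp
  then have "ball 0 1 = insert 0 {w :: complex. inverse (w ^ N) \<in> {z. norm z > 1}}"
    unfolding set_eq_iff mem_ball_0 insert_iff mem_Collect_eq by (metis norm_zero zero_less_one)
  then show ?thesis using white_image[of "{z. norm z > 1}"] by (simp only: image_insert chart_0) simp
qed

lemma black_slit: "chart Black ` slit N = insert (centre Black) (range P \<times> {z. z \<noteq> 0 \<and> z \<notin> from_one})"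
proof -
  have "0 \<notin> from_one" by (simp add: from_one_def)
  then have "slit N = insert 0 {w. w ^ N \<in> {z. z \<noteq> 0 \<and> z \<notin> from_one}}"
    using N_pos by (auto simp: slit_def power_0_left)
  then show ?thesis using black_image[of "{z. z \<noteq> 0 \<and> z \<notin> from_one}"] one_from_one
    by (simp only: image_insert chart_0) simp
qed

lemma white_slit: "chart White ` slit N = insert (centre White) (range P \<times> {z. z \<noteq> 0 \<and> inverse z \<notin> from_one})"
proof -
  have "0 \<notin> from_one" by (simp add: from_one_def)
  then have "slit N = insert 0 {w. inverse (w ^ N) \<in> {z. z \<noteq> 0 \<and> inverse z \<notin> from_one}}"
    using N_pos by (auto simp: slit_def power_0_left)
  then show ?thesis using white_image[of "{z. z \<noteq> 0 \<and> inverse z \<notin> from_one}"] one_from_one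
    by (simp only: image_insert chart_0) simp
qed

lemma vertex_ball: 
  assumes x: "x \<in> Vs"
  shows "chart (Vertex x) ` ball 0 1 \<subseteq> insert (centre (Vertex x)) (range P \<times> (- {0, 1}))"
proof (rule image_subsetI)
  fix w :: complex assume w: "w \<in> ball 0 1"
  show "chart (Vertex x) w \<in> insert (centre (Vertex x)) (range P \<times> (- {0, 1}))"
  proof (cases "w = 0")
    case False
    then obtain t where t: "w = exp (t / of_nat d)" "Re t < 0" using w vertex_cases by blast
    have "star x t \<in> range P \<times> {exp (exp t)}"
      using cell_in[of "exp t + turn k" P for k] exp_exp_ne_1[OF t(2)] by (simp add: star_def)
    then show ?thesis using exp_exp_ne_1[OF t(2)] x by (auto simp: t chart_vertex)
  qed simp
qed

text \<open>A point over \<open>z\<close> other than 0 and 1 is seen by one of the face charts,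
  since \<open>z\<close> and \<open>1 / z\<close> cannot both lie on the ray from 1 on.\<close>

lemma carrier_eq: "carrier = centre ` indices \<union> range P \<times> (- {0, 1})"
proof
  show "carrier \<subseteq> centre ` indices \<union> range P \<times> (- {0, 1})"
    unfolding carrier_def
  proof (rule UN_least)
    fix i assume i: "i \<in> indices"
    then show "chart i ` dom i \<subseteq> centre ` indices \<union> range P \<times> (- {0, 1})"
    proof (cases rule: indices_cases)
      case 1
      then show ?thesis using black_slit i one_from_one by auto
    next
      case 2
      then show ?thesis using white_slit i one_from_one by auto
    next
      case (3 x)
      then show ?thesis using vertex_ball[of x] i by auto
    qed
  qed
  have "centre i \<in> carrier" if "i \<in> indices" for i
  proof -
    have "0 \<in> dom i" using N_pos by (cases i) (auto simp: slit_def from_one_def power_0_left)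
    then show ?thesis using that chart_0[of i] unfolding carrier_def by (metis UN_I image_eqI)
  qed
  moreover have "(l, z) \<in> carrier" if "l \<in> range P" "z \<noteq> 0" "z \<noteq> 1" for l z
  proof (cases "z \<in> from_one")
    case False
    then have "(l, z) \<in> chart Black ` dom Black" using black_slit that by auto
    then show ?thesis unfolding carrier_def by (metis UN_I indices_simps(1))
  next
    case True
    then have "inverse z \<notin> from_one" using inverse_notin_from_one that by blast
    then have "(l, z) \<in> chart White ` dom White" using white_slit that by auto
    then show ?thesis unfolding carrier_def by (metis UN_I indices_simps(2))
  qed
  ultimately show "centre ` indices \<union> range P \<times> (- {0, 1}) \<subseteq> carrier" by auto
qed

text \<open>Near the corner \<open>turn j\<close> the face coordinate \<open>s\<close> equals
  \<open>u ^ d\<close> in the vertex chart. The equation between norms is what continuity at the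
  corners of the closed disc requires.\<close>

lemma corner_black:
  assumes "s \<notin> \<real>\<^sub>\<ge>\<^sub>0" "norm s < 1"
  obtains u where "norm u ^ d = norm s" "norm u < 1" "chart (Vertex (src (P j))) u = cell P (s + turn j)"
proof -
  let ?x = "src (P j)"
  have x: "?x \<in> Vs" by (rule src_P)
  have "P j \<in> range (R ?x)" unfolding range_R[OF x] by simp
  then obtain c where c: "P j = R ?x c" by blast
  have s0: "s \<noteq> 0" using assms by auto
  \<comment> \<open>The argument must lie between 0 and \<open>2 * pi\<close>, the sector of
    \<open>star_black\<close>; that of \<open>Ln (- s)\<close> lies between \<open>- pi\<close> and
    \<open>pi\<close>, whence the added \<open>pi\<close>.\<close>
  define t where "t = Ln (- s) + \<i> * pi + turn c"
  have t: "exp t = s" using s0 by (simp add: t_def exp_add)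
  have "- s \<notin> \<real>\<^sub>\<le>\<^sub>0" using assms(1) by (simp add: complex_nonneg_Reals_iff complex_nonpos_Reals_iff)
  then have "Im (Ln (- s)) < pi" "- pi < Im (Ln (- s))"
    using mpi_less_Im_Ln[of "- s"] Im_Ln_le_pi[of "- s"] Im_Ln_eq_pi[of "- s"] s0
    by (auto simp: less_le complex_nonpos_Reals_iff)
  then have "of_int c * (2 * pi) \<le> Im t" "Im t < (of_int c + 1) * (2 * pi)"
    by (auto simp: t_def algebra_simps)
  from star_black[OF this c] have "star ?x t = cell P (s + turn j)" by (simp add: t)
  moreover have n: "norm (exp (t / of_nat d)) ^ d = norm s"
    by (simp only: norm_power[symmetric] exp_divide_power[OF d_pos] t)
  moreover have "norm (exp (t / of_nat d)) < 1"
    using n assms(2) d_pos by (metis norm_ge_zero power_less_one_iff)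
  ultimately show thesis using that[of "exp (t / of_nat d)"] x by (simp add: chart_vertex)
qed

lemma src_Q: "src (Q j) \<in> Vs"
  using src_P range_Q by (metis imageE rangeI)

lemma corner_white:
  assumes "s \<notin> \<real>\<^sub>\<le>\<^sub>0" "norm s < 1"
  obtains u where "norm u ^ d = norm s" "norm u < 1" "chart (Vertex (src (Q j))) u = cell Q (s + turn j)"
proof -
  let ?x = "src (Q j)"
  have x: "?x \<in> Vs" by (rule src_Q)
  have "Q j \<in> range (R ?x)" unfolding range_R[OF x] using range_Q by auto
  then obtain c where c: "Q j = R ?x c" by blast
  have s0: "s \<noteq> 0" using assms by auto
  \<comment> \<open>The principal logarithm already has its argument in the range of
    \<open>star_white\<close>.\<close>
  define t where "t = Ln s + turn c"
  have t: "exp t = s" using s0 by (simp add: t_def)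
  have "Im (Ln s) < pi" "- pi < Im (Ln s)"
    using mpi_less_Im_Ln[of s] Im_Ln_le_pi[of s] Im_Ln_eq_pi[of s] s0 assms(1)
    by (auto simp: less_le complex_nonpos_Reals_iff)
  then have *: "of_int c * (2 * pi) - pi < Im t" "Im t < of_int c * (2 * pi) + pi"
    by (auto simp: t_def algebra_simps)
  have "Re t < 0"
  proof -
    have "exp (Re t) < 1" using assms(2) t by (metis norm_exp_eq_Re)
    then show ?thesis by simp
  qed
  from star_white[OF x this * c] have "star ?x t = cell Q (s + turn j)" by (simp add: t)
  moreover have n: "norm (exp (t / of_nat d)) ^ d = norm s"
    by (simp only: norm_power[symmetric] exp_divide_power[OF d_pos] t)
  moreover have "norm (exp (t / of_nat d)) < 1"
    using n assms(2) d_pos by (metis norm_ge_zero power_less_one_iff)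
  ultimately show thesis using that[of "exp (t / of_nat d)"] x by (simp add: chart_vertex)
qed

text \<open>For an \<open>n\<close>-th root of unity \<open>w0\<close>, the expression is, up to
  sign, the logarithmic face coordinate of \<open>w\<close> relative to the corner at
  \<open>w0\<close>.\<close>

lemma near_root:
  fixes w0 :: complex
  assumes "w0 \<noteq> 0" "e > 0"
  obtains \<delta> where "\<delta> > 0" "\<And>w. dist w w0 < \<delta> \<Longrightarrow> w \<noteq> 0 \<and> norm (of_nat n * Ln (w / w0)) < e"
proof -
  have "isCont (\<lambda>w. of_nat n * Ln (w / w0)) w0"
    using assms by (intro continuous_intros) auto
  then obtain \<delta> where \<delta>: "\<delta> > 0" "\<And>w. dist w w0 < \<delta> \<Longrightarrow> norm (of_nat n * Ln (w / w0)) < e"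
    using assms unfolding continuous_at_eps_delta by force
  show thesis
  proof (rule that[of "min \<delta> (norm w0)"])
    fix w assume w: "dist w w0 < min \<delta> (norm w0)"
    then show "w \<noteq> 0 \<and> norm (of_nat n * Ln (w / w0)) < e"
      using \<delta>(2)[of w] by (auto simp: dist_norm)
  qed (use \<delta> assms in auto)
qed

lemma cball_cases:
  assumes "w \<in> cball 0 1"
  obtains "w \<in> slit N" | "w ^ N = 1"
proof (cases "w \<in> slit N")
  case False
  then have w: "w ^ N \<in> \<real>" "1 \<le> Re (w ^ N)" by (auto simp: slit_def from_one_def)
  have "norm (w ^ N) \<le> 1" using assms by (simp add: norm_power power_le_one)
  then have "Re (w ^ N) = 1" using w complex_Re_le_cmod[of "w ^ N"] by linarith
  then have "w ^ N = 1" using w by (simp add: complex_is_Real_iff complex_eq_iff)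
  then show thesis by (rule that(2))
qed

lemma vertex_neighbourhood:
  assumes x: "x \<in> Vs" and U: "openin glued U" "centre (Vertex x) \<in> U"
  obtains e where "e > 0" "e \<le> 1" "\<And>u. norm u < 1 \<Longrightarrow> norm u ^ d < e \<Longrightarrow> chart (Vertex x) u \<in> U"
proof -
  have i: "Vertex x \<in> indices" using x by (simp add: indices_def)
  have "open {u \<in> dom (Vertex x). chart (Vertex x) u \<in> U}"
    using U(1) i unfolding openin_glued by blast
  then have "open {u \<in> ball 0 1. chart (Vertex x) u \<in> U}" by simp
  moreover have "0 \<in> {u \<in> ball 0 1. chart (Vertex x) u \<in> U}" using U by simp
  ultimately obtain e where e: "e > 0" "ball 0 e \<subseteq> {u \<in> ball 0 1. chart (Vertex x) u \<in> U}"
    using open_contains_ball_eq by metis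
  show thesis
  proof (rule that[of "min 1 (e ^ d)"])
    fix u :: complex assume "norm u ^ d < min 1 (e ^ d)"
    then have "norm u < e" using e(1) power_less_imp_less_base[of "norm u" d e] by simp
    then show "chart (Vertex x) u \<in> U" using e(2) by auto
  qed (use e in auto)
qed

text \<open>Away from the \<open>N\<close>-th roots of unity the closed disc lies in the domain of
  the chart. At a root the formula of the chart still yields a vertex, and nearby points of the
  closed disc lie in the chart of this vertex by \<open>corner_black\<close> and
  \<open>corner_white\<close>.\<close>

lemma continuous_map_closed_disc:
  assumes i: "i = Black \<or> i = White"
  shows "continuous_map (top_of_set (cball 0 1)) glued (chart i)"
proof -
  have root: "\<exists>\<delta>>0. \<forall>w. w \<in> cball 0 1 \<longrightarrow> dist w w0 < \<delta> \<longrightarrow> chart i w \<in> U"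
    if w0: "w0 ^ N = 1" and U: "openin glued U" "chart i w0 \<in> U" for w0 U
    using i
  proof
    assume i: "i = Black"
    have "w0 \<noteq> 0" using w0 N_pos by (auto simp: power_0_left)
    then obtain u where u: "w0 = exp (u / of_nat N)" using nonzero_eq_exp_divide N_pos by blast
    then have "exp u = 1" using w0 N_pos by simp
    then obtain j where j: "u = turn j" using exp_eq_1_imp_turn by blast
    have v: "chart i w0 = centre (Vertex (src (P j)))"
      using cell_strip[of 0 P j] by (simp add: i u j chart_black)
    obtain e where e: "e > 0" "e \<le> 1"
      "\<And>u. norm u < 1 \<Longrightarrow> norm u ^ d < e \<Longrightarrow> chart (Vertex (src (P j))) u \<in> U"
      using vertex_neighbourhood[OF src_P U(1)] U(2) v by metis
    obtain \<delta> where \<delta>: "\<delta> > 0" "\<And>w. dist w w0 < \<delta> \<Longrightarrow> w \<noteq> 0 \<and> norm (of_nat N * Ln (w / w0)) < e"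
      using near_root[OF \<open>w0 \<noteq> 0\<close> e(1)] by metis
    have "chart i w \<in> U" if w: "w \<in> cball 0 1" "dist w w0 < \<delta>" for w
    proof -
      define s where "s = of_nat N * Ln (w / w0)"
      have s: "norm s < e" "w \<noteq> 0" using \<delta>(2)[OF w(2)] by (auto simp: s_def)
      have "exp ((s + turn j) / of_nat N) = exp (s / of_nat N) * w0"
        by (simp add: u j add_divide_distrib exp_add)
      also have "exp (s / of_nat N) = w / w0" using s \<open>w0 \<noteq> 0\<close> N_pos by (simp add: s_def)
      finally have ws: "w = exp ((s + turn j) / of_nat N)" using \<open>w0 \<noteq> 0\<close> by simp
      then have cw: "chart i w = cell P (s + turn j)" by (simp add: i chart_black)
      show ?thesis
      proof (cases "s = 0")
        case True
        then show ?thesis using cw v U(2) u j i by (simp add: chart_black)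
      next
        case False
        \<comment> \<open>In the closed black disc \<open>Re s \<le> 0\<close>, so a nonzero
          \<open>s\<close> avoids the half line excluded by \<open>corner_black\<close>.\<close>
        have "exp (Re s / N) \<le> 1" using w(1) ws by simp
        then have "Re s \<le> 0" using N_pos by (simp add: divide_le_0_iff)
        then have "s \<notin> \<real>\<^sub>\<ge>\<^sub>0" using False by (auto simp: complex_nonneg_Reals_iff complex_eq_iff)
        then obtain u where "norm u ^ d = norm s" "norm u < 1"
          "chart (Vertex (src (P j))) u = cell P (s + turn j)"
          using corner_black s e by (metis order_less_le_trans)
        then show ?thesis using e(3)[of u] s cw by simp
      qed
    qed
    then show ?thesis using \<delta>(1) by blast
  next
    assume i: "i = White"
    have "w0 \<noteq> 0" using w0 N_pos by (auto simp: power_0_left)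
    then obtain u' where u': "w0 = exp (u' / of_nat N)" using nonzero_eq_exp_divide N_pos by blast
    then have "exp u' = 1" using w0 N_pos by simp
    then have "exp (- u') = 1" by (simp add: exp_minus)
    then obtain j where "- u' = turn j" using exp_eq_1_imp_turn by blast
    then have u: "w0 = exp (- (turn j / of_nat N))" using u' by (metis divide_minus_left minus_minus)
    have v: "chart i w0 = centre (Vertex (src (Q j)))"
      using cell_strip[of 0 Q j] by (simp add: i u chart_white)
    obtain e where e: "e > 0" "e \<le> 1"
      "\<And>u. norm u < 1 \<Longrightarrow> norm u ^ d < e \<Longrightarrow> chart (Vertex (src (Q j))) u \<in> U"
      using vertex_neighbourhood[OF src_Q U(1)] U(2) v by metis
    obtain \<delta> where \<delta>: "\<delta> > 0" "\<And>w. dist w w0 < \<delta> \<Longrightarrow> w \<noteq> 0 \<and> norm (of_nat N * Ln (w / w0)) < e"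
      using near_root[OF \<open>w0 \<noteq> 0\<close> e(1)] by metis
    have "chart i w \<in> U" if w: "w \<in> cball 0 1" "dist w w0 < \<delta>" for w
    proof -
      define s where "s = - (of_nat N * Ln (w / w0))"
      have s: "norm s < e" "w \<noteq> 0" using \<delta>(2)[OF w(2)] by (auto simp: s_def)
      have "- ((s + turn j) / of_nat N) = - (s / of_nat N) + - (turn j / of_nat N)"
        by (simp add: add_divide_distrib)
      then have "exp (- ((s + turn j) / of_nat N)) = exp (- (s / of_nat N)) * w0"
        by (simp only: u exp_add)
      also have "exp (- (s / of_nat N)) = w / w0" using s \<open>w0 \<noteq> 0\<close> N_pos by (simp add: s_def)
      finally have ws: "w = exp (- ((s + turn j) / of_nat N))" using \<open>w0 \<noteq> 0\<close> by simp
      then have cw: "chart i w = cell Q (s + turn j)" by (simp only: i chart_white)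
      show ?thesis
      proof (cases "s = 0")
        case True
        then show ?thesis using cw v U(2) u i by (simp add: chart_white)
      next
        case False
        \<comment> \<open>The white disc is the other half plane, so here the nonpositive half line
          is avoided.\<close>
        have "exp (- (Re s / N)) \<le> 1" using w(1) ws by simp
        then have "0 \<le> Re s" using N_pos by (simp add: zero_le_divide_iff)
        then have "s \<notin> \<real>\<^sub>\<le>\<^sub>0" using False by (auto simp: complex_nonpos_Reals_iff complex_eq_iff)
        then obtain u where "norm u ^ d = norm s" "norm u < 1"
          "chart (Vertex (src (Q j))) u = cell Q (s + turn j)"
          using corner_white s e by (metis order_less_le_trans)
        then show ?thesis using e(3)[of u] s cw by simp
      qed
    qed
    then show ?thesis using \<delta>(1) by blast
  qed
  have ii: "i \<in> indices" and domi: "dom i = slit N" using i by (auto simp: indices_def)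
  have in_carrier: "chart i w \<in> carrier" if w: "w \<in> cball 0 1" for w
    using w
  proof (cases rule: cball_cases)
    case 1
    then show ?thesis using ii domi by (auto simp: carrier_def)
  next
    case 2
    have "w \<noteq> 0" using 2 N_pos by (auto simp: power_0_left)
    then obtain u where u: "w = exp (u / of_nat N)" using nonzero_eq_exp_divide N_pos by blast
    then have "exp u = 1" using 2 N_pos by simp
    then have e: "exp u = 1" "exp (- u) = 1" by (simp_all add: exp_minus)
    have "chart i w \<in> centre ` Vertex ` Vs"
      using i u e src_P src_Q chart_exp[OF ii, of u] by (auto simp: cell_def)
    then show ?thesis by (auto simp: carrier_eq)
  qed
  show ?thesis
    unfolding continuous_map_def
  proof (intro conjI allI impI)
    show "chart i \<in> topspace (top_of_set (cball 0 1)) \<rightarrow> topspace glued"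
      using in_carrier by auto
    fix U assume U: "openin glued U"
    show "openin (top_of_set (cball 0 1)) {x \<in> topspace (top_of_set (cball 0 1)). chart i x \<in> U}"
      unfolding openin_contains_ball
    proof (intro conjI ballI)
      fix w assume w: "w \<in> {x \<in> topspace (top_of_set (cball 0 1)). chart i x \<in> U}"
      then have "w \<in> cball 0 1" by simp
      then show "\<exists>e>0. ball w e \<inter> cball 0 1 \<subseteq> {x \<in> topspace (top_of_set (cball 0 1)). chart i x \<in> U}"
      proof (cases rule: cball_cases)
        case 1
        have "open {z \<in> dom i. chart i z \<in> U}" using U ii by (simp add: openin_glued)
        then obtain e where "e > 0" "ball w e \<subseteq> {z \<in> dom i. chart i z \<in> U}"
          using 1 w domi open_contains_ball_eq[of "{z \<in> dom i. chart i z \<in> U}" w] by auto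
        then show ?thesis by (intro exI[of _ e]) auto
      next
        case 2
        then obtain \<delta> where "\<delta> > 0" "\<forall>v. v \<in> cball 0 1 \<longrightarrow> dist v w < \<delta> \<longrightarrow> chart i v \<in> U"
          using root[OF 2 U] w by auto
        then show ?thesis by (intro exI[of _ \<delta>]) (auto simp: dist_commute)
      qed
    qed auto
  qed
qed

end

section \<open>Topology of the surface\<close>

lemma connected_components_of_two_open:
  assumes "openin X A" "openin X B" "topspace X = A \<union> B" "A \<inter> B = {}"
    "connectedin X A" "connectedin X B" "A \<noteq> {}" "B \<noteq> {}"
  shows "connected_components_of X = {A, B}"
proof -
  have comp: "connected_component_of_set X x = C"
    if x: "x \<in> C" and C: "connectedin X C" "openin X C" "openin X (topspace X - C)" for C x
  proof
    show "C \<subseteq> connected_component_of_set X x"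
      using connected_component_of_maximal[OF C(1) x] .
    have "closedin X C" using C openin_subset[OF C(2)] by (simp add: closedin_def)
    moreover have "connectedin X (connected_component_of_set X x)"
      by (rule connectedin_connected_component_of)
    moreover have "x \<in> connected_component_of_set X x"
      using x openin_subset[OF C(2)] by (auto simp: connected_component_of_refl)
    ultimately show "connected_component_of_set X x \<subseteq> C"
      using connectedin_clopen_cases[of X "connected_component_of_set X x" C] C(2) x
      by (auto simp: disjnt_iff)
  qed
  have "topspace X - A = B" "topspace X - B = A" using assms by auto
  then have "connected_component_of_set X x = A" if "x \<in> A" for x
    using comp[OF that] assms by simp
  moreover have "connected_component_of_set X x = B" if "x \<in> B" for x
    using comp[OF that] assms \<open>topspace X - B = A\<close> by simp
  ultimately have "connected_component_of_set X ` A = {A}" "connected_component_of_set X ` B = {B}"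
    using assms(7,8) by (auto simp del: Collect_empty_eq)
  then show ?thesis
    unfolding connected_components_of_def assms(3) image_Un by (simp add: insert_commute)
qed

text \<open>The embedding of the sphere takes this form in every chart, with \<open>f = g\<close>
  and \<open>h = 1\<close> except around infinity.\<close>

lemma continuous_on_sphere:
  fixes f g :: "complex \<Rightarrow> complex" and h :: "complex \<Rightarrow> real"
  assumes "continuous_on S f" "continuous_on S g" "continuous_on S h"
  shows "continuous_on S (\<lambda>w. (g w / of_real (1 + (norm (f w))\<^sup>2), h w / (1 + norm (f w))))"
proof (intro continuous_intros assms ballI)
  fix w
  have "0 < 1 + (norm (f w))\<^sup>2" "0 < 1 + norm (f w)" by (auto simp: add_pos_nonneg)
  then show "complex_of_real (1 + (norm (f w))\<^sup>2) \<noteq> 0" "1 + norm (f w) \<noteq> 0"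
    by (metis less_irrefl of_real_eq_0_iff, linarith)
qed

lemma cis_eq_exp: "cis a = exp (\<i> * of_real a)"
  by (simp add: cis_conv_exp)

lemma inj_on_cis_unit: "inj_on (\<lambda>\<tau>. cis (2 * pi * \<tau>)) {0<..<1}"
proof (rule inj_onI)
  fix \<tau> \<tau>' :: real assume *: "\<tau> \<in> {0<..<1}" "\<tau>' \<in> {0<..<1}" "cis (2 * pi * \<tau>) = cis (2 * pi * \<tau>')"
  from *(3) have "exp (\<i> * of_real (2 * pi * \<tau>)) = exp (\<i> * of_real (2 * pi * \<tau>'))"
    by (simp only: cis_eq_exp)
  from exp_inj_strip[OF this] have "\<i> * of_real (2 * pi * \<tau>) = \<i> * of_real (2 * pi * \<tau>')"
    using *(1,2) by simp
  then show "\<tau> = \<tau>'" by (simp add: complex_eq_iff)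
qed

lemma unit_circle_minus_1: "(\<lambda>\<tau>. cis (2 * pi * \<tau>)) ` {0<..<1} = {z. norm z = 1 \<and> z \<noteq> 1}"
proof (intro equalityI subsetI)
  fix z assume "z \<in> (\<lambda>\<tau>. cis (2 * pi * \<tau>)) ` {0<..<1}"
  then obtain \<tau> where \<tau>: "0 < \<tau>" "\<tau> < 1" "z = cis (2 * pi * \<tau>)" by auto
  have "z \<noteq> 1"
  proof
    assume "z = 1"
    then have "exp (\<i> * of_real (2 * pi * \<tau>)) = 1" using \<tau>(3) by (simp only: cis_eq_exp)
    then obtain k where k: "\<i> * of_real (2 * pi * \<tau>) = turn k"
      using exp_eq_1_imp_turn by blast
    then have "Im (\<i> * of_real (2 * pi * \<tau>)) = Im (turn k)" by (simp only:)
    then have "2 * pi * \<tau> = 2 * pi * of_int k" by simp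
    then have "\<tau> = of_int k" by simp
    then show False using \<tau> by auto
  qed
  then show "z \<in> {z. norm z = 1 \<and> z \<noteq> 1}" using \<tau> by simp
next
  fix z :: complex assume "z \<in> {z. norm z = 1 \<and> z \<noteq> 1}"
  then have z: "norm z = 1" "z \<noteq> 1" by auto
  then have "z \<noteq> 0" by auto
  then obtain u where u: "z = exp u" by (metis exp_Ln)
  obtain j r where r: "u = r + turn j" "0 \<le> Im r" "Im r < 2 * pi" using split_turn .
  then have zr: "z = exp r" by (simp add: u)
  then have "Re r = 0" using z by simp
  then have re: "r = \<i> * of_real (2 * pi * (Im r / (2 * pi)))" by (simp add: complex_eq_iff)
  then have "z = cis (2 * pi * (Im r / (2 * pi)))" unfolding cis_eq_exp using zr by simp
  moreover have "Im r \<noteq> 0" using z zr \<open>Re r = 0\<close> by (auto simp: complex_eq_iff exp_eq_polar)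
  ultimately show "z \<in> (\<lambda>\<tau>. cis (2 * pi * \<tau>)) ` {0<..<1}"
    using r by (intro image_eqI[of _ _ "Im r / (2 * pi)"]) (auto simp: field_simps)
qed

context two_face_map
begin

section \<open>The covering of the sphere and the Hausdorff property\<close>

lemma chart_eq_centre:
  assumes "i \<in> indices" "w \<in> dom i"
  shows "chart i w = centre k \<longleftrightarrow> w = 0 \<and> k = i"
  using snd_chart_ne_0[OF assms] by (metis chart_0 centre_eq_iff snd_centre)

lemma snd_black: "w \<in> slit N \<Longrightarrow> snd (chart Black w) = w ^ N"
proof (cases "w = 0")
  case False
  assume "w \<in> slit N"
  then obtain s where "w = exp (s / of_nat N)" "exp s \<notin> from_one" using False black_cases by blast
  then show ?thesis using one_from_one N_pos by (auto simp: chart_black cell_def Let_def)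
qed (use N_pos in \<open>simp add: power_0_left\<close>)

lemma snd_white: "w \<in> slit N \<Longrightarrow> snd (chart White w) = inverse (w ^ N)"
proof (cases "w = 0")
  case False
  assume "w \<in> slit N"
  then obtain s where s: "w = exp (- (s / of_nat N))" "exp (- s) \<notin> from_one" using False white_cases by blast
  then have "exp s \<noteq> 1" using one_from_one by (auto simp: exp_minus)
  moreover have "inverse (w ^ N) = exp s" using s N_pos by (simp add: exp_minus power_inverse)
  ultimately show ?thesis by (simp add: s chart_white cell_def Let_def)
qed (use N_pos in \<open>simp add: power_0_left\<close>)

lemma snd_vertex:
  assumes "x \<in> Vs" "w \<in> ball 0 1" "w \<noteq> 0"
  shows "snd (chart (Vertex x) w) = exp (w ^ d)"
proof -
  obtain t where "w = exp (t / of_nat d)" "Re t < 0" using assms vertex_cases by blast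
  then show ?thesis using assms(1) star_value[of t x] d_pos by (metis chart_vertex exp_divide_power snd_conv)
qed

text \<open>The covering of the Riemann sphere, which is embedded into \<open>\<complex> \<times> \<real>\<close> by
  \<open>z \<mapsto> (z / (1 + |z|\<^sup>2), 1 / (1 + |z|))\<close> and \<open>\<infinity> \<mapsto> (0, 0)\<close>.\<close>
definition sphere_point :: "surface_point \<Rightarrow> complex \<times> real" where
  "sphere_point p = (if p = centre White then (0, 0) else
    let z = (if p = centre Black then 0 else if snd p = 0 then 1 else snd p)
    in (z / of_real (1 + (norm z)\<^sup>2), 1 / (1 + norm z)))"

lemma continuous_sphere_point: "continuous_map glued euclidean sphere_point"
proof (rule continuous_map_from_glued)
  fix i assume i: "i \<in> indices"
  then show "continuous_on (dom i) (\<lambda>z. sphere_point (chart i z))"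
  proof (cases rule: indices_cases)
    case 1
    have "sphere_point (chart i w) = (w ^ N / of_real (1 + (norm (w ^ N))\<^sup>2), 1 / (1 + norm (w ^ N)))"
      if "w \<in> dom i" for w
      using that 1 N_pos i
      by (auto simp: sphere_point_def chart_eq_centre snd_black Let_def power_0_left)
    moreover have "continuous_on (dom i) (\<lambda>w. (w ^ N / of_real (1 + (norm (w ^ N))\<^sup>2) :: complex, 1 / (1 + norm (w ^ N))))"
      by (intro continuous_on_sphere continuous_intros)
    ultimately show ?thesis by (simp cong: continuous_on_cong)
  next
    case 2
    \<comment> \<open>With \<open>y = w ^ N = 1 / z\<close> the embedding reads
      \<open>cnj y / (1 + |y|^2)\<close> and \<open>|y| / (1 + |y|)\<close>, which is continuous at
      \<open>y = 0\<close> too.\<close>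
    have "sphere_point (chart i w) = (cnj (w ^ N) / of_real (1 + (norm (w ^ N))\<^sup>2), norm (w ^ N) / (1 + norm (w ^ N)))"
      if w: "w \<in> dom i" for w
    proof (cases "w = 0")
      case True
      then show ?thesis using 2 N_pos by (simp add: sphere_point_def power_0_left)
    next
      case False
      define y where "y = w ^ N"
      have y: "y \<noteq> 0" using False by (simp add: y_def)
      have "sphere_point (chart i w) =
        (inverse y / of_real (1 + (norm (inverse y))\<^sup>2), 1 / (1 + norm (inverse y)))"
        using w 2 i False by (auto simp: sphere_point_def chart_eq_centre snd_white Let_def y_def)
      moreover have "inverse y / of_real (1 + (norm (inverse y))\<^sup>2) = cnj y / of_real (1 + (norm y)\<^sup>2)"
      proof -
        have n: "of_real ((norm y)\<^sup>2) = y * cnj y" by (rule complex_norm_square)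
        have 0: "(0::real) < (norm y)\<^sup>2" "(0::real) < 1 + (norm y)\<^sup>2" using y by (auto simp: add_pos_nonneg)
        have "(norm (inverse y))\<^sup>2 = inverse ((norm y)\<^sup>2)" by (simp only: norm_inverse power_inverse)
        then have "1 + (norm (inverse y))\<^sup>2 = (1 + (norm y)\<^sup>2) / (norm y)\<^sup>2"
          using 0(1) by (simp only: inverse_eq_divide add_divide_distrib) simp
        then have "inverse y / of_real (1 + (norm (inverse y))\<^sup>2) = inverse y * of_real ((norm y)\<^sup>2) / of_real (1 + (norm y)\<^sup>2)"
          by simp
        also have "inverse y * of_real ((norm y)\<^sup>2) = cnj y" unfolding n using y by simp
        finally show ?thesis .
      qed
      moreover have "1 / (1 + norm (inverse y)) = norm y / (1 + norm y)"
        using y by (simp only: norm_inverse) (simp add: field_simps)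
      ultimately show ?thesis by (simp add: y_def)
    qed
    moreover have "continuous_on (dom i) (\<lambda>w. (cnj (w ^ N) / of_real (1 + (norm (w ^ N))\<^sup>2) :: complex, norm (w ^ N) / (1 + norm (w ^ N))))"
      by (intro continuous_on_sphere continuous_intros)
    ultimately show ?thesis by (simp cong: continuous_on_cong)
  next
    case (3 x)
    have "sphere_point (chart i w) = (exp (w ^ d) / of_real (1 + (norm (exp (w ^ d)))\<^sup>2), 1 / (1 + norm (exp (w ^ d))))"
      if "w \<in> dom i" for w
      using that 3 d_pos i snd_vertex[of x w]
      by (cases "w = 0") (auto simp: sphere_point_def chart_eq_centre Let_def power_0_left)
    moreover have "continuous_on (dom i) (\<lambda>w. (exp (w ^ d) / of_real (1 + (norm (exp (w ^ d)))\<^sup>2) :: complex, 1 / (1 + norm (exp (w ^ d)))))"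
      by (intro continuous_on_sphere continuous_intros)
    ultimately show ?thesis by (simp cong: continuous_on_cong)
  qed
qed

text \<open>The second coordinate of \<open>sphere_point\<close> determines the norm of
  \<open>z\<close>, and then the first determines \<open>z\<close>. The fibre over 1 consists of the
  vertices, that over a \<open>z\<close> other than 0 and 1 of one point per sheet.\<close>

lemma sphere_point_inject:
  assumes p: "p \<in> carrier" "q \<in> carrier" and eq: "sphere_point p = sphere_point q"
  shows "p = q \<or> (\<exists>x\<in>Vs. \<exists>y\<in>Vs. p = centre (Vertex x) \<and> q = centre (Vertex y)) \<or>
    (snd p = snd q \<and> fst p \<in> range P \<and> fst q \<in> range P \<and> snd p \<notin> {0, 1})"
proof -
  define base where "base r = (if r = centre Black then 0 else if snd r = 0 then 1 else snd r)" for r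
  have sp: "sphere_point r = (base r / of_real (1 + (norm (base r))\<^sup>2), 1 / (1 + norm (base r)))"
    if "r \<noteq> centre White" for r
    using that by (simp add: sphere_point_def base_def Let_def)
  have pos: "snd (sphere_point r) > 0" if "r \<noteq> centre White" for r
    using sp[OF that] by (simp add: add_pos_nonneg)
  have zero: "snd (sphere_point (centre White)) = 0" by (simp add: sphere_point_def)
  show ?thesis
  proof (cases "p = centre White \<or> q = centre White")
    case True
    then have "p = q" using pos zero eq by (metis less_irrefl)
    then show ?thesis ..
  next
    case False
    then have 1: "1 / (1 + norm (base p)) = 1 / (1 + norm (base q))"
      and 2: "base p / of_real (1 + (norm (base p))\<^sup>2) = base q / of_real (1 + (norm (base q))\<^sup>2)"
      using eq sp by auto
    have "1 + norm (base p) \<noteq> 0" "1 + norm (base q) \<noteq> 0"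
      using norm_ge_zero[of "base p"] norm_ge_zero[of "base q"] by linarith+
    then have n: "norm (base p) = norm (base q)" using 1 by (simp add: frac_eq_eq)
    have "(0::real) < 1 + (norm (base q))\<^sup>2" by (simp add: add_pos_nonneg)
    then have "complex_of_real (1 + (norm (base q))\<^sup>2) \<noteq> 0" by (metis less_irrefl of_real_eq_0_iff)
    then have b: "base p = base q" using 2 unfolding n by (simp only: divide_cancel_right) simp
    have kinds: "r = centre Black \<and> base r = 0 \<or> (\<exists>x\<in>Vs. r = centre (Vertex x)) \<and> base r = 1 \<or>
        fst r \<in> range P \<and> snd r \<notin> {0, 1} \<and> base r = snd r"
      if "r \<in> carrier" "r \<noteq> centre White" for r
    proof -
      from that(1) have "(\<exists>i\<in>indices. r = centre i) \<or> fst r \<in> range P \<and> snd r \<notin> {0, 1}"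
        unfolding carrier_eq by auto
      then show ?thesis using that(2) unfolding base_def by (auto elim!: indices_cases)
    qed
    show ?thesis using kinds[OF p(1)] kinds[OF p(2)] False b by auto
  qed
qed

text \<open>Points over different points of the sphere are separated by preimages of open sets.
  Within a fibre, two vertices have disjoint charts, and two points over a \<open>z\<close> other
  than 0 and 1 lie in one and the same face chart, a copy of an open set of the plane.\<close>

lemma Hausdorff_glued: "Hausdorff_space glued"
  unfolding Hausdorff_space_def topspace_glued
proof (intro allI impI)
  fix p q assume "p \<in> carrier \<and> q \<in> carrier \<and> p \<noteq> q"
  then have p: "p \<in> carrier" "q \<in> carrier" "p \<noteq> q" by auto
  have common: "\<exists>U W. openin glued U \<and> openin glued W \<and> p \<in> U \<and> q \<in> W \<and> disjnt U W"
    if i: "i \<in> indices" and pq: "p \<in> chart i ` dom i" "q \<in> chart i ` dom i" for i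
  proof -
    obtain a b where ab: "p = chart i a" "q = chart i b" "a \<in> dom i" "b \<in> dom i" using pq by blast
    then have "a \<noteq> b" using p by auto
    then obtain A B where AB: "open A" "open B" "a \<in> A" "b \<in> B" "A \<inter> B = {}" using hausdorff by metis
    have "openin glued (chart i ` (A \<inter> dom i))" "openin glued (chart i ` (B \<inter> dom i))"
      using openin_image[OF i] open_V[OF i] AB by auto
    moreover have "disjnt (chart i ` (A \<inter> dom i)) (chart i ` (B \<inter> dom i))"
      using AB inj_onD[OF chart_inj[OF i]] by (auto simp: disjnt_iff) blast
    ultimately show ?thesis using ab AB by blast
  qed
  show "\<exists>U W. openin glued U \<and> openin glued W \<and> p \<in> U \<and> q \<in> W \<and> disjnt U W"
  proof (cases "sphere_point p = sphere_point q")
    case False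
    then obtain A B where AB: "open A" "open B" "sphere_point p \<in> A" "sphere_point q \<in> B" "A \<inter> B = {}"
      using hausdorff by metis
    have "openin glued {r \<in> topspace glued. sphere_point r \<in> A}" "openin glued {r \<in> topspace glued. sphere_point r \<in> B}"
      using continuous_sphere_point AB unfolding continuous_map_def by simp_all
    then show ?thesis using p AB
      by (intro exI[of _ "{r \<in> topspace glued. sphere_point r \<in> A}"] exI[of _ "{r \<in> topspace glued. sphere_point r \<in> B}"])
        (auto simp: disjnt_iff)
  next
    case True
    from sphere_point_inject[OF p(1,2) True] p(3)
    consider x y where "x \<in> Vs" "y \<in> Vs" "p = centre (Vertex x)" "q = centre (Vertex y)"
      | "snd p = snd q" "fst p \<in> range P" "fst q \<in> range P" "snd p \<noteq> 0" "snd p \<noteq> 1"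
      by auto
    then show ?thesis
    proof cases
      case 1
      have "x \<noteq> y" using 1 p by auto
      then have "disjnt (chart (Vertex x) ` ball 0 1) (chart (Vertex y) ` ball 0 1)"
        unfolding disjnt_iff using vertex_charts_disjoint[OF 1(1,2)] by blast
      moreover have "openin glued (chart (Vertex x) ` ball 0 1)" "openin glued (chart (Vertex y) ` ball 0 1)"
        using openin_image[of "Vertex x" "ball 0 1"] openin_image[of "Vertex y" "ball 0 1"] 1 by auto
      moreover have "p \<in> chart (Vertex x) ` ball 0 1" "q \<in> chart (Vertex y) ` ball 0 1"
        using 1 by (auto intro!: image_eqI[of _ _ 0])
      ultimately show ?thesis by blast
    next
      case 2
      show ?thesis
      proof (cases "snd p \<in> from_one")
        case False
        then have "p \<in> chart Black ` dom Black" "q \<in> chart Black ` dom Black"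
          using 2 by (auto simp: black_slit mem_Times_iff)
        then show ?thesis using common[of Black] by simp
      next
        case True
        then have "inverse (snd p) \<notin> from_one" using inverse_notin_from_one 2 by blast
        then have "p \<in> chart White ` dom White" "q \<in> chart White ` dom White"
          using 2 by (auto simp: white_slit mem_Times_iff)
        then show ?thesis using common[of White] by simp
      qed
    qed
  qed
qed

section \<open>Faces and skeleton\<close>

definition skeleton :: "surface_point set" where
  "skeleton = centre ` Vertex ` Vs \<union> range P \<times> {z. norm z = 1 \<and> z \<noteq> 1}"

definition face :: "chart_index \<Rightarrow> surface_point set" where
  "face i = chart i ` ball 0 1"

lemma black_corner: "chart Black (cis (2 * pi * of_int j / of_nat N)) = centre (Vertex (src (P j)))"
proof -
  have "cis (2 * pi * of_int j / of_nat N) = exp (turn j / of_nat N)"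
    unfolding cis_eq_exp by (rule arg_cong[of _ _ exp]) (simp add: complex_eq_iff)
  then show ?thesis using cell_strip[of 0 P j] by (simp add: chart_black)
qed

lemma white_corner: "chart White (cis (2 * pi * of_int j / of_nat N)) = centre (Vertex (src (Q (- j))))"
proof -
  have "cis (2 * pi * of_int j / of_nat N) = exp (- (turn (- j) / of_nat N))"
    unfolding cis_eq_exp by (rule arg_cong[of _ _ exp]) (simp add: complex_eq_iff)
  then show ?thesis using cell_strip[of 0 Q "- j"] by (simp add: chart_white)
qed

lemma cell_on_edge:
  assumes "0 < \<tau>" "\<tau> < 1"
  shows "cell K (\<i> * of_real (2 * pi * \<tau>) + turn j) = (K j, cis (2 * pi * \<tau>))"
proof -
  have "cis (2 * pi * \<tau>) \<noteq> 1" using unit_circle_minus_1 assms by (metis (mono_tags, lifting) greaterThanLessThan_iff image_eqI mem_Collect_eq)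
  then have "exp (\<i> * of_real (2 * pi * \<tau>)) \<noteq> 1" by (simp add: cis_eq_exp)
  then show ?thesis using cell_strip[of "\<i> * of_real (2 * pi * \<tau>)" K j] assms
    by (simp only: cis_eq_exp) simp
qed

lemma black_arc:
  assumes "0 < \<tau>" "\<tau> < 1"
  shows "chart Black (cis (2 * pi * (of_int j + \<tau>) / of_nat N)) = (P j, cis (2 * pi * \<tau>))"
proof -
  have "cis (2 * pi * (of_int j + \<tau>) / of_nat N) = exp ((\<i> * of_real (2 * pi * \<tau>) + turn j) / of_nat N)"
    unfolding cis_eq_exp by (rule arg_cong[of _ _ exp]) (simp add: complex_eq_iff distrib_left)
  then show ?thesis using cell_on_edge[OF assms] by (simp only: chart_black)
qed

text \<open>Since \<open>w = exp (- s / N)\<close>, going counterclockwise around the white disc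
  runs through \<open>Q\<close> backwards and along each edge from \<open>\<tau> = 1\<close> to
  \<open>\<tau> = 0\<close>. The arc from \<open>j\<close> to \<open>j + 1\<close> bounds the strip
  between \<open>- j - 1\<close> and \<open>- j\<close>, whence the index.\<close>

lemma white_arc:
  assumes "0 < \<tau>" "\<tau> < 1"
  shows "chart White (cis (2 * pi * (of_int j + 1 - \<tau>) / of_nat N)) = (Q (- j - 1), cis (2 * pi * \<tau>))"
proof -
  have "cis (2 * pi * (of_int j + 1 - \<tau>) / of_nat N) =
      exp (- ((\<i> * of_real (2 * pi * \<tau>) + turn (- j - 1)) / of_nat N))"
    unfolding cis_eq_exp by (rule arg_cong[of _ _ exp]) (simp add: complex_eq_iff algebra_simps add_divide_distrib diff_divide_distrib)
  then show ?thesis using cell_on_edge[OF assms] by (simp only: chart_white)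
qed

lemma face_eq:
  "face Black = insert (centre Black) (range P \<times> {z. z \<noteq> 0 \<and> norm z < 1})"
  "face White = insert (centre White) (range P \<times> {z. norm z > 1})"
  by (simp_all add: face_def black_ball white_ball)

lemma skeleton_subset_image:
  "skeleton \<subseteq> chart Black ` cball 0 1" "skeleton \<subseteq> chart White ` cball 0 1"
proof -
  have vert: "\<exists>j. x = src (P j)" "\<exists>j. x = src (Q j)" if "x \<in> Vs" for x
  proof -
    have "R x 0 \<in> {l \<in> range P. src l = x}" using range_R[OF that] by blast
    then show "\<exists>j. x = src (P j)" "\<exists>j. x = src (Q j)" using range_Q by (auto, metis imageE rangeI)
  qed
  show "skeleton \<subseteq> chart Black ` cball 0 1"
  proof
    fix p assume "p \<in> skeleton"
    then consider x where "x \<in> Vs" "p = centre (Vertex x)"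
      | j \<tau> where "0 < \<tau>" "\<tau> < 1" "p = (P j, cis (2 * pi * \<tau>))"
      unfolding skeleton_def unit_circle_minus_1[symmetric] by auto
    then have "\<exists>a. p = chart Black (cis a)"
      using vert(1) black_corner black_arc by cases metis+
    then show "p \<in> chart Black ` cball 0 1" by auto
  qed
  show "skeleton \<subseteq> chart White ` cball 0 1"
  proof
    fix p assume "p \<in> skeleton"
    then consider x where "x \<in> Vs" "p = centre (Vertex x)"
      | j \<tau> where "0 < \<tau>" "\<tau> < 1" "p = (Q j, cis (2 * pi * \<tau>))"
      unfolding skeleton_def unit_circle_minus_1[symmetric] range_Q[symmetric] by auto
    then have "\<exists>a. p = chart White (cis a)"
    proof cases
      case 1
      then obtain j where "x = src (Q j)" using vert(2) by blast
      then show ?thesis using white_corner[of "- j"] 1 by (metis minus_minus)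
    next
      case (2 j \<tau>)
      then show ?thesis using white_arc[of \<tau> "- j - 1"] by (metis (no_types, lifting) add_diff_cancel_right' diff_minus_eq_add minus_diff_eq uminus_add_conv_diff)
    qed
    then show "p \<in> chart White ` cball 0 1" by auto
  qed
qed

text \<open>The three sets lie over the inside, the outside and the circumference of the unit
  circle; 0 and infinity are represented by the face centres and 1 by the vertices.\<close>

lemma carrier_partition:
  "carrier = face Black \<union> face White \<union> skeleton"
  "face Black \<inter> face White = {}" "face Black \<inter> skeleton = {}" "face White \<inter> skeleton = {}"
proof -
  have [simp]: "centre i \<noteq> (l, z)" if "z \<noteq> 0" for i l z using that snd_centre[of i] by (metis snd_conv)
  show "carrier = face Black \<union> face White \<union> skeleton"
  proof -
    have "- {0, 1} = {z. z \<noteq> 0 \<and> norm z < 1} \<union> {z. norm z > 1} \<union> {z :: complex. norm z = 1 \<and> z \<noteq> 1}"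
      by auto
    then have "range P \<times> - {0, 1} = range P \<times> {z. z \<noteq> 0 \<and> norm z < 1} \<union> range P \<times> {z. norm z > 1} \<union> range P \<times> {z :: complex. norm z = 1 \<and> z \<noteq> 1}"
      by (simp only: Sigma_Un_distrib2)
    then show ?thesis unfolding carrier_eq unfolding face_eq skeleton_def indices_def by auto
  qed
  have zero: "z = 0" if "(l, z) = centre i" for l z i using arg_cong[OF that, of snd] by simp
  show "face Black \<inter> face White = {}" "face Black \<inter> skeleton = {}" "face White \<inter> skeleton = {}"
    unfolding face_eq skeleton_def by (auto dest!: zero dest: zero[OF sym])
qed

lemma disc_image_subset: "i = Black \<or> i = White \<Longrightarrow> chart i ` cball 0 1 \<subseteq> carrier"
  using continuous_map_image_subset_topspace[OF continuous_map_closed_disc] by fastforce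

lemma carrier_discs: "carrier = chart Black ` cball 0 1 \<union> chart White ` cball 0 1"
proof
  show "carrier \<subseteq> chart Black ` cball 0 1 \<union> chart White ` cball 0 1"
    unfolding carrier_partition(1) face_def using skeleton_subset_image(1) by auto
qed (use disc_image_subset in auto)

text \<open>Two images of the closed disc cover the surface, which makes it compact; they meet in
  the skeleton, which makes it connected.\<close>

lemma closed_surface_glued: "closed_surface glued"
  unfolding closed_surface_def
proof (intro conjI)
  show "topspace glued \<noteq> {}" using carrier_partition(1) by (simp add: face_eq)
  show "compact_space glued"
    unfolding compact_space_def topspace_glued carrier_discs
    by (intro compactin_Un image_compactin[OF _ continuous_map_closed_disc]) auto
  have "connectedin glued (chart i ` cball 0 1)" if "i = Black \<or> i = White" for i
    by (rule connectedin_continuous_map_image[OF continuous_map_closed_disc[OF that]])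
      (simp add: connectedin_subtopology connectedin_iff_connected)
  moreover have "skeleton \<noteq> {}" using src_P by (auto simp: skeleton_def)
  then have "chart Black ` cball 0 1 \<inter> chart White ` cball 0 1 \<noteq> {}"
    using skeleton_subset_image by blast
  ultimately have "connectedin glued carrier"
    unfolding carrier_discs by (intro connectedin_Un) auto
  then show "connected_space glued" by (metis connectedin_topspace topspace_glued)
  show "\<forall>x\<in>topspace glued. \<exists>U (V :: complex set). openin glued U \<and> x \<in> U \<and> open V \<and>
    (subtopology glued U) homeomorphic_space (top_of_set V)"
    using locally_planar by blast
qed (rule Hausdorff_glued second_countable_glued)+

lemma ball_subset_slit: "ball 0 1 \<subseteq> slit N"
proof
  fix w :: complex assume "w \<in> ball 0 1"
  then have "norm (w ^ N) < 1" using N_pos by (simp add: norm_power power_less_one_iff)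
  then have "Re (w ^ N) < 1" using complex_Re_le_cmod[of "w ^ N"] by linarith
  then show "w \<in> slit N" by (simp add: slit_def from_one_def)
qed

lemma homeomorphic_map_face:
  assumes "i = Black \<or> i = White"
  shows "homeomorphic_map (top_of_set (ball 0 1)) (subtopology glued (face i)) (chart i)"
  unfolding face_def using homeomorphic_map_chart[of i "ball 0 1"] ball_subset_slit assms by auto

lemma openin_face: "i = Black \<or> i = White \<Longrightarrow> openin glued (face i)"
  unfolding face_def using openin_image[of i "ball 0 1"] ball_subset_slit by auto

lemma connectedin_face:
  assumes "i = Black \<or> i = White" shows "connectedin glued (face i)"
  unfolding face_def
  by (rule connectedin_continuous_map_image[OF continuous_map_closed_disc[OF assms]])
    (simp add: connectedin_subtopology connectedin_iff_connected)

lemma components_minus_skeleton: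
  "connected_components_of (subtopology glued (topspace glued - skeleton)) = {face Black, face White}"
proof (rule connected_components_of_two_open)
  have sub: "face Black \<subseteq> topspace glued - skeleton" "face White \<subseteq> topspace glued - skeleton"
    using carrier_partition by auto
  show "openin (subtopology glued (topspace glued - skeleton)) (face Black)"
    "openin (subtopology glued (topspace glued - skeleton)) (face White)"
    using sub openin_face by (auto simp: openin_subtopology)
  show "topspace (subtopology glued (topspace glued - skeleton)) = face Black \<union> face White"
    using carrier_partition by auto
  show "connectedin (subtopology glued (topspace glued - skeleton)) (face Black)"
    "connectedin (subtopology glued (topspace glued - skeleton)) (face White)"
    using sub connectedin_face by (simp_all add: connectedin_subtopology)
qed (use carrier_partition in \<open>auto simp: face_eq\<close>)

text \<open>The continuous image of the closed disc lies in the closure of the image of the open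
  disc, and it contains the skeleton.\<close>

lemma skeleton_subset_closure:
  assumes i: "i = Black \<or> i = White" shows "skeleton \<subseteq> glued closure_of face i"
proof -
  have "top_of_set (cball 0 1) closure_of ball (0 :: complex) 1 = cball 0 1"
    using ball_subset_cball[of "0 :: complex" 1] by (simp add: closure_of_subtopology Int_absorb1)
  then have "chart i ` cball 0 1 \<subseteq> glued closure_of face i"
    unfolding face_def using continuous_map_image_closure_subset[OF continuous_map_closed_disc[OF i], of "ball 0 1"] by simp
  then show ?thesis using skeleton_subset_image i by blast
qed

end

section \<open>Drawing a graph on the surface\<close>

text \<open>\<open>lab\<close> and \<open>vid\<close> number the edges and vertices of
  \<open>G\<close>; \<open>head_step\<close> makes \<open>P\<close> a closed walk that follows the
  orientation from \<open>tail\<close> to \<open>head\<close>.\<close>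

locale two_face_graph = two_face_map N d P Q R Vs src
  for N d :: nat and P Q :: "int \<Rightarrow> nat" and R :: "nat \<Rightarrow> int \<Rightarrow> nat" and Vs :: "nat set" and src :: "nat \<Rightarrow> nat" +
  fixes G :: "('v, 'e) multigraph" and lab :: "'e \<Rightarrow> nat" and vid :: "'v \<Rightarrow> nat" and tail head :: "'e \<Rightarrow> 'v"
  assumes inj_lab: "inj_on lab (edges G)" and lab_edges: "lab ` edges G = range P"
    and inj_vid: "inj_on vid (verts G)" and vid_verts: "vid ` verts G = Vs"
    and ends: "e \<in> edges G \<Longrightarrow> ends G e = {tail e, head e}"
    and tail_in: "e \<in> edges G \<Longrightarrow> tail e \<in> verts G" and head_in: "e \<in> edges G \<Longrightarrow> head e \<in> verts G"
    and tail_neq_head: "e \<in> edges G \<Longrightarrow> tail e \<noteq> head e"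
    and src_lab: "e \<in> edges G \<Longrightarrow> src (lab e) = vid (tail e)"
    and head_step: "e \<in> edges G \<Longrightarrow> lab e = P j \<Longrightarrow> vid (head e) = src (P (j + 1))"
begin

text \<open>Barycentric coordinates in the bisected edge: the point moves from the tail at
  \<open>\<tau> = 0\<close> through the midpoint at \<open>\<tau> = 1 / 2\<close> to the head at
  \<open>\<tau> = 1\<close>.\<close>

definition edge_point :: "'e \<Rightarrow> real \<Rightarrow> ('v + 'e \<Rightarrow> real)" where
  "edge_point e \<tau> = (\<lambda>w. if w = Inr e then 2 * min \<tau> (1 - \<tau>)
    else if w = Inl (tail e) then max 0 (1 - 2 * \<tau>)
    else if w = Inl (head e) then max 0 (2 * \<tau> - 1) else 0)"

text \<open>One linear, hence continuous, expression recovers \<open>\<tau>\<close> on both halves: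
  it is \<open>\<tau> + 0\<close> before the midpoint and
  \<open>(1 - \<tau>) + (2 * \<tau> - 1)\<close> after it.\<close>

definition param :: "'e \<Rightarrow> ('v + 'e \<Rightarrow> real) \<Rightarrow> real" where
  "param e x = x (Inr e) / 2 + x (Inl (head e))"

lemma edge_point_0: "edge_point e 0 = (\<lambda>w. if w = Inl (tail e) then 1 else 0)"
  by (auto simp: edge_point_def)

lemma edge_point_1: "e \<in> edges G \<Longrightarrow> edge_point e 1 = (\<lambda>w. if w = Inl (head e) then 1 else 0)"
  using tail_neq_head by (auto simp: edge_point_def)

lemma param_edge_point:
  assumes "e \<in> edges G" shows "param e (edge_point e \<tau>) = \<tau>"
  using tail_neq_head[OF assms] by (auto simp: param_def edge_point_def min_def max_def)

lemma edge_point_midpoint_pos: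
  assumes "0 \<le> \<tau>" "\<tau> \<le> 1"
  shows "0 < edge_point e \<tau> (Inr e') \<longleftrightarrow> e' = e \<and> 0 < \<tau> \<and> \<tau> < 1"
  using assms by (auto simp: edge_point_def)

lemma exists_out_edge:
  assumes "u \<in> verts G" obtains e where "e \<in> edges G" "tail e = u"
proof -
  have u: "vid u \<in> Vs" using assms vid_verts by blast
  have "R (vid u) 0 \<in> {l \<in> range P. src l = vid u}" using range_R[OF u] by blast
  then obtain e where e: "e \<in> edges G" "src (lab e) = vid u" using lab_edges by (metis (mono_tags, lifting) imageE mem_Collect_eq)
  then have "vid (tail e) = vid u" using src_lab by simp
  then have "tail e = u" using inj_onD[OF inj_vid] assms tail_in e by blast
  then show thesis using that e by blast
qed

text \<open>No vertex is isolated, since its rotation lists an edge that leaves it; so the closed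
  edges cover the vertices as well.\<close>

lemma realization_eq: "realization G = (\<Union>e\<in>edges G. edge_point e ` {0..1})"
proof (intro equalityI subsetI)
  fix x assume "x \<in> realization G"
  then obtain S where x: "\<forall>w. 0 \<le> x w" and S: "S \<in> subdivision_simplices G"
    "\<forall>w. w \<notin> S \<longrightarrow> x w = 0" "(\<Sum>w\<in>S. x w) = 1"
    unfolding realization_def by blast
  from S(1) consider u where "S = {Inl u}" "u \<in> verts G" | e where "S = {Inr e}" "e \<in> edges G"
    | u e where "S = {Inl u, Inr e}" "e \<in> edges G" "u \<in> ends G e"
    unfolding subdivision_simplices_def by blast
  then show "x \<in> (\<Union>e\<in>edges G. edge_point e ` {0..1})"
  proof cases
    case 1
    obtain e where e: "e \<in> edges G" "tail e = u" using exists_out_edge[OF 1(2)] .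
    have "x = edge_point e 0" using S 1 e by (auto simp: edge_point_0 fun_eq_iff)
    then show ?thesis by (intro UN_I[OF e(1)] image_eqI[of _ _ 0]) auto
  next
    case 2
    have "x = edge_point e (1 / 2)" using S 2 by (auto simp: edge_point_def fun_eq_iff)
    then show ?thesis by (intro UN_I[OF 2(2)] image_eqI[of _ _ "1 / 2"]) auto
  next
    case 3
    have sum: "x (Inl u) + x (Inr e) = 1" using S 3 by simp
    have u: "u = tail e \<or> u = head e" using ends[OF 3(2)] 3(3) by auto
    have bounds: "0 \<le> x (Inl u)" "0 \<le> x (Inr e)" using x by auto
    from u show ?thesis
    proof
      assume u: "u = tail e"
      have "x = edge_point e (x (Inr e) / 2)"
        using S(2) 3 sum bounds tail_neq_head[OF 3(2)] unfolding u
        by (auto simp: edge_point_def fun_eq_iff min_def max_def)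
      moreover have "x (Inr e) / 2 \<in> {0..1}" using sum bounds by auto
      ultimately show ?thesis using 3 by blast
    next
      assume u: "u = head e"
      have "x = edge_point e (1 - x (Inr e) / 2)"
        using S(2) 3 sum bounds tail_neq_head[OF 3(2)] unfolding u
        by (auto simp: edge_point_def fun_eq_iff min_def max_def)
      moreover have "1 - x (Inr e) / 2 \<in> {0..1}" using sum bounds by auto
      ultimately show ?thesis using 3 by blast
    qed
  qed
next
  fix x assume "x \<in> (\<Union>e\<in>edges G. edge_point e ` {0..1})"
  then obtain e \<tau> where e: "e \<in> edges G" "x = edge_point e \<tau>" "0 \<le> \<tau>" "\<tau> \<le> 1" by auto
  define u where "u = (if \<tau> \<le> 1 / 2 then tail e else head e)"
  have "{Inl u, Inr e} \<in> subdivision_simplices G"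
    using e ends[OF e(1)] unfolding subdivision_simplices_def u_def by auto
  moreover have "\<forall>w. w \<notin> {Inl u, Inr e} \<longrightarrow> x w = 0"
    using tail_neq_head[OF e(1)] by (auto simp: e u_def edge_point_def)
  moreover have "(\<Sum>w\<in>{Inl u, Inr e}. x w) = 1"
    using tail_neq_head[OF e(1)] by (auto simp: e u_def edge_point_def)
  moreover have "\<forall>w. 0 \<le> x w" using e by (auto simp: edge_point_def)
  ultimately show "x \<in> realization G" unfolding realization_def by blast
qed

lemma realization_cases:
  assumes "x \<in> realization G"
  obtains (vertex) u where "u \<in> verts G" "x = (\<lambda>w. if w = Inl u then 1 else 0)"
    | (edge) e \<tau> where "e \<in> edges G" "0 < \<tau>" "\<tau> < 1" "x = edge_point e \<tau>"
proof -
  obtain e \<tau> where e: "e \<in> edges G" "x = edge_point e \<tau>" "0 \<le> \<tau>" "\<tau> \<le> 1"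
    using assms unfolding realization_eq by auto
  consider "\<tau> = 0" | "\<tau> = 1" | "0 < \<tau>" "\<tau> < 1" using e by linarith
  then show thesis
    using that edge_point_0 edge_point_1 e tail_in head_in by cases blast+
qed

definition drawing :: "('v + 'e \<Rightarrow> real) \<Rightarrow> surface_point" where
  "drawing x = (if \<exists>e\<in>edges G. 0 < x (Inr e)
    then (let e = (THE e. e \<in> edges G \<and> 0 < x (Inr e)) in (lab e, cis (2 * pi * param e x)))
    else centre (Vertex (vid (THE u. x (Inl u) = 1))))"

lemma drawing_vertex: "drawing (\<lambda>w. if w = Inl u then 1 else 0) = centre (Vertex (vid u))"
proof -
  have "(THE u'. (if Inl u' = (Inl u :: 'v + 'e) then 1 else 0) = (1 :: real)) = u"
    by (rule the_equality) (auto split: if_splits)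
  then show ?thesis by (simp add: drawing_def)
qed

lemma drawing_edge:
  assumes "e \<in> edges G" "0 < \<tau>" "\<tau> < 1"
  shows "drawing (edge_point e \<tau>) = (lab e, cis (2 * pi * \<tau>))"
proof -
  have "(THE e'. e' \<in> edges G \<and> 0 < edge_point e \<tau> (Inr e')) = e"
    by (rule the_equality) (use assms edge_point_midpoint_pos[of \<tau> e] in auto)
  moreover have "\<exists>e'\<in>edges G. 0 < edge_point e \<tau> (Inr e')"
    using assms edge_point_midpoint_pos[of \<tau> e e] by auto
  ultimately show ?thesis using assms by (simp add: drawing_def param_edge_point)
qed

text \<open>On a closed edge the drawing factors through the closed black disc; its continuity there
  comes from \<open>continuous_map_closed_disc\<close>.\<close>

lemma drawing_black:
  assumes e: "e \<in> edges G" "lab e = P j" and \<tau>: "0 \<le> \<tau>" "\<tau> \<le> 1"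
  shows "drawing (edge_point e \<tau>) = chart Black (cis (2 * pi * (of_int j + \<tau>) / of_nat N))"
proof -
  consider "\<tau> = 0" | "\<tau> = 1" | "0 < \<tau>" "\<tau> < 1" using \<tau> by linarith
  then show ?thesis
  proof cases
    case 1
    then show ?thesis using black_corner[of j] e src_lab[OF e(1)] by (simp add: edge_point_0 drawing_vertex)
  next
    case 2
    then show ?thesis using black_corner[of "j + 1"] e head_step[OF e] by (simp add: edge_point_1 drawing_vertex)
  next
    case 3
    then show ?thesis using black_arc[of \<tau> j] drawing_edge[OF e(1)] e by simp
  qed
qed

lemma drawing_inj: "inj_on drawing (realization G)"
proof (rule inj_onI)
  fix x y assume x: "x \<in> realization G" and y: "y \<in> realization G" and eq: "drawing x = drawing y"
  have ne: "drawing (edge_point e \<tau>) \<noteq> centre i" if "e \<in> edges G" "0 < \<tau>" "\<tau> < 1" for e \<tau> i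
    using drawing_edge[OF that] by (metis cis_neq_zero snd_centre snd_conv)
  from x show "x = y"
  proof (cases rule: realization_cases)
    case (vertex u)
    from y show ?thesis
    proof (cases rule: realization_cases)
      case (vertex u')
      then have "vid u = vid u'" using eq \<open>x = _\<close> by (simp add: drawing_vertex)
      then have "u = u'" using inj_onD[OF inj_vid] vertex \<open>u \<in> verts G\<close> by blast
      then show ?thesis using vertex \<open>x = _\<close> by simp
    next
      case (edge e \<tau>)
      then show ?thesis using ne[OF edge(1-3), of "Vertex (vid u)"] eq vertex edge(4) by (simp add: drawing_vertex)
    qed
  next
    case (edge e \<tau>)
    from y show ?thesis
    proof (cases rule: realization_cases)
      case (vertex u)
      then show ?thesis using ne[OF edge(1-3)] eq edge by (metis drawing_vertex)
    next
      case (edge e' \<tau>')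
      then have "lab e = lab e'" "cis (2 * pi * \<tau>) = cis (2 * pi * \<tau>')"
        using eq \<open>e \<in> edges G\<close> \<open>0 < \<tau>\<close> \<open>\<tau> < 1\<close> \<open>x = _\<close> by (simp_all add: drawing_edge)
      then have "e = e'" "\<tau> = \<tau>'"
        using inj_onD[OF inj_lab] inj_onD[OF inj_on_cis_unit] edge \<open>e \<in> edges G\<close> \<open>0 < \<tau>\<close> \<open>\<tau> < 1\<close> by auto
      then show ?thesis using edge \<open>x = _\<close> by simp
    qed
  qed
qed

lemma finite_edges: "finite (edges G)"
proof -
  have "range P \<subseteq> P ` {0..<int N}"
  proof (rule image_subsetI)
    fix j :: int
    have "P j = P (j mod int N)" unfolding P_eq_iff by (simp add: minus_mod_eq_mult_div)
    then show "P j \<in> P ` {0..<int N}" using N_pos by simp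
  qed
  then have "finite (lab ` edges G)" unfolding lab_edges by (rule finite_subset) simp
  then show ?thesis using inj_lab finite_imageD by blast
qed

lemma edge_obtain_index:
  assumes "e \<in> edges G" obtains j where "lab e = P j"
  using assms lab_edges by blast

text \<open>Vanishing of coordinates is a closed condition in the product topology. Parallel edges
  differ in their midpoint coordinate, so they contribute only their end points.\<close>

lemma closed_edge_eq:
  assumes e: "e \<in> edges G"
  shows "edge_point e ` {0..1} = {x \<in> realization G. \<forall>w. w \<notin> {Inr e, Inl (tail e), Inl (head e)} \<longrightarrow> x w = 0}"
    (is "?A = ?B")
proof (intro equalityI subsetI)
  fix x assume "x \<in> ?A"
  then show "x \<in> ?B" using e by (auto simp: realization_eq edge_point_def)
next
  fix x assume x: "x \<in> ?B"
  then have "x \<in> realization G" by simp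
  then show "x \<in> ?A"
  proof (cases rule: realization_cases)
    case (vertex u)
    have "u = tail e \<or> u = head e"
    proof (rule ccontr)
      assume "\<not> (u = tail e \<or> u = head e)"
      then have "x (Inl u) = 0" using x by simp
      then show False using vertex by simp
    qed
    then have "x = edge_point e 0 \<or> x = edge_point e 1"
      using vertex e edge_point_0[of e] edge_point_1[of e] by auto
    then show ?thesis by auto
  next
    case (edge e' \<tau>)
    then have "0 < x (Inr e')" using edge_point_midpoint_pos[of \<tau> e' e'] by simp
    then have "x (Inr e') \<noteq> 0" by simp
    then have "e' = e" using x by blast
    then show ?thesis using edge by auto
  qed
qed

lemma drawing_continuous: "continuous_map (top_of_set (realization G)) glued drawing"
proof (rule pasting_lemma_closed[where I = "edges G" and T = "\<lambda>e. edge_point e ` {0..1}" and f = "\<lambda>_. drawing"])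
  show "finite (edges G)" by (rule finite_edges)
  fix e assume e: "e \<in> edges G"
  show "closedin (top_of_set (realization G)) (edge_point e ` {0..1})"
  proof -
    have "closed {x :: 'v + 'e \<Rightarrow> real. \<forall>w. w \<notin> {Inr e, Inl (tail e), Inl (head e)} \<longrightarrow> x w = 0}"
      by (intro closed_Collect_all closed_Collect_imp open_Collect_const closed_Collect_eq continuous_on_product_coordinates continuous_on_const)
    moreover have "edge_point e ` {0..1} = realization G \<inter> {x. \<forall>w. w \<notin> {Inr e, Inl (tail e), Inl (head e)} \<longrightarrow> x w = 0}"
      unfolding closed_edge_eq[OF e] by auto
    ultimately show ?thesis by (simp only: closedin_closed_Int)
  qed
  obtain j where j: "lab e = P j" using edge_obtain_index[OF e] .
  have sub: "edge_point e ` {0..1} \<subseteq> realization G" using e by (auto simp: realization_eq)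
  have "continuous_on (edge_point e ` {0..1}) (\<lambda>x. cis (2 * pi * (of_int j + param e x) / of_nat N))"
  proof -
    have c: "continuous_on (edge_point e ` {0..1}) (\<lambda>x. x w)" for w
      by (rule continuous_on_subset[OF continuous_on_product_coordinates subset_UNIV])
    show ?thesis
      unfolding param_def cis_conv_exp by (intro continuous_intros c) (use N_pos in simp_all)
  qed
  then have "continuous_map (top_of_set (edge_point e ` {0..1})) (top_of_set (cball 0 1))
      (\<lambda>x. cis (2 * pi * (of_int j + param e x) / of_nat N))"
    by (intro continuous_map_into_subtopology) auto
  then have "continuous_map (top_of_set (edge_point e ` {0..1})) glued
      (chart Black \<circ> (\<lambda>x. cis (2 * pi * (of_int j + param e x) / of_nat N)))"
    by (rule continuous_map_compose) (simp add: continuous_map_closed_disc)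
  then have "continuous_map (top_of_set (edge_point e ` {0..1})) glued drawing"
    by (rule continuous_map_eq) (auto simp: drawing_black[OF e j] param_edge_point[OF e])
  then show "continuous_map (subtopology (top_of_set (realization G)) (edge_point e ` {0..1})) glued drawing"
    using sub by (simp add: subtopology_subtopology Int_absorb1)
qed (auto simp: realization_eq)

lemma drawing_open_edge:
  assumes e: "e \<in> edges G"
  shows "drawing ` open_edge G e = {lab e} \<times> {z. norm z = 1 \<and> z \<noteq> 1}"
proof -
  have "open_edge G e = edge_point e ` {0<..<1}"
  proof (intro equalityI subsetI)
    fix x assume "x \<in> open_edge G e"
    then have x: "x \<in> realization G" "0 < x (Inr e)" by (auto simp: open_edge_def)
    then show "x \<in> edge_point e ` {0<..<1}"
    proof (cases rule: realization_cases)
      case (edge e' \<tau>)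
      then show ?thesis using x(2) edge_point_midpoint_pos[of \<tau> e' e] by auto
    qed auto
  next
    fix x assume "x \<in> edge_point e ` {0<..<1}"
    then show "x \<in> open_edge G e"
      using e edge_point_midpoint_pos by (force simp: open_edge_def realization_eq)
  qed
  then have "drawing ` open_edge G e = (\<lambda>\<tau>. (lab e, cis (2 * pi * \<tau>))) ` {0<..<1}"
    using drawing_edge[OF e] by (auto simp: image_image image_iff)
  also have "\<dots> = {lab e} \<times> {z. norm z = 1 \<and> z \<noteq> 1}"
    unfolding unit_circle_minus_1[symmetric] by auto
  finally show ?thesis .
qed

lemma drawing_vertex_points: "drawing ` vertex_points G = centre ` Vertex ` Vs"
proof -
  have "vertex_points G = (\<lambda>u (w :: 'v + 'e). if w = Inl u then 1 else 0 :: real) ` verts G"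
  proof (intro equalityI subsetI)
    fix x assume "x \<in> vertex_points G"
    then obtain u where x: "x \<in> realization G" "u \<in> verts G" "x (Inl u) = 1" by (auto simp: vertex_points_def)
    from x(1) show "x \<in> (\<lambda>u (w :: 'v + 'e). if w = Inl u then 1 else 0 :: real) ` verts G"
    proof (cases rule: realization_cases)
      case (edge e \<tau>)
      then show ?thesis using x(3) by (auto simp: edge_point_def split: if_splits)
    qed auto
  next
    fix x assume "x \<in> (\<lambda>u (w :: 'v + 'e). if w = Inl u then 1 else 0 :: real) ` verts G"
    then obtain u where u: "u \<in> verts G" "x = (\<lambda>w. if w = Inl u then 1 else 0)" by blast
    obtain e where "e \<in> edges G" "tail e = u" using exists_out_edge[OF u(1)] .
    then have "x \<in> realization G" unfolding realization_eq using u edge_point_0[of e] by force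
    then show "x \<in> vertex_points G" using u by (auto simp: vertex_points_def)
  qed
  then show ?thesis unfolding vid_verts[symmetric] by (auto simp: image_image drawing_vertex)
qed

lemma drawing_realization: "drawing ` realization G = skeleton"
proof -
  have "realization G = vertex_points G \<union> (\<Union>e\<in>edges G. open_edge G e)"
  proof (intro equalityI subsetI)
    fix x assume x: "x \<in> realization G"
    then show "x \<in> vertex_points G \<union> (\<Union>e\<in>edges G. open_edge G e)"
    proof (cases rule: realization_cases)
      case (vertex u)
      then show ?thesis using x by (auto simp: vertex_points_def)
    next
      case (edge e \<tau>)
      then have "0 < x (Inr e)" using edge_point_midpoint_pos[of \<tau> e e] by simp
      then show ?thesis using x edge by (auto simp: open_edge_def)
    qed
  qed (auto simp: vertex_points_def open_edge_def)
  then have "drawing ` realization G = centre ` Vertex ` Vs \<union> (\<Union>e\<in>edges G. {lab e} \<times> {z. norm z = 1 \<and> z \<noteq> 1})"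
    by (simp add: image_Un image_UN drawing_vertex_points drawing_open_edge)
  also have "(\<Union>e\<in>edges G. {lab e} \<times> {z. norm z = 1 \<and> z \<noteq> 1}) = range P \<times> {z :: complex. norm z = 1 \<and> z \<noteq> 1}"
    unfolding lab_edges[symmetric] by auto
  finally show ?thesis by (simp add: skeleton_def)
qed

lemma faces_eq: "faces G glued drawing = {face Black, face White}"
  unfolding faces_def drawing_realization by (rule components_minus_skeleton)

lemma face_Black_neq_White: "face Black \<noteq> face White"
proof
  assume "face Black = face White"
  then have "face Black = {}" using carrier_partition(2) by simp
  then show False by (simp add: face_eq(1))
qed

text \<open>Both faces have every edge in their closure, so the colouring that singles out the black
  face is proper.\<close>

lemma biembedding_drawing: "biembedding G glued drawing"
  unfolding biembedding_def embedding_def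
proof (intro conjI exI ballI)
  show "continuous_map (top_of_set (realization G)) glued drawing" by (rule drawing_continuous)
  show "inj_on drawing (realization G)" by (rule drawing_inj)
  fix e assume e: "e \<in> edges G"
  have "drawing ` open_edge G e \<subseteq> skeleton"
    unfolding drawing_realization[symmetric] by (auto simp: open_edge_def)
  then have "drawing ` open_edge G e \<subseteq> glued closure_of face Black"
    "drawing ` open_edge G e \<subseteq> glued closure_of face White"
    using skeleton_subset_closure by blast+
  then show "faces_at G glued drawing e = {face Black, face White}"
    unfolding faces_at_def faces_eq by auto
  show "(face Black = face Black) \<noteq> (face White = face Black)"
    using face_Black_neq_White by auto
qed

lemma cellular_drawing: "cellular G glued drawing"
  unfolding cellular_def faces_eq
  using homeomorphic_map_imp_homeomorphic_space[OF homeomorphic_map_face] homeomorphic_space_sym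
  by blast

section \<open>Boundary walks of the two faces\<close>

lemma arc_bij:
  assumes "\<And>\<tau>. 0 < \<tau> \<Longrightarrow> \<tau> < 1 \<Longrightarrow> f (g \<tau>) = (l, cis (2 * pi * \<tau>))" and A: "A = g ` {0<..<1}"
  shows "bij_betw f A ({l} \<times> {z. norm z = 1 \<and> z \<noteq> 1})"
proof (rule bij_betw_imageI)
  show "inj_on f A"
  proof (unfold A, rule inj_onI, clarify)
    fix \<tau> \<tau>' :: real assume *: "\<tau> \<in> {0<..<1}" "\<tau>' \<in> {0<..<1}" "f (g \<tau>) = f (g \<tau>')"
    then have "cis (2 * pi * \<tau>) = cis (2 * pi * \<tau>')" using assms(1) by auto
    then have "\<tau> = \<tau>'" using inj_onD[OF inj_on_cis_unit] * by blast
    then show "g \<tau> = g \<tau>'" by simp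
  qed
  have "f ` A = (\<lambda>\<tau>. (l, cis (2 * pi * \<tau>))) ` {0<..<1}"
    unfolding A using assms(1) by (auto simp: image_image image_iff)
  then show "f ` A = {l} \<times> {z. norm z = 1 \<and> z \<noteq> 1}"
    unfolding unit_circle_minus_1[symmetric] by auto
qed

definition edge_named :: "nat \<Rightarrow> 'e" where
  "edge_named = inv_into (edges G) lab"

lemma edge_named: "l \<in> range P \<Longrightarrow> edge_named l \<in> edges G" "l \<in> range P \<Longrightarrow> lab (edge_named l) = l"
  unfolding edge_named_def lab_edges[symmetric] by (auto intro: inv_into_into f_inv_into_f)

lemma affine_image_unit:
  fixes b c :: real
  assumes "c > 0"
  shows "(\<lambda>\<tau>. b + c * \<tau>) ` {0<..<1} = {b<..<b + c}" "(\<lambda>\<tau>. b + c * (1 - \<tau>)) ` {0<..<1} = {b<..<b + c}"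
proof -
  show 1: "(\<lambda>\<tau>. b + c * \<tau>) ` {0<..<1} = {b<..<b + c}"
  proof (intro equalityI subsetI)
    fix y assume "y \<in> {b<..<b + c}"
    then show "y \<in> (\<lambda>\<tau>. b + c * \<tau>) ` {0<..<1}"
      using assms by (intro image_eqI[of _ _ "(y - b) / c"]) (auto simp: field_simps)
  qed (use assms in auto)
  have "(\<lambda>\<tau>. 1 - \<tau>) ` {0<..<1} = {0<..<1 :: real}"
    by (intro equalityI subsetI, auto, rule_tac x = "1 - x" in image_eqI, auto)
  then have "(\<lambda>\<tau>. b + c * (1 - \<tau>)) ` {0<..<1} = (\<lambda>\<tau>. b + c * \<tau>) ` {0<..<1}"
    by (metis (no_types, lifting) image_image image_cong)
  then show "(\<lambda>\<tau>. b + c * (1 - \<tau>)) ` {0<..<1} = {b<..<b + c}" using 1 by simp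
qed

lemma arc_params:
  fixes i :: nat
  shows "cis ` {2 * pi * real i / real N<..<2 * pi * real (Suc i) / real N} =
      (\<lambda>\<tau>. cis (2 * pi * (of_int (int i) + \<tau>) / of_nat N)) ` {0<..<1}"
    "cis ` {2 * pi * real i / real N<..<2 * pi * real (Suc i) / real N} =
      (\<lambda>\<tau>. cis (2 * pi * (of_int (int i) + 1 - \<tau>) / of_nat N)) ` {0<..<1}"
proof -
  have c: "2 * pi / real N > 0" using N_pos by simp
  have S: "2 * pi * real (Suc i) / real N = 2 * pi * real i / real N + 2 * pi / real N"
    by (simp add: distrib_left add_divide_distrib)
  show "cis ` {2 * pi * real i / real N<..<2 * pi * real (Suc i) / real N} =
      (\<lambda>\<tau>. cis (2 * pi * (of_int (int i) + \<tau>) / of_nat N)) ` {0<..<1}"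
    unfolding S affine_image_unit(1)[OF c, symmetric] image_image
    by (intro image_cong refl arg_cong[of _ _ cis]) (simp add: distrib_left add_divide_distrib)
  show "cis ` {2 * pi * real i / real N<..<2 * pi * real (Suc i) / real N} =
      (\<lambda>\<tau>. cis (2 * pi * (of_int (int i) + 1 - \<tau>) / of_nat N)) ` {0<..<1}"
    unfolding S affine_image_unit(2)[OF c, symmetric] image_image
    by (intro image_cong refl arg_cong[of _ _ cis]) (simp add: algebra_simps add_divide_distrib diff_divide_distrib)
qed

lemma boundary_walk_face:
  assumes i: "i = Black \<or> i = White" and f: "\<And>m. f m \<in> range P"
    and corner: "\<And>m :: nat. chart i (cis (2 * pi * of_int (int m) / of_nat N)) \<in> centre ` Vertex ` Vs"
    and arc: "\<And>m :: nat. bij_betw (chart i) (cis ` {2 * pi * real m / real N<..<2 * pi * real (Suc m) / real N})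
      ({f m} \<times> {z. norm z = 1 \<and> z \<noteq> 1})"
  shows "boundary_walk G glued drawing (face i) (map (\<lambda>m. edge_named (f m)) [0..<N])"
  unfolding boundary_walk_def
proof (intro conjI exI[of _ "chart i"] allI impI)
  show "map (\<lambda>m. edge_named (f m)) [0..<N] \<noteq> []" using N_pos by simp
  show "set (map (\<lambda>m. edge_named (f m)) [0..<N]) \<subseteq> edges G" using edge_named f by auto
  show "continuous_map (top_of_set (cball 0 1)) glued (chart i)" by (rule continuous_map_closed_disc[OF i])
  show "homeomorphic_map (top_of_set (ball 0 1)) (subtopology glued (face i)) (chart i)"
    by (rule homeomorphic_map_face[OF i])
  fix m assume "m < length (map (\<lambda>m. edge_named (f m)) [0..<N])"
  then have m: "m < N" by simp
  show "chart i (cis (2 * pi * real m / real (length (map (\<lambda>m. edge_named (f m)) [0..<N])))) \<in> drawing ` vertex_points G"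
    using corner[of m] by (simp add: drawing_vertex_points)
  show "bij_betw (chart i)
    (cis ` {2 * pi * real m / real (length (map (\<lambda>m. edge_named (f m)) [0..<N]))<..<
      2 * pi * real (Suc m) / real (length (map (\<lambda>m. edge_named (f m)) [0..<N]))})
    (drawing ` open_edge G (map (\<lambda>m. edge_named (f m)) [0..<N] ! m))"
    using arc[of m] m edge_named[OF f] by (simp add: drawing_open_edge)
qed

lemma has_face_length_face:
  assumes "F \<in> faces G glued drawing"
  shows "has_face_length G glued drawing F N"
proof -
  have "boundary_walk G glued drawing (face Black) (map (\<lambda>m. edge_named (P (int m))) [0..<N])"
  proof (rule boundary_walk_face)
    fix m :: nat
    show "chart Black (cis (2 * pi * of_int (int m) / of_nat N)) \<in> centre ` Vertex ` Vs"
      unfolding black_corner using src_P by blast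
    show "bij_betw (chart Black) (cis ` {2 * pi * real m / real N<..<2 * pi * real (Suc m) / real N})
      ({P (int m)} \<times> {z. norm z = 1 \<and> z \<noteq> 1})"
      by (rule arc_bij[OF black_arc arc_params(1)])
  qed auto
  \<comment> \<open>The white disc meets the edges in the reverse order of \<open>Q\<close>, with
    the index computed in \<open>white_arc\<close>.\<close>
  moreover have "boundary_walk G glued drawing (face White) (map (\<lambda>m. edge_named (Q (- int m - 1))) [0..<N])"
  proof (rule boundary_walk_face)
    fix m :: nat
    show "Q (- int m - 1) \<in> range P" using range_Q by blast
    show "chart White (cis (2 * pi * of_int (int m) / of_nat N)) \<in> centre ` Vertex ` Vs"
      unfolding white_corner using src_Q by blast
    show "bij_betw (chart White) (cis ` {2 * pi * real m / real N<..<2 * pi * real (Suc m) / real N})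
      ({Q (- int m - 1)} \<times> {z. norm z = 1 \<and> z \<noteq> 1})"
      by (rule arc_bij[OF white_arc arc_params(2)])
  qed auto
  ultimately show ?thesis
    using assms unfolding faces_eq has_face_length_def by auto
qed

end

section \<open>Permutations with a single cycle\<close>

text \<open>A cycle written as a sequence over the integers whose exact period is its length, the
  form in which \<open>two_face_map\<close> takes its permutations.\<close>

definition enumerates :: "(int \<Rightarrow> 'a) \<Rightarrow> ('a \<Rightarrow> 'a) \<Rightarrow> 'a set \<Rightarrow> bool" where
  "enumerates Q f S \<longleftrightarrow> range Q = S \<and> (\<forall>i. Q (i + 1) = f (Q i)) \<and>
    (\<forall>i j. Q i = Q j \<longleftrightarrow> int (card S) dvd i - j)"

lemma cyclic_on_enumerates:
  assumes cyc: "cyclic_on f S"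
  obtains Q where "enumerates Q f S"
proof -
  obtain s where s: "s \<in> S" "S = orbit f s" using cyc by (auto simp: cyclic_on_def)
  define n where "n = funpow_dist1 f s s"
  have so: "s \<in> orbit f s" using s by simp
  have S: "S = (\<lambda>m. (f ^^ m) s) ` {0..<n}"
    unfolding s(2) n_def by (rule orbit_conv_funpow_dist1[OF so])
  have inj: "inj_on (\<lambda>m. (f ^^ m) s) {0..<n}"
    unfolding n_def by (rule inj_on_funpow_dist1[OF so])
  have card: "card S = n" unfolding S using card_image[OF inj] by simp
  have n: "(f ^^ n) s = s" unfolding n_def by (rule funpow_dist1_prop[OF so])
  have npos: "n > 0" by (simp add: n_def)
  define Q where "Q = (\<lambda>i :: int. (f ^^ nat (i mod int n)) s)"
  have mod: "nat (i mod int n) < n" for i using npos by (simp add: nat_less_iff)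
  have "range Q = S"
  proof
    show "range Q \<subseteq> S" unfolding S Q_def using mod by auto
    show "S \<subseteq> range Q"
    proof
      fix x assume "x \<in> S"
      then obtain m where "m < n" "x = (f ^^ m) s" unfolding S by auto
      then have "x = Q (int m)" by (simp add: Q_def)
      then show "x \<in> range Q" by blast
    qed
  qed
  moreover have "Q (i + 1) = f (Q i)" for i
  proof -
    define m where "m = nat (i mod int n)"
    have m: "int m = i mod int n" "m < n" using npos mod by (simp_all add: m_def)
    have "(i + 1) mod int n = (int m + 1) mod int n" unfolding m(1) by (simp add: mod_add_left_eq)
    also have "\<dots> = int (Suc m mod n)" by (simp add: zmod_int add.commute)
    finally have "Q (i + 1) = (f ^^ (Suc m mod n)) s" by (simp add: Q_def)
    also have "\<dots> = (f ^^ Suc m) s"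
    proof (cases "Suc m = n")
      case True
      then show ?thesis using n by simp
    next
      case False
      then show ?thesis using m(2) by simp
    qed
    also have "\<dots> = f (Q i)" by (simp add: Q_def m_def)
    finally show ?thesis .
  qed
  moreover have "Q i = Q j \<longleftrightarrow> int (card S) dvd i - j" for i j
  proof -
    have "Q i = Q j \<longleftrightarrow> nat (i mod int n) = nat (j mod int n)"
      unfolding Q_def using inj_on_eq_iff[OF inj] mod by simp
    also have "\<dots> \<longleftrightarrow> i mod int n = j mod int n" using npos by (simp add: eq_nat_nat_iff)
    finally show ?thesis by (simp add: card mod_eq_dvd_iff)
  qed
  ultimately have "enumerates Q f S" by (simp add: enumerates_def)
  then show thesis by (rule that)
qed

lemma enumerates_funpow:
  assumes "enumerates Q f S" shows "Q (i + int n) = (f ^^ n) (Q i)"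
proof (induction n)
  case (Suc n)
  have "Q (i + int (Suc n)) = Q ((i + int n) + 1)" by (simp add: algebra_simps)
  then show ?case using assms Suc by (simp add: enumerates_def)
qed simp

text \<open>A transposition of elements of two different cycles joins the cycles: the predecessor of
  \<open>a\<close> under \<open>f\<close> is now sent to \<open>b\<close>. The inclusion is enough
  to see that the orbit of \<open>e\<close> grows.\<close>

lemma orbit_transpose_merge:
  assumes f: "f permutes E" "finite E" and a: "a \<in> E" "b \<in> E" "b \<notin> orbit f a"
    and e: "e \<in> orbit f a"
  shows "insert b (orbit f a) \<subseteq> orbit (Transposition.transpose a b \<circ> f) e"
proof -
  define g where "g = Transposition.transpose a b \<circ> f"
  have g: "g permutes E"
    unfolding g_def by (rule permutes_compose[OF f(1) permutes_swap_id[OF a(1,2)]])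
  have "permutation f" "permutation g" using f g by (auto intro: permutation_permutes[THEN iffD2])
  then have af: "a \<in> orbit f a" and ag: "a \<in> orbit g a" by (auto intro: permutation_self_in_orbit)
  have same: "g x = f x" if "f x \<noteq> a" "f x \<noteq> b" for x
    using that by (simp add: g_def Transposition.transpose_def)
  have b: "b \<in> orbit g a"
  proof (rule ccontr)
    assume b: "b \<notin> orbit g a"
    have *: "x \<in> orbit g a" if "x \<in> orbit f a" for x
      using that
    proof induction
      case base
      have "f a \<noteq> b" using a(3) orbit.base[of f a] by metis
      then show ?case using ag same[of a] orbit.base[of g a] by (cases "f a = a") auto
    next
      case (step y)
      have "f y \<noteq> b" using a(3) orbit.step[OF step(1)] by metis
      then show ?case using ag same[of y] orbit.step[OF step(2)] by (cases "f y = a") auto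
    qed
    from af obtain x where x: "x \<in> orbit f a" "f x = a"
    proof cases
      case base
      then show thesis using that[of a] af by simp
    next
      case (step y)
      then show thesis using that by simp
    qed
    have "g x = b" using x by (simp add: g_def)
    then show False using b orbit.step[OF *[OF x(1)]] by simp
  qed
  have closed: "f x \<in> orbit g a" if "x \<in> orbit g a" for x
    using same[of x] orbit.step[OF that] ag b by (cases "f x = a \<or> f x = b") auto
  have sub: "x \<in> orbit g a" if "x \<in> orbit f a" for x
    using that by induction (use closed ag in auto)
  have "orbit g e = orbit g a"
    by (rule orbit_cyclic_eq3[OF cyclic_on_orbit[OF g f(2)] sub[OF e]])
  then show ?thesis using b sub unfolding g_def by auto
qed

text \<open>At each vertex the incoming edges are matched with the equally many outgoing ones;
  \<open>f e\<close> is the edge to follow after \<open>e\<close>.\<close>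

lemma exists_transition:
  assumes fin: "finite E" and bal: "\<And>x. card {e \<in> E. head e = x} = card {e \<in> E. tail e = x}"
  obtains f where "f permutes E" "\<And>e. e \<in> E \<Longrightarrow> tail (f e) = head e"
proof -
  have "\<exists>h. bij_betw h {e \<in> E. head e = x} {e \<in> E. tail e = x}" for x
    using fin bal by (intro finite_same_card_bij) auto
  then obtain h where h: "\<And>x. bij_betw (h x) {e \<in> E. head e = x} {e \<in> E. tail e = x}" by metis
  define f where "f e = (if e \<in> E then h (head e) e else e)" for e
  have f: "f e \<in> E" "tail (f e) = head e" if "e \<in> E" for e
    using bij_betwE[OF h[of "head e"]] that by (auto simp: f_def)
  have "inj_on f E"
  proof (rule inj_onI)
    fix e e' assume e: "e \<in> E" "e' \<in> E" "f e = f e'"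
    then have hd: "head e = head e'" using f(2) by metis
    then have "h (head e) e = h (head e) e'" using e by (simp add: f_def)
    then show "e = e'" using inj_onD[OF bij_betw_imp_inj_on[OF h[of "head e"]]] e hd by auto
  qed
  then have "bij_betw f E E" using fin f(1) by (simp add: bij_betw_def endo_inj_surj image_subsetI)
  then have "f permutes E" by (rule bij_imp_permutes) (simp add: f_def)
  then show thesis using that f(2) by blast
qed

text \<open>A transition whose cycle through a fixed edge is as long as possible has only this
  cycle: otherwise two edges, one on and one off the cycle, leave the same vertex, and exchanging
  them as successors lengthens the cycle. In \<open>conn\<close>, \<open>T\<close> is a set of
  vertices that no edge enters or leaves.\<close>

lemma exists_cyclic_transition:
  assumes fin: "finite E" and ne: "E \<noteq> {}"
    and bal: "\<And>x. card {e \<in> E. head e = x} = card {e \<in> E. tail e = x}"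
    and conn: "\<And>T e e'. (\<And>a. a \<in> E \<Longrightarrow> tail a \<in> T \<longleftrightarrow> head a \<in> T) \<Longrightarrow> e \<in> E \<Longrightarrow> tail e \<in> T \<Longrightarrow>
      e' \<in> E \<Longrightarrow> tail e' \<in> T"
  obtains f where "f permutes E" "cyclic_on f E" "\<And>e. e \<in> E \<Longrightarrow> tail (f e) = head e"
proof -
  obtain e0 where e0: "e0 \<in> E" using ne by blast
  define good where "good f \<longleftrightarrow> f permutes E \<and> (\<forall>e\<in>E. tail (f e) = head e)" for f
  have "\<exists>f. good f" using exists_transition[OF fin bal] unfolding good_def by metis
  moreover have sub: "orbit f e0 \<subseteq> E" if "good f" for f
    using permutes_orbit_subset[of f E e0] e0 that unfolding good_def by blast
  then have "\<forall>f. good f \<longrightarrow> card (orbit f e0) < Suc (card E)"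
    using card_mono[OF fin] by (simp add: less_Suc_eq_le)
  ultimately obtain f where f: "good f" and max: "\<And>g. good g \<Longrightarrow> card (orbit g e0) \<le> card (orbit f e0)"
    using ex_has_greatest_nat[of good _ "\<lambda>f. card (orbit f e0)" "Suc (card E)"] by blast
  have perm: "f permutes E" and tl: "\<And>e. e \<in> E \<Longrightarrow> tail (f e) = head e" using f by (auto simp: good_def)
  have "permutation f" using perm fin by (auto intro: permutation_permutes[THEN iffD2])
  then have self: "e0 \<in> orbit f e0" by (rule permutation_self_in_orbit)
  have cyc: "cyclic_on f (orbit f e0)" by (rule cyclic_on_orbit[OF perm fin])
  have "orbit f e0 = E"
  proof (rule ccontr)
    assume neq: "orbit f e0 \<noteq> E"
    \<comment> \<open>If no vertex had outgoing edges both on and off the cycle, no edge would join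
      \<open>T\<close> to its complement, and \<open>conn\<close> would put every edge on the
      cycle.\<close>
    define T where "T = tail ` orbit f e0"
    have "\<exists>a b. a \<in> orbit f e0 \<and> b \<in> E - orbit f e0 \<and> tail a = tail b"
    proof (rule ccontr)
      assume no: "\<not> ?thesis"
      have inT: "e \<in> orbit f e0 \<longleftrightarrow> tail e \<in> T" if "e \<in> E" for e
        using no that unfolding T_def by (metis DiffI imageE imageI)
      have "tail a \<in> T \<longleftrightarrow> head a \<in> T" if a: "a \<in> E" for a
      proof -
        have fa: "f a \<in> E" using a perm by (simp add: permutes_in_image)
        have "a \<in> orbit f e0 \<longleftrightarrow> f a \<in> orbit f e0"
          using cyclic_on_inI[OF cyc] cyclic_on_f_in[OF perm cyc] by blast
        then show ?thesis using inT[OF a] inT[OF fa] tl[OF a] by simp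
      qed
      then have "tail e \<in> T" if "e \<in> E" for e
        using conn[of T e0 e] e0 self that by (auto simp: T_def)
      then show False using inT sub[OF f] neq by auto
    qed
    then obtain a b where ab: "a \<in> orbit f e0" "b \<in> E" "b \<notin> orbit f e0" "tail a = tail b" by blast
    have orb: "orbit f a = orbit f e0" by (rule orbit_cyclic_eq3[OF cyc ab(1)])
    have aE: "a \<in> E" using ab sub[OF f] by blast
    let ?g = "Transposition.transpose a b \<circ> f"
    have "insert b (orbit f e0) \<subseteq> orbit ?g e0"
      using orbit_transpose_merge[OF perm fin aE ab(2), of e0] ab self by (simp add: orb)
    moreover have g: "good ?g"
      unfolding good_def
    proof (intro conjI ballI)
      show "?g permutes E" by (rule permutes_compose[OF perm permutes_swap_id[OF aE ab(2)]])
      show "tail (?g e) = head e" if "e \<in> E" for e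
      proof -
        have "tail (Transposition.transpose a b y) = tail y" for y
        proof -
          consider "y = a" | "y = b" | "y \<noteq> a" "y \<noteq> b" by blast
          then show ?thesis
          proof cases
            case 1
            then show ?thesis by (simp only: transpose_apply_first ab(4))
          next
            case 2
            then show ?thesis by (simp only: transpose_apply_second ab(4))
          next
            case 3
            then show ?thesis by simp
          qed
        qed
        then show ?thesis using tl[OF that] by (simp only: comp_apply)
      qed
    qed
    ultimately have "card (insert b (orbit f e0)) \<le> card (orbit ?g e0)"
      using finite_subset[OF sub[OF g] fin] card_mono by blast
    moreover have "card (insert b (orbit f e0)) = Suc (card (orbit f e0))"
      using ab finite_subset[OF sub[OF f] fin] by simp
    ultimately show False using max[OF g] by simp
  qed
  then show thesis using that perm tl cyc by simp
qed

text \<open>The permutation \<open>s\<close> is the first return map of \<open>f\<close> to \<open>S\<close>: the first return map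
  of \<open>s \<circ> f\<close> is then its square, which is still a single cycle because \<open>card S\<close> is odd.\<close>
lemma cyclic_on_twist:
  assumes f: "f permutes E" "cyclic_on f E" and S: "S \<subseteq> E" "odd (card S)"
  obtains s where "s permutes S" "cyclic_on s S" "cyclic_on (s \<circ> f) E"
proof -
  have finE: "finite E" by (rule finite_cyclic_on[OF f(2)])
  have finS: "finite S" by (rule finite_subset[OF S(1) finE])
  obtain Q where Q: "enumerates Q f E" using cyclic_on_enumerates[OF f(2)] .
  define N where "N = int (card E)"
  have Q_step: "Q (i + 1) = f (Q i)" and Q_eq: "Q i = Q j \<longleftrightarrow> N dvd i - j" and Q_range: "range Q = E" for i j
    using Q by (auto simp: enumerates_def N_def)
  have "E \<noteq> {}" using f(2) by (auto simp: cyclic_on_def)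
  then have Npos: "N > 0" using finE by (simp add: N_def card_gt_0_iff)
  have above: "\<exists>j>i. Q j = e" if e: "e \<in> E" for e i
  proof -
    obtain k where k: "Q k = e" using e Q_range by (metis imageE)
    \<comment> \<open>A multiple of the period \<open>N\<close> is added, large enough to exceed
      \<open>i\<close> whatever the signs of \<open>i\<close> and \<open>k\<close>.\<close>
    define j where "j = k + N * (\<bar>i\<bar> + \<bar>k\<bar> + 1)"
    have "\<bar>i\<bar> + \<bar>k\<bar> + 1 \<le> N * (\<bar>i\<bar> + \<bar>k\<bar> + 1)" using Npos mult_right_mono[of 1 N "\<bar>i\<bar> + \<bar>k\<bar> + 1"] by simp
    then have "j > i" unfolding j_def using abs_ge_self[of i] abs_ge_minus_self[of k] by linarith
    moreover have "Q j = e" unfolding k[symmetric] Q_eq by (simp add: j_def)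
    ultimately show ?thesis by blast
  qed
  have "S \<noteq> {}" using S(2) by auto
  then obtain o0 where o0: "o0 \<in> S" by blast
  have ex: "\<exists>n. Q (i + 1 + int n) \<in> S" for i
  proof -
    obtain j where "j > i" "Q j = o0" using above o0 S by blast
    then have "Q (i + 1 + int (nat (j - i - 1))) \<in> S" using o0 by simp
    then show ?thesis by blast
  qed
  \<comment> \<open>The index of the next visit to \<open>S\<close> strictly after \<open>i\<close>;
    hence the search starts at \<open>i + 1\<close>.\<close>
  define r where "r i = i + 1 + int (LEAST n. Q (i + 1 + int n) \<in> S)" for i
  have r_gt: "r i > i" and r_in: "Q (r i) \<in> S" for i
    using LeastI_ex[OF ex[of i]] by (simp_all add: r_def)
  have r_least: "Q j \<notin> S" if "i < j" "j < r i" for i j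
  proof -
    have "nat (j - i - 1) < (LEAST n. Q (i + 1 + int n) \<in> S)" using that by (simp add: r_def)
    then have "Q (i + 1 + int (nat (j - i - 1))) \<notin> S" by (rule not_less_Least)
    then show ?thesis using that by simp
  qed
  have r_per: "Q (r i) = Q (r i')" if "Q i = Q i'" for i i'
  proof -
    have "Q (i + 1 + int n) = Q (i' + 1 + int n)" for n using that unfolding Q_eq by simp
    then have "r i - r i' = i - i'" by (simp add: r_def)
    then show ?thesis using that by (simp only: Q_eq)
  qed
  \<comment> \<open>The index of \<open>e\<close> is determined only modulo \<open>N\<close>; by
    \<open>r_per\<close> its choice does not affect the value.\<close>
  define s where "s e = (if e \<in> S then Q (r (SOME i. Q i = e)) else e)" for e
  have s_Q: "s (Q i) = Q (r i)" if "Q i \<in> S" for i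
  proof -
    have "Q (SOME k. Q k = Q i) = Q i" by (rule someI) (rule refl)
    from r_per[OF this] show ?thesis using that by (simp add: s_def)
  qed
  obtain i0 where i0: "Q i0 = o0" using o0 S Q_range by blast
  \<comment> \<open>The \<open>z\<close> found is the last visit to \<open>S\<close> at or before
    \<open>j\<close>.\<close>
  have pred: "\<exists>z. i \<le> z \<and> z \<le> j \<and> Q z \<in> S \<and> j < r z" if "i \<le> j" "Q i \<in> S" for i j
  proof -
    define A where "A = {z \<in> {i..j}. Q z \<in> S}"
    have "A \<subseteq> {i..j}" by (auto simp: A_def)
    then have A: "finite A" "A \<noteq> {}"
      using that finite_subset[of A "{i..j}"] by (simp, auto simp: A_def)
    have Max: "Max A \<in> A" by (rule Max_in[OF A])
    have "j < r (Max A)"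
    proof (rule ccontr)
      assume "\<not> j < r (Max A)"
      then have "r (Max A) \<in> A" using r_in r_gt[of "Max A"] Max by (auto simp: A_def)
      then show False using Max_ge[OF A(1)] r_gt[of "Max A"] by fastforce
    qed
    then show ?thesis using Max by (auto simp: A_def)
  qed
  \<comment> \<open>Positivity of the exponent is recorded because \<open>orbit\<close> consists of
    the positive iterates.\<close>
  have cover: "\<exists>n. Q j = (s ^^ n) o0 \<and> (j > i0 \<longrightarrow> n > 0)" if "i0 \<le> j" "Q j \<in> S" for j
    using that
  proof (induction "nat (j - i0)" arbitrary: j rule: less_induct)
    case less
    show ?case
    proof (cases "j = i0")
      case True
      then show ?thesis using i0 by (intro exI[of _ 0]) simp
    next
      case False
      then have "i0 \<le> j - 1" using less.prems by simp
      then obtain z where z: "i0 \<le> z" "z \<le> j - 1" "Q z \<in> S" "j - 1 < r z"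
        using pred[of i0 "j - 1"] i0 o0 by auto
      have "r z = j"
        using r_least[of z j] less.prems z by (cases "j < r z") auto
      moreover obtain n where "Q z = (s ^^ n) o0"
        using less.hyps[of z] z less.prems by auto
      ultimately have "Q j = (s ^^ Suc n) o0" using s_Q[OF z(3)] by simp
      then show ?thesis by blast
    qed
  qed
  have s_in: "s e \<in> S" if "e \<in> S" for e using that r_in by (simp add: s_def)
  have s_orbit: "S = orbit s o0"
  proof
    show "S \<subseteq> orbit s o0"
    proof
      fix e assume e: "e \<in> S"
      obtain j where "j > i0" "Q j = e" using above[of e i0] e S by blast
      then obtain n where "n > 0" "e = (s ^^ n) o0" using cover[of j] e by auto
      then show "e \<in> orbit s o0" unfolding orbit_altdef by blast
    qed
    show "orbit s o0 \<subseteq> S"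
    proof
      fix e assume "e \<in> orbit s o0"
      then show "e \<in> S" by induction (use s_in o0 in auto)
    qed
  qed
  then have s_cyc: "cyclic_on s S" using o0 by (auto simp: cyclic_on_def)
  have "S \<subseteq> s ` S"
  proof
    fix e assume "e \<in> S"
    then have "e \<in> orbit s o0" using s_orbit by simp
    then show "e \<in> s ` S" by cases (use o0 s_orbit in auto)
  qed
  then have "s ` S = S" using s_in by auto
  then have "bij_betw s S S" using finS by (simp add: bij_betw_def finite_surj_inj)
  then have s_perm: "s permutes S" by (rule bij_imp_permutes) (simp add: s_def)
  obtain R where R: "enumerates R s S" using cyclic_on_enumerates[OF s_cyc] .
  obtain c0 where c0: "R c0 = o0" using R o0 by (auto simp: enumerates_def image_iff)
  have period: "(s ^^ (n + card S)) o0 = (s ^^ n) o0" for n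
  proof -
    have "R (c0 + int (n + card S)) = R (c0 + int n)" using R by (simp add: enumerates_def)
    then show ?thesis unfolding enumerates_funpow[OF R] c0 .
  qed
  let ?g = "s \<circ> f"
  have g_perm: "?g permutes E"
    by (rule permutes_compose[OF f(1) permutes_subset[OF s_perm S(1)]])
  have g_Q: "?g (Q i) = s (Q (i + 1))" for i by (simp add: Q_step)
  define T where "T = orbit ?g o0"
  have "permutation ?g" using g_perm finE by (auto intro: permutation_permutes[THEN iffD2])
  then have o0T: "o0 \<in> T" unfolding T_def by (rule permutation_self_in_orbit)
  have gT: "?g e \<in> T" if "e \<in> T" for e using that unfolding T_def by (rule orbit.step)
  \<comment> \<open>Between two visits to \<open>S\<close> the map \<open>s\<close> is the identity,
    so \<open>?g\<close> moves along \<open>Q\<close> just as \<open>f\<close> does.\<close>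
  have segment: "Q (z + int n) \<in> T" if "Q z \<in> T" "z + int n < r z" for z n
    using that(2)
  proof (induction n)
    case 0
    then show ?case using that by simp
  next
    case (Suc n)
    have "Q (z + int n + 1) \<notin> S" by (rule r_least[of z]) (use Suc in auto)
    then have "s (Q (z + int n + 1)) = Q (z + int n + 1)" by (simp add: s_def)
    moreover have "Q (z + int n) \<in> T" using Suc by simp
    moreover have "z + int (Suc n) = z + int n + 1" by simp
    ultimately show ?case using gT[of "Q (z + int n)"] unfolding g_Q by (simp only:)
  qed
  have segment': "Q j \<in> T" if "Q z \<in> T" "z \<le> j" "j < r z" for z j
    using segment[OF that(1), of "nat (j - z)"] that by simp
  \<comment> \<open>The step that would reach the next element \<open>s e\<close> of
    \<open>S\<close> applies \<open>s\<close> once more, so \<open>?g\<close> enters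
    \<open>S\<close> at \<open>s (s e)\<close> instead.\<close>
  have double: "s (s e) \<in> T" if e: "e \<in> T" "e \<in> S" for e
  proof -
    obtain z where z: "Q z = e" using e S Q_range by blast
    have "Q (r z - 1) \<in> T" using segment'[of z "r z - 1"] z e r_gt[of z] by simp
    then have "?g (Q (r z - 1)) \<in> T" by (rule gT)
    then have "s (Q (r z)) \<in> T" unfolding g_Q by simp
    then show ?thesis using s_Q[of z] z e by simp
  qed
  have s_pow_in: "(s ^^ n) o0 \<in> S" for n by (induction n) (use s_in o0 in auto)
  have even: "(s ^^ (2 * n)) o0 \<in> T" for n
  proof (induction n)
    case (Suc n)
    then show ?case using double[OF Suc s_pow_in] by simp
  qed (simp add: o0T)
  \<comment> \<open>An odd exponent becomes even on adding the odd period
    \<open>card S\<close>.\<close>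
  have pow: "(s ^^ n) o0 \<in> T" for n
  proof (cases "even n")
    case True
    then show ?thesis using even by (metis dvd_def)
  next
    case False
    then have "even (n + card S)" using S(2) by simp
    then show ?thesis using even period by (metis dvd_def)
  qed
  have "E \<subseteq> T"
  proof
    fix e assume "e \<in> E"
    then obtain j where j: "j > i0" "Q j = e" using above by blast
    then obtain z where z: "i0 \<le> z" "z \<le> j" "Q z \<in> S" "j < r z" using pred[of i0 j] i0 o0 by auto
    obtain n where "Q z = (s ^^ n) o0" using cover[OF z(1,3)] by blast
    then have "Q z \<in> T" using pow by simp
    then show "e \<in> T" using segment' z j by blast
  qed
  moreover have "T \<subseteq> E" unfolding T_def using permutes_orbit_subset[OF g_perm] o0 S by blast
  ultimately have "cyclic_on ?g E" using o0 S unfolding cyclic_on_def T_def by blast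
  then show thesis using that s_perm s_cyc by blast
qed

text \<open>Induction over the vertices, with \<open>cyclic_on_twist\<close> applied to the circuit
  obtained so far. As the sets \<open>A x\<close> are disjoint, the twist at a new vertex leaves the
  cycles at the earlier ones unchanged.\<close>

lemma cyclic_on_twist_family:
  assumes "finite Vs" and f: "f permutes E" "cyclic_on f E"
    and A: "\<And>x. x \<in> Vs \<Longrightarrow> A x \<subseteq> E" "\<And>x. x \<in> Vs \<Longrightarrow> odd (card (A x))"
    and disj: "\<And>x y. x \<in> Vs \<Longrightarrow> y \<in> Vs \<Longrightarrow> x \<noteq> y \<Longrightarrow> A x \<inter> A y = {}"
  shows "\<exists>s. s permutes (\<Union>x\<in>Vs. A x) \<and> (\<forall>x\<in>Vs. cyclic_on s (A x)) \<and> cyclic_on (s \<circ> f) E"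
  using assms(1) A disj
proof (induction Vs)
  case empty
  then show ?case using f by (intro exI[of _ id]) (simp add: id_def)
next
  case (insert y Vs)
  then obtain s where s: "s permutes (\<Union>x\<in>Vs. A x)" "\<forall>x\<in>Vs. cyclic_on s (A x)" "cyclic_on (s \<circ> f) E"
  proof -
    have "\<exists>s. s permutes (\<Union>x\<in>Vs. A x) \<and> (\<forall>x\<in>Vs. cyclic_on s (A x)) \<and> cyclic_on (s \<circ> f) E"
      by (rule insert.IH) (use insert.prems in auto)
    then show thesis using that by blast
  qed
  have sub: "(\<Union>x\<in>Vs. A x) \<subseteq> E" using insert.prems by blast
  have "(s \<circ> f) permutes E" by (rule permutes_compose[OF f(1) permutes_subset[OF s(1) sub]])
  then obtain u where u: "u permutes A y" "cyclic_on u (A y)" "cyclic_on (u \<circ> (s \<circ> f)) E"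
    using cyclic_on_twist[OF _ s(3), of "A y"] insert.prems by blast
  have "(u \<circ> s) permutes (\<Union>x\<in>insert y Vs. A x)"
    by (rule permutes_compose[OF permutes_subset[OF s(1)] permutes_subset[OF u(1)]]) auto
  moreover have "cyclic_on (u \<circ> s) (A x)" if x: "x \<in> insert y Vs" for x
  proof (cases "x = y")
    case True
    have "s e = e" if e: "e \<in> A y" for e
    proof -
      have "e \<notin> (\<Union>x\<in>Vs. A x)" using insert.prems(3)[of y] insert.hyps e by blast
      then show ?thesis using s(1) by (simp add: permutes_not_in)
    qed
    then have "cyclic_on (u \<circ> s) (A y) = cyclic_on u (A y)" by (intro cyclic_cong) simp
    then show ?thesis using u True by simp
  next
    case False
    then have xV: "x \<in> Vs" using x by simp
    have "u (s e) = s e" if "e \<in> A x" for e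
    proof -
      have "s e \<in> A x" using s(2) xV that cyclic_on_inI by metis
      then have "s e \<notin> A y" using insert.prems(3)[of x y] x False by blast
      then show ?thesis using u(1) by (simp add: permutes_not_in)
    qed
    then have "cyclic_on (u \<circ> s) (A x) = cyclic_on s (A x)" by (intro cyclic_cong) simp
    then show ?thesis using s(2) xV by simp
  qed
  moreover have "cyclic_on (u \<circ> s \<circ> f) E" using u(3) by (simp only: comp_assoc)
  ultimately show ?case by blast
qed

text \<open>\<open>f\<close> follows the first circuit and \<open>s \<circ> f\<close> the second.
  Both continue from the head of an edge, as \<open>s\<close> only permutes the edges leaving a
  vertex, and \<open>s\<close> itself is the rotation at every vertex.\<close>

theorem two_face_biembedding:
  fixes G :: "('v, 'e) multigraph" and tail head :: "'e \<Rightarrow> 'v"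
  assumes fin: "finite (edges G)" "finite (verts G)" and ne: "verts G \<noteq> {}"
    and ends: "\<And>e. e \<in> edges G \<Longrightarrow> ends G e = {tail e, head e}"
    and tail_in: "\<And>e. e \<in> edges G \<Longrightarrow> tail e \<in> verts G"
    and head_in: "\<And>e. e \<in> edges G \<Longrightarrow> head e \<in> verts G"
    and tail_neq_head: "\<And>e. e \<in> edges G \<Longrightarrow> tail e \<noteq> head e"
    and out_degree: "\<And>x. x \<in> verts G \<Longrightarrow> card {e \<in> edges G. tail e = x} = d"
    and in_degree: "\<And>x. x \<in> verts G \<Longrightarrow> card {e \<in> edges G. head e = x} = d"
    and d: "odd d"
    and conn: "\<And>T x y. (\<And>e. e \<in> edges G \<Longrightarrow> tail e \<in> T \<longleftrightarrow> head e \<in> T) \<Longrightarrow> x \<in> verts G \<Longrightarrow> x \<in> T \<Longrightarrow>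
      y \<in> verts G \<Longrightarrow> y \<in> T"
  shows "\<exists>(X :: surface_point topology) \<psi>. closed_surface X \<and> orientable X \<and> biembedding G X \<psi> \<and>
    cellular G X \<psi> \<and> (\<forall>F\<in>faces G X \<psi>. has_face_length G X \<psi> F (card (edges G)))"
proof -
  have dpos: "d > 0" using d by (cases d) auto
  obtain x0 where x0: "x0 \<in> verts G" using ne by blast
  then have "card {e \<in> edges G. tail e = x0} > 0" using out_degree dpos by simp
  then have "{e \<in> edges G. tail e = x0} \<noteq> {}" by (metis card.empty less_irrefl)
  then have neE: "edges G \<noteq> {}" by blast
  have bal: "card {e \<in> edges G. head e = x} = card {e \<in> edges G. tail e = x}" for x
  proof (cases "x \<in> verts G")
    case True
    then show ?thesis using out_degree in_degree by simp
  next
    case False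
    then have "{e \<in> edges G. head e = x} = {}" "{e \<in> edges G. tail e = x} = {}" using tail_in head_in by auto
    then show ?thesis by (simp only:)
  qed
  obtain f where f: "f permutes edges G" "cyclic_on f (edges G)" "\<And>e. e \<in> edges G \<Longrightarrow> tail (f e) = head e"
    using exists_cyclic_transition[OF fin(1) neE bal] conn tail_in by (metis (no_types, lifting))
  define out where "out x = {e \<in> edges G. tail e = x}" for x
  have "\<exists>s. s permutes (\<Union>x\<in>verts G. out x) \<and> (\<forall>x\<in>verts G. cyclic_on s (out x)) \<and> cyclic_on (s \<circ> f) (edges G)"
    by (rule cyclic_on_twist_family[OF fin(2) f(1,2)]) (use out_degree d in \<open>auto simp: out_def\<close>)
  then obtain s where s: "\<And>x. x \<in> verts G \<Longrightarrow> cyclic_on s (out x)" "cyclic_on (s \<circ> f) (edges G)" by blast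
  obtain P where P: "enumerates P f (edges G)" using cyclic_on_enumerates[OF f(2)] .
  obtain Q where Q: "enumerates Q (s \<circ> f) (edges G)" using cyclic_on_enumerates[OF s(2)] .
  have "\<exists>R. enumerates R s (out x)" if "x \<in> verts G" for x
    using cyclic_on_enumerates[OF s(1)[OF that]] by metis
  then obtain R where R: "\<And>x. x \<in> verts G \<Longrightarrow> enumerates (R x) s (out x)" by metis
  \<comment> \<open>The first component of a \<open>surface_point\<close> is a natural number, so
    edges and vertices have to be numbered.\<close>
  obtain lab :: "'e \<Rightarrow> nat" where lab: "inj_on lab (edges G)" using finite_imp_inj_to_nat_seg[OF fin(1)] by metis
  obtain vid :: "'v \<Rightarrow> nat" where vid: "inj_on vid (verts G)" using finite_imp_inj_to_nat_seg[OF fin(2)] by metis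
  define vert where "vert = inv_into (verts G) vid"
  have vert: "vert (vid x) = x" if "x \<in> verts G" for x using that vid by (simp add: vert_def)
  define src where "src l = vid (tail (inv_into (edges G) lab l))" for l
  have src: "src (lab e) = vid (tail e)" if "e \<in> edges G" for e using that lab by (simp add: src_def)
  have P_in: "P i \<in> edges G" and Q_in: "Q i \<in> edges G" for i using P Q by (auto simp: enumerates_def)
  have R_in: "R x c \<in> edges G" "tail (R x c) = x" if "x \<in> verts G" for x c
    using R[OF that] by (auto simp: enumerates_def out_def)
  have lab_iff: "lab e = lab e' \<longleftrightarrow> e = e'" if "e \<in> edges G" "e' \<in> edges G" for e e'
    using lab that by (auto simp: inj_on_def)
  interpret two_face_graph "card (edges G)" d "\<lambda>i. lab (P i)" "\<lambda>i. lab (Q i)" "\<lambda>x c. lab (R (vert x) c)"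
    "vid ` verts G" src G lab vid tail head
  proof
    show "card (edges G) > 0" using fin neE by (simp add: card_gt_0_iff)
    show "d > 0" by (rule dpos)
    show "finite (vid ` verts G)" using fin by simp
    show "lab (P i) = lab (P j) \<longleftrightarrow> int (card (edges G)) dvd i - j" for i j
      using P by (simp add: lab_iff P_in enumerates_def)
    show "lab (Q i) = lab (Q j) \<longleftrightarrow> int (card (edges G)) dvd i - j" for i j
      using Q by (simp add: lab_iff Q_in enumerates_def)
    have rg: "range (\<lambda>i. lab (K i)) = lab ` range K" for K :: "int \<Rightarrow> 'e" by (simp add: image_image)
    have rP: "range (\<lambda>i. lab (P i)) = lab ` edges G" using P by (simp add: rg enumerates_def)
    have rQ: "range (\<lambda>i. lab (Q i)) = lab ` edges G" using Q by (simp add: rg enumerates_def)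
    show "range (\<lambda>i. lab (Q i)) = range (\<lambda>i. lab (P i))" using rP rQ by simp
    show "lab ` edges G = range (\<lambda>i. lab (P i))" using rP by simp
    fix x assume "x \<in> vid ` verts G"
    then obtain u where u: "u \<in> verts G" "x = vid u" by blast
    show "lab (R (vert x) i) = lab (R (vert x) j) \<longleftrightarrow> int d dvd i - j" for i j
    proof -
      have "card (out u) = d" using out_degree[OF u(1)] by (simp add: out_def)
      then show ?thesis using R[OF u(1)] R_in[OF u(1)] by (simp add: u vert lab_iff enumerates_def)
    qed
    show "range (\<lambda>c. lab (R (vert x) c)) = {l \<in> range (\<lambda>i. lab (P i)). src l = x}"
    proof -
      have "range (\<lambda>c. lab (R (vert x) c)) = lab ` out u"
        using R[OF u(1)] by (simp add: rg u vert enumerates_def)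
      also have "\<dots> = {l \<in> lab ` edges G. src l = x}"
        using tail_in u src inj_onD[OF vid] by (auto simp: out_def)
      finally show ?thesis using rP by simp
    qed
    show "lab (R (vert x) (c + 1)) = lab (Q (j + 1))"
      if "lab (R (vert x) c) = lab (P i)" "lab (P (i - 1)) = lab (Q j)" for c i j
    proof -
      have "R u c = P i" "P (i - 1) = Q j" using that R_in[OF u(1)] P_in Q_in by (simp_all add: u vert lab_iff)
      moreover have "P i = f (P (i - 1))" using P by (metis enumerates_def diff_add_cancel)
      \<comment> \<open>This identity is the required \<open>rotation\<close> property: advancing
        \<open>P i\<close> in the rotation amounts to advancing \<open>Q j\<close>, the edge that
        precedes \<open>P i\<close> in the first circuit, in the second circuit.\<close>
      ultimately have "s (R u c) = (s \<circ> f) (Q j)" by simp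
      then show ?thesis using R[OF u(1)] Q by (simp add: u vert enumerates_def)
    qed
  next
    show "src (lab (P i)) \<in> vid ` verts G" for i using src[OF P_in] tail_in[OF P_in] by simp
    show "inj_on lab (edges G)" "inj_on vid (verts G)" by (rule lab vid)+
    show "vid ` verts G = vid ` verts G" ..
    fix e assume e: "e \<in> edges G"
    show "ends G e = {tail e, head e}" "tail e \<in> verts G" "head e \<in> verts G" "tail e \<noteq> head e"
      "src (lab e) = vid (tail e)"
      using e ends tail_in head_in tail_neq_head src by auto
    show "vid (head e) = src (lab (P (j + 1)))" if "lab e = lab (P j)" for j
    proof -
      have "e = P j" using that e P_in by (simp add: lab_iff)
      then have "P (j + 1) = f e" using P by (simp add: enumerates_def)
      then have "tail (P (j + 1)) = head e" using f(3)[OF e] by simp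
      then show ?thesis using src[OF P_in, of "j + 1"] by simp
    qed
  qed
  show ?thesis
    using closed_surface_glued orientable_glued biembedding_drawing cellular_drawing has_face_length_face by blast
qed

section \<open>Balanced orientations of complete multipartite multigraphs\<close>

text \<open>Meant for a pairing of the edges at a vertex in which one edge of each pair leaves the
  vertex and the other enters it.\<close>

lemma card_involution_half:
  assumes "finite A" and inv: "\<And>a. a \<in> A \<Longrightarrow> g a \<in> A" "\<And>a. a \<in> A \<Longrightarrow> g (g a) = a"
    and swap: "\<And>a. a \<in> A \<Longrightarrow> B (g a) \<longleftrightarrow> \<not> B a"
  shows "2 * card {a \<in> A. B a} = card A" "2 * card {a \<in> A. \<not> B a} = card A"
proof -
  have "bij_betw g {a \<in> A. B a} {a \<in> A. \<not> B a}"
    by (rule bij_betwI[where g = g]) (use inv swap in auto)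
  then have eq: "card {a \<in> A. B a} = card {a \<in> A. \<not> B a}" by (rule bij_betw_same_card)
  have "A = {a \<in> A. B a} \<union> {a \<in> A. \<not> B a}" by auto
  then have "card A = card {a \<in> A. B a} + card {a \<in> A. \<not> B a}"
    using assms(1) by (metis (no_types, lifting) card_Un_disjoint disjoint_iff finite_Un mem_Collect_eq)
  then show "2 * card {a \<in> A. B a} = card A" "2 * card {a \<in> A. \<not> B a} = card A" using eq by simp_all
qed

text \<open>The pairing of \<open>2 * i\<close> with \<open>2 * i + 1\<close>, which respects every
  even bound.\<close>

definition flip :: "nat \<Rightarrow> nat" where
  "flip m = (if even m then m + 1 else m - 1)"

lemma flip: "flip (flip m) = m" "even (flip m) \<longleftrightarrow> odd m" "even q \<Longrightarrow> m < q \<Longrightarrow> flip m < q"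
proof -
  show "flip (flip m) = m" "even (flip m) \<longleftrightarrow> odd m" by (auto simp: flip_def elim: oddE)
  show "flip m < q" if "even q" "m < q"
    using that by (auto simp: flip_def) (metis Suc_lessI even_Suc)
qed

text \<open>\<open>D m x y\<close> means that the \<open>m\<close>-th edge between \<open>x\<close> and \<open>y\<close> is directed
  from \<open>x\<close> to \<open>y\<close>; a pair \<open>a = (y, m)\<close> stands for the \<open>m\<close>-th edge between \<open>x\<close> and \<open>y\<close>.\<close>
lemma balanced_direction:
  assumes "even lam \<or> even t \<or> odd p"
  obtains D :: "nat \<Rightarrow> nat \<times> nat \<Rightarrow> nat \<times> nat \<Rightarrow> bool"
  where "\<forall>m x y. fst x < p \<longrightarrow> fst y < p \<longrightarrow> fst x \<noteq> fst y \<longrightarrow> (D m y x \<longleftrightarrow> \<not> D m x y)"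
    "\<forall>x. fst x < p \<longrightarrow> (\<exists>g. \<forall>a \<in> (({0..<p} - {fst x}) \<times> {0..<t}) \<times> {0..<lam}.
       g a \<in> (({0..<p} - {fst x}) \<times> {0..<t}) \<times> {0..<lam} \<and> g (g a) = a \<and>
       (D (snd (g a)) x (fst (g a)) \<longleftrightarrow> \<not> D (snd a) x (fst a)))"
proof -
  consider "even lam" | "even t" | "odd p" using assms by blast
  then show thesis
  proof cases
    case 1
    show ?thesis
    \<comment> \<open>With \<open>lam\<close> even, parallel edges are paired and directed
      oppositely.\<close>
    proof (rule that[of "\<lambda>m x y. even m \<longleftrightarrow> fst x < fst y"]; intro allI impI)
      fix x :: "nat \<times> nat"
      show "\<exists>g. \<forall>a \<in> (({0..<p} - {fst x}) \<times> {0..<t}) \<times> {0..<lam}.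
       g a \<in> (({0..<p} - {fst x}) \<times> {0..<t}) \<times> {0..<lam} \<and> g (g a) = a \<and>
       ((even (snd (g a)) \<longleftrightarrow> fst x < fst (fst (g a))) \<longleftrightarrow> \<not> (even (snd a) \<longleftrightarrow> fst x < fst (fst a)))"
        by (rule exI[of _ "\<lambda>a. (fst a, flip (snd a))"]) (use 1 in \<open>auto simp: flip\<close>)
    qed auto
  next
    case 2
    show ?thesis
    \<comment> \<open>With \<open>t\<close> even, the neighbours within one part are paired; the
      direction depends on the parity of their positions.\<close>
    proof (rule that[of "\<lambda>m x y. even (snd x + snd y) \<longleftrightarrow> fst x < fst y"]; intro allI impI)
      fix x :: "nat \<times> nat"
      show "\<exists>g. \<forall>a \<in> (({0..<p} - {fst x}) \<times> {0..<t}) \<times> {0..<lam}.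
       g a \<in> (({0..<p} - {fst x}) \<times> {0..<t}) \<times> {0..<lam} \<and> g (g a) = a \<and>
       ((even (snd x + snd (fst (g a))) \<longleftrightarrow> fst x < fst (fst (g a))) \<longleftrightarrow> \<not> (even (snd x + snd (fst a)) \<longleftrightarrow> fst x < fst (fst a)))"
        by (rule exI[of _ "\<lambda>a. ((fst (fst a), flip (snd (fst a))), snd a)"]) (use 2 in \<open>auto simp: flip\<close>)
    qed (auto simp: add.commute)
  next
    case 3
    \<comment> \<open>With \<open>p\<close> odd, the parts form a rotational tournament: edges leave
      a part towards the parts less than half a turn ahead of it.\<close>
    define \<delta> where "\<delta> i j = (int j - int i) mod int p" for i j
    have \<delta>: "0 \<le> \<delta> i j \<and> \<delta> i j < int p" if "i < p" for i j using that by (simp add: \<delta>_def)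
    have opp: "\<delta> j i = int p - \<delta> i j" if "i < p" "j < p" "i \<noteq> j" for i j
    proof -
      have "(int j - int i) mod int p \<noteq> 0"
      proof
        assume "(int j - int i) mod int p = 0"
        then have "int j mod int p = int i mod int p" by (simp add: mod_eq_dvd_iff mod_eq_0_iff_dvd)
        then show False using that by simp
      qed
      then show ?thesis
        using zmod_zminus1_eq_if[of "int j - int i" "int p"] by (simp add: \<delta>_def)
    qed
    have half: "2 * (int p - a) < int p \<longleftrightarrow> \<not> 2 * a < int p" for a
    proof -
      have "2 * a \<noteq> int p" using 3 by presburger
      then show ?thesis by presburger
    qed
    show ?thesis
    proof (rule that[of "\<lambda>m x y. 2 * \<delta> (fst x) (fst y) < int p"]; intro allI impI)
      show "2 * \<delta> (fst y) (fst x) < int p \<longleftrightarrow> \<not> 2 * \<delta> (fst x) (fst y) < int p"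
        if "fst x < p" "fst y < p" "fst x \<noteq> fst y" for x y :: "nat \<times> nat"
        using opp[OF that] half by simp
      fix x :: "nat \<times> nat" assume x: "fst x < p"
      \<comment> \<open>The reflection of the cyclic order that fixes the part of \<open>x\<close>;
        it exchanges the parts ahead of it with those behind.\<close>
      define h where "h j = nat ((2 * int (fst x) - int j) mod int p)" for j
      have h: "int (h j) = (2 * int (fst x) - int j) mod int p" for j using x by (simp add: h_def)
      have hp: "h j < p" for j
      proof -
        have "int (h j) < int p" unfolding h using x by simp
        then show ?thesis by simp
      qed
      have hh: "h (h j) = j" if "j < p" for j
      proof -
        have "int (h (h j)) = (2 * int (fst x) - (2 * int (fst x) - int j)) mod int p"
          unfolding h by (simp only: mod_diff_right_eq)
        then have "int (h (h j)) = int j" using that by simp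
        then show ?thesis by simp
      qed
      have \<delta>h: "\<delta> (fst x) (h j) = \<delta> j (fst x)" for j
        unfolding \<delta>_def h by (simp add: mod_diff_left_eq)
      have hne: "h j \<noteq> fst x" if "j < p" "j \<noteq> fst x" for j
      proof
        assume "h j = fst x"
        then have "j = h (fst x)" using hh[OF that(1)] by simp
        moreover have "h (fst x) = fst x" using x by (simp add: h_def)
        ultimately show False using that by simp
      qed
      show "\<exists>g. \<forall>a \<in> (({0..<p} - {fst x}) \<times> {0..<t}) \<times> {0..<lam}.
       g a \<in> (({0..<p} - {fst x}) \<times> {0..<t}) \<times> {0..<lam} \<and> g (g a) = a \<and>
       (2 * \<delta> (fst x) (fst (fst (g a))) < int p \<longleftrightarrow> \<not> 2 * \<delta> (fst x) (fst (fst a)) < int p)"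
      proof (rule exI[of _ "\<lambda>a. ((h (fst (fst a)), snd (fst a)), snd a)"], intro ballI)
        fix a assume "a \<in> (({0..<p} - {fst x}) \<times> {0..<t}) \<times> {0..<lam}"
        moreover obtain j l m where "a = ((j, l), m)" by (metis surj_pair)
        ultimately have a: "a = ((j, l), m)" "j < p" "j \<noteq> fst x" "l < t" "m < lam" by auto
        have "2 * \<delta> j (fst x) < int p \<longleftrightarrow> \<not> 2 * \<delta> (fst x) j < int p"
          using opp[OF x a(2)] a(3) half by simp
        then show "((h (fst (fst a)), snd (fst a)), snd a) \<in> (({0..<p} - {fst x}) \<times> {0..<t}) \<times> {0..<lam} \<and>
          ((h (fst (fst ((h (fst (fst a)), snd (fst a)), snd a))), snd (fst ((h (fst (fst a)), snd (fst a)), snd a))), snd ((h (fst (fst a)), snd (fst a)), snd a)) = a \<and>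
          (2 * \<delta> (fst x) (fst (fst ((h (fst (fst a)), snd (fst a)), snd a))) < int p \<longleftrightarrow> \<not> 2 * \<delta> (fst x) (fst (fst a)) < int p)"
          using a hp hh hne by (simp add: \<delta>h)
      qed
    qed
  qed
qed

lemma complete_multipartite_sel [simp]:
  "verts (complete_multipartite lam p t) = {0..<p} \<times> {0..<t}"
  "ends (complete_multipartite lam p t) = fst"
  by (simp_all add: complete_multipartite_def)

lemma edges_complete_multipartite:
  "e \<in> edges (complete_multipartite lam p t) \<longleftrightarrow> (\<exists>x y m. e = ({x, y}, m) \<and> x \<in> {0..<p} \<times> {0..<t} \<and>
    y \<in> {0..<p} \<times> {0..<t} \<and> fst x \<noteq> fst y \<and> m < lam)"
  by (cases e) (auto simp: complete_multipartite_def)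

text \<open>Every vertex has valency \<open>lam * ((p - 1) * t)\<close>, so \<open>d\<close> is the
  in- and out-degree of a balanced orientation, and counting the edges by their tails gives the face
  length.\<close>

theorem two_face_complete_multipartite:
  assumes d: "odd d" "lam * ((p - 1) * t) = 2 * d" and p: "p \<ge> 2"
  shows "\<exists>(X :: surface_point topology) \<psi>. closed_surface X \<and> orientable X \<and>
    biembedding (complete_multipartite lam p t) X \<psi> \<and> cellular (complete_multipartite lam p t) X \<psi> \<and>
    (\<forall>F\<in>faces (complete_multipartite lam p t) X \<psi>.
      has_face_length (complete_multipartite lam p t) X \<psi> F (p * t * d))"
proof -
  let ?G = "complete_multipartite lam p t"
  let ?V = "{0..<p} \<times> {0..<t}"
  have dpos: "d > 0" using d(1) by (cases d) auto
  then have tpos: "t > 0" using d(2) by (cases t) auto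
  have "even (lam * ((p - 1) * t))" using d by simp
  \<comment> \<open>An even product has an even factor, and each of the three possible factors has
    its own pairing in \<open>balanced_direction\<close>.\<close>
  then have par: "even lam \<or> even t \<or> odd p" using p by auto
  obtain D where D': "\<forall>m x y. fst x < p \<longrightarrow> fst y < p \<longrightarrow> fst x \<noteq> fst y \<longrightarrow> (D m y x \<longleftrightarrow> \<not> D m x y)"
    "\<forall>x. fst x < p \<longrightarrow> (\<exists>g. \<forall>a \<in> (({0..<p} - {fst x}) \<times> {0..<t}) \<times> {0..<lam}.
       g a \<in> (({0..<p} - {fst x}) \<times> {0..<t}) \<times> {0..<lam} \<and> g (g a) = a \<and>
       (D (snd (g a)) x (fst (g a)) \<longleftrightarrow> \<not> D (snd a) x (fst a)))"
    by (rule balanced_direction[OF par])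
  have D: "D m y x \<longleftrightarrow> \<not> D m x y" if "fst x < p" "fst y < p" "fst x \<noteq> fst y" for x y m
    using D'(1) that by blast
  define A where "A x = (({0..<p} - {fst x}) \<times> {0..<t}) \<times> {0..<lam}" for x :: "nat \<times> nat"
  \<comment> \<open>An edge stores only the unordered pair of its ends, so \<open>tail\<close> and
    \<open>head\<close> have to be recovered from \<open>D\<close>.\<close>
  define ends_of where "ends_of e xy \<longleftrightarrow> fst e = {fst xy, snd xy} \<and> fst (fst xy) \<noteq> fst (snd xy) \<and> D (snd e) (fst xy) (snd xy)"
    for e :: "(nat \<times> nat) set \<times> nat" and xy
  define tail head where "tail e = fst (THE xy. ends_of e xy)" and "head e = snd (THE xy. ends_of e xy)" for e
  have dir: "tail ({x, y}, m) = x" "head ({x, y}, m) = y"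
    if "x \<in> ?V" "y \<in> ?V" "fst x \<noteq> fst y" "D m x y" for x y m
  proof -
    have nD: "\<not> D m y x" using D[of x y m] that by auto
    have "(THE xy. ends_of ({x, y}, m) xy) = (x, y)"
    proof (rule the_equality)
      show "ends_of ({x, y}, m) (x, y)" using that by (simp add: ends_of_def)
      fix xy assume "ends_of ({x, y}, m) xy"
      then show "xy = (x, y)" using nD by (cases xy) (auto simp: ends_of_def doubleton_eq_iff)
    qed
    then show "tail ({x, y}, m) = x" "head ({x, y}, m) = y" by (simp_all add: tail_def head_def)
  qed
  have edge: "\<exists>x y m. e = ({x, y}, m) \<and> x \<in> ?V \<and> y \<in> ?V \<and> fst x \<noteq> fst y \<and> m < lam \<and> D m x y \<and> tail e = x \<and> head e = y"
    if "e \<in> edges ?G" for e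
  proof -
    obtain x y m where e: "e = ({x, y}, m)" "x \<in> ?V" "y \<in> ?V" "fst x \<noteq> fst y" "m < lam"
      using \<open>e \<in> edges ?G\<close> unfolding edges_complete_multipartite by blast
    show ?thesis
    proof (cases "D m x y")
      case True
      then show ?thesis using e dir[of x y m] by blast
    next
      case False
      then have yx: "D m y x" using D[of x y m] e by auto
      have "e = ({y, x}, m)" using e by (simp add: insert_commute)
      then show ?thesis using e yx dir[of y x m] by metis
    qed
  qed
  have in_edges: "({x, y}, m) \<in> edges ?G" if "x \<in> ?V" "y \<in> ?V" "fst x \<noteq> fst y" "m < lam" for x y m
    unfolding edges_complete_multipartite using that by blast
  have fin: "finite (edges ?G)"
    by (rule finite_subset[of _ "Pow ?V \<times> {0..<lam}"]) (auto simp: complete_multipartite_def)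
  have cardA: "card (A x) = 2 * d" if "x \<in> ?V" for x
  proof -
    have "card ({0..<p} - {fst x}) = p - 1" using that by auto
    then show ?thesis unfolding A_def card_cartesian_product using d(2) by (simp add: mult_ac)
  qed
  have A_iff: "(y, m) \<in> A x \<longleftrightarrow> y \<in> ?V \<and> fst y \<noteq> fst x \<and> m < lam" for x y m
    by (cases y) (auto simp: A_def)
  have half: "card {a \<in> A x. D (snd a) x (fst a)} = d" "card {a \<in> A x. \<not> D (snd a) x (fst a)} = d"
    if x: "x \<in> ?V" for x
  proof -
    have "fst x < p" using x by auto
    then obtain g where g: "\<forall>a\<in>A x. g a \<in> A x \<and> g (g a) = a \<and> (D (snd (g a)) x (fst (g a)) \<longleftrightarrow> \<not> D (snd a) x (fst a))"
      using D'(2) unfolding A_def by blast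
    have "finite (A x)" by (simp add: A_def)
    from card_involution_half[OF this, of g "\<lambda>a. D (snd a) x (fst a)"] g
    show "card {a \<in> A x. D (snd a) x (fst a)} = d" "card {a \<in> A x. \<not> D (snd a) x (fst a)} = d"
      using cardA[OF x] by auto
  qed
  have inj: "inj_on (\<lambda>a. ({x, fst a}, snd a)) (A x)" for x
    by (rule inj_onI) (auto simp: A_def doubleton_eq_iff)
  have ci: "card ((\<lambda>a. ({x, fst a}, snd a)) ` {a \<in> A x. B a}) = card {a \<in> A x. B a}" for x B
    by (rule card_image, rule inj_on_subset[OF inj]) auto
  have out: "card {e \<in> edges ?G. tail e = x} = d" and inn: "card {e \<in> edges ?G. head e = x} = d" if x: "x \<in> ?V" for x
  proof -
    have "{e \<in> edges ?G. tail e = x} = (\<lambda>a. ({x, fst a}, snd a)) ` {a \<in> A x. D (snd a) x (fst a)}"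
    proof (intro equalityI subsetI)
      fix e assume "e \<in> {e \<in> edges ?G. tail e = x}"
      then obtain y m where "e = ({x, y}, m)" "y \<in> ?V" "fst x \<noteq> fst y" "m < lam" "D m x y"
        using edge[of e] by auto
      then show "e \<in> (\<lambda>a. ({x, fst a}, snd a)) ` {a \<in> A x. D (snd a) x (fst a)}"
        using A_iff[of y m x] by (intro image_eqI[of _ _ "(y, m)"]) auto
    next
      fix e assume "e \<in> (\<lambda>a. ({x, fst a}, snd a)) ` {a \<in> A x. D (snd a) x (fst a)}"
      then obtain y m where e: "e = ({x, y}, m)" "(y, m) \<in> A x" "D m x y" by auto
      then have y: "y \<in> ?V" "fst x \<noteq> fst y" "m < lam" unfolding A_iff by auto
      then show "e \<in> {e \<in> edges ?G. tail e = x}"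
        using in_edges[OF x y] dir(1)[OF x y(1,2) e(3)] e(1) by simp
    qed
    then show "card {e \<in> edges ?G. tail e = x} = d"
      by (simp only: ci half(1)[OF x])
    have "{e \<in> edges ?G. head e = x} = (\<lambda>a. ({x, fst a}, snd a)) ` {a \<in> A x. \<not> D (snd a) x (fst a)}"
    proof (intro equalityI subsetI)
      fix e assume "e \<in> {e \<in> edges ?G. head e = x}"
      then obtain y m where e: "e = ({y, x}, m)" "y \<in> ?V" "fst y \<noteq> fst x" "m < lam" "D m y x"
        using edge[of e] by auto
      then have "\<not> D m x y" "e = ({x, y}, m)" using D[of x y m] x by (auto simp: insert_commute)
      then show "e \<in> (\<lambda>a. ({x, fst a}, snd a)) ` {a \<in> A x. \<not> D (snd a) x (fst a)}"
        using A_iff[of y m x] e by (intro image_eqI[of _ _ "(y, m)"]) auto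
    next
      fix e assume "e \<in> (\<lambda>a. ({x, fst a}, snd a)) ` {a \<in> A x. \<not> D (snd a) x (fst a)}"
      then obtain y m where e: "e = ({x, y}, m)" "(y, m) \<in> A x" "\<not> D m x y" by auto
      then have y: "y \<in> ?V" "fst y \<noteq> fst x" "m < lam" unfolding A_iff by auto
      then have "D m y x" "e = ({y, x}, m)" using D[of x y m] x e by (auto simp: insert_commute)
      then show "e \<in> {e \<in> edges ?G. head e = x}"
        using in_edges[OF y(1) x y(2,3)] dir(2)[OF y(1) x y(2)] by simp
    qed
    then show "card {e \<in> edges ?G. head e = x} = d"
      by (simp only: ci half(2)[OF x])
  qed
  have "tail e \<in> ?V" if "e \<in> edges ?G" for e using edge[OF that] by metis
  then have "edges ?G = (\<Union>x\<in>?V. {e \<in> edges ?G. tail e = x})" by blast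
  then have "card (edges ?G) = card (\<Union>x\<in>?V. {e \<in> edges ?G. tail e = x})" by (rule arg_cong)
  also have "\<dots> = (\<Sum>x\<in>?V. card {e \<in> edges ?G. tail e = x})"
    by (rule card_UN_disjoint) (use fin in auto)
  also have "\<dots> = p * t * d" using out by (simp add: card_cartesian_product)
  finally have N: "card (edges ?G) = p * t * d" .
  have "\<exists>(X :: surface_point topology) \<psi>. closed_surface X \<and> orientable X \<and> biembedding ?G X \<psi> \<and>
    cellular ?G X \<psi> \<and> (\<forall>F\<in>faces ?G X \<psi>. has_face_length ?G X \<psi> F (card (edges ?G)))"
  proof (rule two_face_biembedding[where tail = tail and head = head and d = d])
    show "finite (edges ?G)" by (rule fin)
    show "finite (verts ?G)" by simp
    show "verts ?G \<noteq> {}" using p tpos by simp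
    show "ends ?G e = {tail e, head e}" "tail e \<in> verts ?G" "head e \<in> verts ?G" "tail e \<noteq> head e"
      if "e \<in> edges ?G" for e using edge[OF that] by auto
    show "card {e \<in> edges ?G. tail e = x} = d" "card {e \<in> edges ?G. head e = x} = d" if "x \<in> verts ?G" for x
      using out inn that by auto
    show "odd d" by (rule d(1))
    fix T x y assume T: "\<And>e. e \<in> edges ?G \<Longrightarrow> tail e \<in> T \<longleftrightarrow> head e \<in> T"
      and x: "x \<in> verts ?G" "x \<in> T" and y: "y \<in> verts ?G"
    have lam: "0 < lam" using d dpos by (cases lam) auto
    have adj: "z \<in> T" if "u \<in> T" "u \<in> ?V" "z \<in> ?V" "fst u \<noteq> fst z" for u z
    proof -
      have e: "({u, z}, 0) \<in> edges ?G" by (rule in_edges[OF that(2-4) lam])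
      obtain x' y' where "{u, z} = {x', y'}" "tail ({u, z}, 0) = x'" "head ({u, z}, 0) = y'"
        using edge[OF e] by (metis prod.inject)
      then have "u = x' \<and> z = y' \<or> u = y' \<and> z = x'" "x' \<in> T \<longleftrightarrow> y' \<in> T"
        using T[OF e] by (simp_all add: doubleton_eq_iff)
      then show ?thesis using that(1) by blast
    qed
    show "y \<in> T"
    proof (cases "fst x = fst y")
      case False
      then show ?thesis using adj[of x y] x y by simp
    next
      case True
      \<comment> \<open>Vertices of one part are connected through a vertex of another part, which
        exists because \<open>p \<ge> 2\<close>.\<close>
      define z :: "nat \<times> nat" where "z = (if fst x = 0 then 1 else 0, 0)"
      have "z \<in> ?V" "fst x \<noteq> fst z" "fst z \<noteq> fst y" using p tpos True by (auto simp: z_def)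
      then show ?thesis using adj[of x z] adj[of z y] x y by simp
    qed
  qed
  then show ?thesis unfolding N .
qed

theorem theorem7p7:
  fixes v t lam n k :: nat
  assumes "(even v \<and> v \<ge> 42) \<or> (odd v \<and> v \<ge> 29)"
    and "t dvd v"
    and "lam > 0"
    and "odd n" and "odd k" and "n \<ge> k" and "k \<ge> 3"
    and "real v = 2 * real n * real k / real lam + real t"
    and "gcd n (k - 1) = 1 \<or> (3 < k \<and> k < 200) \<or> n \<ge> (k - 2) * (k - 1)"
  shows "\<exists>p :: nat. real p = 2 * real n * real k / (real lam * real t) + 1 \<and>
    (\<exists>(X :: surface_point topology) \<psi>.
       closed_surface X \<and> orientable X \<and>
       biembedding (complete_multipartite lam p t) X \<psi> \<and>
       cellular (complete_multipartite lam p t) X \<psi> \<and>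
       (\<forall>F \<in> faces (complete_multipartite lam p t) X \<psi>.
          \<exists>l. has_face_length (complete_multipartite lam p t) X \<psi> F l \<and> k dvd l \<and> k < l))"
proof -
  obtain p where p: "v = t * p" using \<open>t dvd v\<close> by blast
  have "v > 0" using assms(1) by auto
  then have t: "t > 0" using p by simp
  have "2 * real n * real k / real lam > 0" using assms by simp
  then have "real t < real v" using assms(8) by linarith
  then have p2: "p \<ge> 2" using p t by (cases "p = 0 \<or> p = 1") auto
  \<comment> \<open>Clearing denominators with \<open>v = t * p\<close> gives the valency equation
    with \<open>d = n * k\<close>.\<close>
  have "real lam * (real t * real p - real t) = 2 * real n * real k"
    using assms(3,8) by (simp add: p field_simps)
  then have "real (lam * ((p - 1) * t)) = real (2 * (n * k))"
    using p2 by (simp add: of_nat_diff algebra_simps)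
  then have deg: "lam * ((p - 1) * t) = 2 * (n * k)" by (simp only: of_nat_eq_iff)
  have odd: "odd (n * k)" using assms by simp
  \<comment> \<open>The face length \<open>p * t * (n * k)\<close> exceeds \<open>k\<close> because
    \<open>n > 1\<close> and \<open>p * t \<ge> 1\<close>.\<close>
  have "1 * k < (p * t * n) * k"
  proof (rule mult_strict_right_mono)
    have "1 < n" using assms by simp
    moreover have "1 \<le> p * t" using p2 t by simp
    ultimately show "1 < p * t * n" by (metis less_1_mult' mult_le_mono nat_mult_1 order_less_le_trans le_refl)
  qed (use assms in simp)
  then have len: "k dvd p * t * (n * k)" "k < p * t * (n * k)" by (simp_all add: mult_ac)
  show ?thesis
  proof (rule exI[of _ p], rule conjI)
    show "real p = 2 * real n * real k / (real lam * real t) + 1"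
      using assms(3,8) t by (simp add: p field_simps)
    show "\<exists>(X :: surface_point topology) \<psi>.
       closed_surface X \<and> orientable X \<and>
       biembedding (complete_multipartite lam p t) X \<psi> \<and>
       cellular (complete_multipartite lam p t) X \<psi> \<and>
       (\<forall>F \<in> faces (complete_multipartite lam p t) X \<psi>.
          \<exists>l. has_face_length (complete_multipartite lam p t) X \<psi> F l \<and> k dvd l \<and> k < l)"
      using two_face_complete_multipartite[OF odd deg p2] len by blast
  qed
qed

end
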